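(* Identify $\gamma\in\mathrm{Loop}^1(\mathbb C\setminus\{0\})$ with the pair $(u,\rho_\infty)$. In these coordinates $$d\mu_0(u,\rho_\infty)=d\nu_0(u)\times\frac{d\rho_\infty}{\rho_\infty},$$ where $\nu_0$ is a finite measure on the set of $u$ (which can therefore be normalized to have unit mass).
   Context: For a Riemann surface $S$, $\mathrm{Loop}(S)$ is the set of compact subsets of $S$ homeomorphic to the circle $S^1$, with the Vietoris topology. A family of positive Borel measures $\mu_S$ on $\mathrm{Loop}(S)$, one for each Riemann surface $S$, satisfies conformal restriction if for each conformal embedding $S_1\to S_2$ the restriction of $\mu_{S_2}$ to $\mathrm{Loop}(S_1)$ equals $\mu_{S_1}$. It is nontrivial if for some $0<\alpha<A$ the set of loops $\gamma\in \mathrm{Loop}(\{0<|z|<A\})\setminus \mathrm{Loop}(\{|z|<\alpha\})$ surrounding $0$ has finite positive measure. By a theorem of Werner such a nontrivial family exists and is unique up to a positive constant. $\mathrm{Loop}^1(\mathbb C\setminus\{0\})$ is the set of loops in $\mathbb C\setminus\{0\}$ which surround $0$, and $\mu_0$ is the restriction of Werner's measure to $\mathrm{Loop}^1(\mathbb C\setminus\{0\})$. Let $\Delta=\{|z|<1\}$ and $\Delta^*=\{|z|>1\}\cup\{\infty\}$. For $\gamma\in\mathrm{Loop}^1(\mathbb C\setminus\{0\})$ let $U_+\ni 0$ and $U_-\ni\infty$ be the two components of $(\mathbb C\cup\{\infty\})\setminus\gamma$. Let $\phi_+:(\Delta,0)\to(U_+,0)$ be the conformal isomorphism normalized by $\phi_+(z)=\rho_0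 u(z)$, $u(z)=z(1+\sum_{n\ge1}u_nz^n)$, $\rho_0>0$, and $\phi_-:(\Delta^*,\infty)\to(U_-,\infty)$ the conformal isomorphism normalized by $\phi_-(z)=\rho_\infty z(1+\sum_{n\ge1}b_nz^{-n})$, $\rho_\infty>0$. The measure $\mu_0$ is determined up to a positive multiplicative constant, and the overall constant is chosen suitably in the displayed formula. *)

theory Defs
  imports "HOL-Complex_Analysis.Complex_Analysis" "HOL-Probability.Probability"
begin

section \<open>Riemann surfaces and conformal maps\<close>

text \<open>
  A chart is a pair of its domain and a map that is relevant only on that domain. The atlas is not
  required to be maximal; two compatible atlases on one space are related by an identity map that
  is a conformal embedding in both directions.
\<close>

record 'a surface =
  surface_top :: "'a topology"
  atlas :: "('a set \<times> ('a \<Rightarrow> complex)) set"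

definition riemann_surface :: "'a surface \<Rightarrow> bool" where
  "riemann_surface S \<longleftrightarrow>
     Hausdorff_space (surface_top S) \<and>
     connected_space (surface_top S) \<and>
     topspace (surface_top S) \<noteq> {} \<and>
     (\<Union>(U, \<phi>)\<in>atlas S. U) = topspace (surface_top S) \<and>
     (\<forall>(U, \<phi>)\<in>atlas S.
        openin (surface_top S) U \<and> open (\<phi> ` U) \<and>
        homeomorphic_map (subtopology (surface_top S) U) (top_of_set (\<phi> ` U)) \<phi>) \<and>
     (\<forall>(U, \<phi>)\<in>atlas S. \<forall>(V, \<psi>)\<in>atlas S.
        (\<psi> \<circ> inv_into U \<phi>) holomorphic_on \<phi> ` (U \<inter> V))"

definition holomorphic_map :: "'a surface \<Rightarrow> 'b surface \<Rightarrow> ('a \<Rightarrow> 'b) \<Rightarrow> bool" where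
  "holomorphic_map S T f \<longleftrightarrow>
     continuous_map (surface_top S) (surface_top T) f \<and>
     (\<forall>(U, \<phi>)\<in>atlas S. \<forall>(V, \<psi>)\<in>atlas T.
        (\<psi> \<circ> f \<circ> inv_into U \<phi>) holomorphic_on \<phi> ` (U \<inter> f -` V))"

definition conformal_embedding :: "'a surface \<Rightarrow> 'b surface \<Rightarrow> ('a \<Rightarrow> 'b) \<Rightarrow> bool" where
  "conformal_embedding S T f \<longleftrightarrow>
     holomorphic_map S T f \<and> inj_on f (topspace (surface_top S))"

definition conformal_iso :: "'a surface \<Rightarrow> 'b surface \<Rightarrow> ('a \<Rightarrow> 'b) \<Rightarrow> bool" where
  "conformal_iso S T f \<longleftrightarrow>
     holomorphic_map S T f \<and>
     bij_betw f (topspace (surface_top S)) (topspace (surface_top T)) \<and>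
     holomorphic_map T S (inv_into (topspace (surface_top S)) f)"

definition subsurface :: "'a surface \<Rightarrow> 'a set \<Rightarrow> 'a surface" where
  "subsurface S D =
     \<lparr>surface_top = subtopology (surface_top S) D, atlas = (\<lambda>(U, \<phi>). (U \<inter> D, \<phi>)) ` atlas S\<rparr>"

text \<open>The Riemann sphere: \<open>None\<close> is the point at infinity, the charts are \<open>z\<close> and \<open>1 / z\<close>.\<close>

definition riemann_sphere :: "complex option surface" where
  "riemann_sphere =
     \<lparr>surface_top = Alexandroff_compactification euclidean,
      atlas = {(range Some, the),
               (UNIV - {Some 0}, \<lambda>p. case p of None \<Rightarrow> 0 | Some z \<Rightarrow> inverse z)}\<rparr>"

abbreviation sphere_domain :: "complex option set \<Rightarrow> complex option surface" where
  "sphere_domain \<equiv> subsurface riemann_sphere"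

section \<open>Loops and conformal restriction\<close>

definition Loop :: "'a surface \<Rightarrow> 'a set set" where
  "Loop S =
     {\<gamma>. compactin (surface_top S) \<gamma> \<and>
         subtopology (surface_top S) \<gamma> homeomorphic_space top_of_set (sphere (0::complex) 1)}"

definition vietoris :: "'a surface \<Rightarrow> 'a set topology" where
  "vietoris S = topology_generated_by
     ({{\<gamma>\<in>Loop S. \<gamma> \<subseteq> U} |U. openin (surface_top S) U} \<union>
      {{\<gamma>\<in>Loop S. \<gamma> \<inter> U \<noteq> {}} |U. openin (surface_top S) U})"

definition loop_borel :: "'a surface \<Rightarrow> 'a set measure" where
  "loop_borel S = sigma (Loop S) {W. openin (vietoris S) W}"

text \<open>
  A family of measures is indexed by all Riemann surfaces whose points lie in a fixed type. For
  \<open>'a = complex option\<close> this comprises the sphere and all its subdomains, and, since a Riemann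
  surface has the cardinality of the continuum, an isomorphic copy of every Riemann surface.
\<close>

definition loop_measure_family :: "('a surface \<Rightarrow> 'a set measure) \<Rightarrow> bool" where
  "loop_measure_family \<mu> \<longleftrightarrow> (\<forall>S. riemann_surface S \<longrightarrow> sets (\<mu> S) = sets (loop_borel S))"

text \<open>
  A conformal embedding \<open>f\<close> identifies \<open>Loop S\<close> with the open subset of loops in \<open>Loop T\<close> that
  lie in the image of \<open>f\<close>.
\<close>

definition conformal_restriction :: "('a surface \<Rightarrow> 'a set measure) \<Rightarrow> bool" where
  "conformal_restriction \<mu> \<longleftrightarrow>
     (\<forall>S T f. riemann_surface S \<longrightarrow> riemann_surface T \<longrightarrow> conformal_embedding S T f \<longrightarrow>
        (\<forall>E\<in>sets (\<mu> S). emeasure (\<mu> S) E = emeasure (\<mu> T) ((`) f ` E)))"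

definition surrounds_0 :: "complex option set \<Rightarrow> bool" where
  "surrounds_0 \<gamma> \<longleftrightarrow> 0 \<in> inside (Some -` \<gamma>)"

abbreviation disc :: "real \<Rightarrow> complex option surface" where
  "disc r \<equiv> sphere_domain (Some ` {z. cmod z < r})"

abbreviation punctured_disc :: "real \<Rightarrow> complex option surface" where
  "punctured_disc r \<equiv> sphere_domain (Some ` {z. 0 < cmod z \<and> cmod z < r})"

abbreviation punctured_plane :: "complex option surface" where
  "punctured_plane \<equiv> sphere_domain (Some ` (UNIV - {0}))"

definition nontrivial :: "(complex option surface \<Rightarrow> complex option set measure) \<Rightarrow> bool" where
  "nontrivial \<mu> \<longleftrightarrow>
     (\<exists>\<alpha> A. 0 < \<alpha> \<and> \<alpha> < A \<and>
        (let m = emeasure (\<mu> (punctured_disc A))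
                   {\<gamma> \<in> Loop (punctured_disc A) - Loop (disc \<alpha>). surrounds_0 \<gamma>}
         in 0 < m \<and> m < \<infinity>))"

definition Loop1 :: "complex option set set" where
  "Loop1 = {\<gamma> \<in> Loop punctured_plane. surrounds_0 \<gamma>}"

definition mu0 ::
  "(complex option surface \<Rightarrow> complex option set measure) \<Rightarrow> complex option set measure" where
  "mu0 \<mu> = restrict_space (\<mu> punctured_plane) Loop1"

section \<open>Uniformizing coordinates\<close>

definition complement_component :: "complex option set \<Rightarrow> complex option \<Rightarrow> complex option set" where
  "complement_component \<gamma> p =
     connected_component_of_set (surface_top (sphere_domain (UNIV - \<gamma>))) p"

abbreviation U_plus :: "complex option set \<Rightarrow> complex option set" where
  "U_plus \<gamma> \<equiv> complement_component \<gamma> (Some 0)"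

abbreviation U_minus :: "complex option set \<Rightarrow> complex option set" where
  "U_minus \<gamma> \<equiv> complement_component \<gamma> None"

text \<open>
  The normalized function \<open>u\<close> is represented by the sequence \<open>1, u\<^sub>1, u\<^sub>2, \<dots>\<close> of the coefficients
  of \<open>u z / z\<close>, and likewise for the exterior map.
\<close>

definition is_phi_plus ::
  "complex option set \<Rightarrow> real \<Rightarrow> (nat \<Rightarrow> complex) \<Rightarrow> (complex option \<Rightarrow> complex option) \<Rightarrow> bool" where
  "is_phi_plus \<gamma> \<rho> u \<phi> \<longleftrightarrow>
     conformal_iso (disc 1) (sphere_domain (U_plus \<gamma>)) \<phi> \<and> \<phi> (Some 0) = Some 0 \<and>
     0 < \<rho> \<and> u 0 = 1 \<and>
     (\<forall>z. cmod z < 1 \<longrightarrow>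
        summable (\<lambda>n. u n * z ^ n) \<and>
        \<phi> (Some z) = Some (of_real \<rho> * (z * (\<Sum>n. u n * z ^ n))))"

definition is_phi_minus ::
  "complex option set \<Rightarrow> real \<Rightarrow> (nat \<Rightarrow> complex) \<Rightarrow> (complex option \<Rightarrow> complex option) \<Rightarrow> bool" where
  "is_phi_minus \<gamma> \<rho> b \<phi> \<longleftrightarrow>
     conformal_iso (sphere_domain (insert None (Some ` {z. 1 < cmod z})))
       (sphere_domain (U_minus \<gamma>)) \<phi> \<and> \<phi> None = None \<and>
     0 < \<rho> \<and> b 0 = 1 \<and>
     (\<forall>z. 1 < cmod z \<longrightarrow>
        summable (\<lambda>n. b n * inverse z ^ n) \<and>
        \<phi> (Some z) = Some (of_real \<rho> * (z * (\<Sum>n. b n * inverse z ^ n))))"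

definition u_coord :: "complex option set \<Rightarrow> nat \<Rightarrow> complex" where
  "u_coord \<gamma> = (THE u. \<exists>\<rho> \<phi>. is_phi_plus \<gamma> \<rho> u \<phi>)"

definition rho_infinity :: "complex option set \<Rightarrow> real" where
  "rho_infinity \<gamma> = (THE \<rho>. \<exists>b \<phi>. is_phi_minus \<gamma> \<rho> b \<phi>)"

definition loop_coords :: "complex option set \<Rightarrow> (nat \<Rightarrow> complex) \<times> real" where
  "loop_coords \<gamma> = (u_coord \<gamma>, rho_infinity \<gamma>)"

definition u_set :: "(nat \<Rightarrow> complex) set" where
  "u_set = u_coord ` Loop1"

text \<open>
  Borel sets of the product topology on coefficient sequences; on univalent functions this is the
  topology of locally uniform convergence.
\<close>

definition u_borel :: "(nat \<Rightarrow> complex) measure" where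
  "u_borel = restrict_space borel u_set"

definition rho_borel :: "real measure" where
  "rho_borel = restrict_space borel {0<..}"

definition drho_over_rho :: "real measure" where
  "drho_over_rho = density (restrict_space lborel {0<..}) (\<lambda>\<rho>. ennreal (1 / \<rho>))"

end

theory Submission
  imports Defs
begin

text \<open>
  Conformal restriction under \<open>z \<mapsto> c * z\<close> makes \<open>\<mu>\<^sub>0\<close> scaling invariant, and in the coordinates \<open>(u, \<rho>\<^sub>\<infinity>)\<close>
  scaling acts on the second factor only. Hence \<open>\<mu>\<^sub>0(u \<in> B, \<rho>\<^sub>\<infinity> \<in> E)\<close> is, as a function of \<open>E\<close>, proportional
  to Haar measure \<open>d\<rho> / \<rho>\<close> of the multiplicative group.
  Finiteness of \<open>\<nu>\<^sub>0\<close> needs no distortion theorem: if \<open>p\<close> and \<open>q\<close> are positive functions of the loop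
  that are homogeneous of degree 1, then by Tonelli's theorem the set \<open>{p \<in> I}\<close> has the same measure as \<open>{q \<in> I}\<close>.
  Applied to \<open>p = \<rho>\<^sub>\<infinity>\<close> and \<open>q(\<gamma>) = max |z|\<close> over \<open>z \<in> \<gamma>\<close>, for which finiteness is the nontriviality hypothesis,
  this gives the claim.
  Measurability of the coordinates follows from the lower semicontinuity of the conformal radius
  and the near-equality case of the Schwarz lemma; the inversion \<open>z \<mapsto> 1 / z\<close> reduces \<open>\<rho>\<^sub>\<infinity>\<close> to the
  conformal radius of the inside of the inverted loop.
\<close>

section \<open>Scaling-invariant measures\<close>

text \<open>Tonelli presupposes a sigma-finite \<mu>0, and only one set of finite measure is given;
  its dilates by the powers of b / a tile the loops around 0, which supplies sigma-finiteness. The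
  value \<nu>0(B) is then \<mu>0(u in B, \<open>rho_infinity\<close> in I) divided by the mass of an
  interval I under d\<rho> / \<rho>, and the exchange identity shows that this quotient is the same
  for every choice of I.

  The other obstacle is that u depends on the whole loop through a Riemann map. Kernel convergence
  of domains is avoided by a one-sided test. A loop around 0 that misses the image f(|z| <= s), s <
  1, of some normalized Riemann map f must surround this image. This is an open condition on the
  loop, and it bounds the conformal radius of the inside from below. Combined with an upper bound
  for that radius it controls every Taylor coefficient. Hence the coordinates are measured using
  only sets of loops contained in some member of a family of open sets.\<close>

lemma space_drho_over_rho [simp]: "space drho_over_rho = {0<..}"
  and sets_drho_over_rho [simp, measurable_cong]: "sets drho_over_rho = sets rho_borel"
  and space_rho_borel [simp]: "space rho_borel = {0<..}"
  by (auto simp: drho_over_rho_def rho_borel_def space_restrict_space sets_restrict_space)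

lemma emeasure_drho_over_rho:
  assumes "E \<in> sets rho_borel"
  shows "emeasure drho_over_rho E = (\<integral>\<^sup>+ t. ennreal (1 / t) * indicator E t \<partial>lborel)"
proof -
  have E: "E \<in> sets borel" "E \<subseteq> {0<..}"
    using assms by (auto simp: rho_borel_def sets_restrict_space)
  have "emeasure drho_over_rho E = (\<integral>\<^sup>+ t. ennreal (1 / t) * indicator E t \<partial>restrict_space lborel {0<..})"
    unfolding drho_over_rho_def using assms
    by (intro emeasure_density) (auto simp: rho_borel_def sets_restrict_space intro!: measurable_restrict_space1)
  also have "\<dots> = (\<integral>\<^sup>+ t. ennreal (1 / t) * indicator E t * indicator {0<..} t \<partial>lborel)"
    by (intro nn_integral_restrict_space) auto
  also have "\<dots> = (\<integral>\<^sup>+ t. ennreal (1 / t) * indicator E t \<partial>lborel)"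
    using E(2) by (intro nn_integral_cong) (auto simp: indicator_def)
  finally show ?thesis .
qed

text \<open>The Jacobian \<open>q\<close> of the substitution cancels against the density 1 / (q t).
  The set of \<open>t\<close> with \<open>t * q\<close> in \<open>E\<close> is the form in which
  slices appear in the Tonelli argument.\<close>

lemma drho_over_rho_scale:
  assumes E: "E \<in> sets rho_borel" and q: "0 < q"
  shows "{t\<in>{0<..}. t * q \<in> E} \<in> sets rho_borel"
    and "emeasure drho_over_rho {t\<in>{0<..}. t * q \<in> E} = emeasure drho_over_rho E"
proof -
  have E'[measurable]: "E \<in> sets borel" and "E \<subseteq> {0<..}"
    using E by (auto simp: rho_borel_def sets_restrict_space)
  note E' = this
  have "(\<lambda>t. t * q) \<in> borel \<rightarrow>\<^sub>M borel"
    by measurable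
  from measurable_sets[OF this E'(1)]
  have "(\<lambda>t. t * q) -` E \<in> sets borel" by simp
  moreover have eq: "{t\<in>{0<..}. t * q \<in> E} = {0<..} \<inter> (\<lambda>t. t * q) -` E"
    by auto
  ultimately show meas: "{t\<in>{0<..}. t * q \<in> E} \<in> sets rho_borel"
    by (auto simp: rho_borel_def sets_restrict_space)
  have "emeasure drho_over_rho E = (\<integral>\<^sup>+ t. ennreal (1 / t) * indicator E t \<partial>lborel)"
    by (rule emeasure_drho_over_rho[OF E])
  also have "\<dots> = ennreal \<bar>q\<bar> * (\<integral>\<^sup>+ t. ennreal (1 / (0 + q * t)) * indicator E (0 + q * t) \<partial>lborel)"
    using q E'(1) by (intro nn_integral_real_affine) auto
  also have "\<dots> = (\<integral>\<^sup>+ t. ennreal \<bar>q\<bar> * (ennreal (1 / (0 + q * t)) * indicator E (0 + q * t)) \<partial>lborel)"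
    by (intro nn_integral_cmult[symmetric]) measurable
  also have "\<dots> = (\<integral>\<^sup>+ t. ennreal (1 / t) * indicator {t\<in>{0<..}. t * q \<in> E} t \<partial>lborel)"
  proof (intro nn_integral_cong)
    fix t :: real
    have "q * t \<in> E \<Longrightarrow> 0 < t"
      using E'(2) q by (auto simp: zero_less_mult_iff)
    then show "ennreal \<bar>q\<bar> * (ennreal (1 / (0 + q * t)) * indicator E (0 + q * t)) =
        ennreal (1 / t) * indicator {t\<in>{0<..}. t * q \<in> E} t"
      using q by (auto simp: indicator_def mult.commute ennreal_mult[symmetric])
  qed
  finally show "emeasure drho_over_rho {t\<in>{0<..}. t * q \<in> E} = emeasure drho_over_rho E"
    by (simp only: emeasure_drho_over_rho[OF meas])
qed

lemma emeasure_drho_over_rho_Icc: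
  assumes "0 < a" "a < b"
  shows "emeasure drho_over_rho {a..b} = ennreal (ln (b / a))"
proof -
  have "emeasure drho_over_rho {a..b} = (\<integral>\<^sup>+ t. ennreal (1 / t) * indicator {a..b} t \<partial>lborel)"
    using assms by (intro emeasure_drho_over_rho) (auto simp: rho_borel_def sets_restrict_space)
  also have "\<dots> = ennreal (ln b - ln a)"
    using assms by (intro nn_integral_FTC_Icc) (auto intro!: derivative_eq_intros)
  finally show ?thesis
    using assms by (simp add: ln_div)
qed

lemma Ico_in_rho_borel: "0 < a \<Longrightarrow> {a..<b} \<in> sets rho_borel"
  by (auto simp: rho_borel_def sets_restrict_space intro!: image_eqI[of _ _ "{a..<b}"])

text \<open>Half-open intervals are the form in which nontriviality arrives: in the disc of radius b
  but not in that of radius a means maximal modulus in \<open>{a..<b}\<close>. They also tile the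
  half-line under dilation.\<close>

lemma emeasure_drho_over_rho_Ico:
  assumes "0 < a" "a < b"
  shows "emeasure drho_over_rho {a..<b} = ennreal (ln (b / a))"
proof -
  have "emeasure drho_over_rho {b} = 0"
    using assms by (subst emeasure_drho_over_rho)
      (auto simp: rho_borel_def sets_restrict_space intro!: image_eqI[of _ _ "{b}"])
  moreover have "{a..b} = {a..<b} \<union> {b}"
    using assms by auto
  moreover have "emeasure drho_over_rho ({a..<b} \<union> {b}) = emeasure drho_over_rho {a..<b} + emeasure drho_over_rho {b}"
    using assms Ico_in_rho_borel by (intro plus_emeasure[symmetric])
      (auto simp: rho_borel_def sets_restrict_space intro!: image_eqI[of _ _ "{b}"])
  ultimately show ?thesis
    using emeasure_drho_over_rho_Icc[OF assms] by simp
qed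

lemma sigma_finite_drho_over_rho: "sigma_finite_measure drho_over_rho"
proof
  \<comment> \<open>The shift by 2 gives 1 / (n + 2) < 1 < n + 2 already for n = 0, so the formula
    for a proper interval applies to every member.\<close>
  let ?F = "\<lambda>n::nat. {1 / (real n + 2)..<real n + 2}"
  have "\<exists>n. x \<in> ?F n" if "0 < x" for x
  proof -
    obtain n where n: "max x (1 / x) < real n"
      using reals_Archimedean2 by blast
    have "1 / (real n + 2) \<le> 1 / (1 / x)"
      using n that by (intro divide_left_mono) (auto simp: field_simps)
    with that n show ?thesis
      by (intro exI[of _ n]) auto
  qed
  then have "\<Union>(range ?F) = space drho_over_rho"
    by (auto simp: zero_less_divide_iff intro: less_le_trans[rotated])
  moreover have "emeasure drho_over_rho (?F n) \<noteq> \<infinity>" for n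
  proof -
    have "1 / (real n + 2) < 1" "1 < real n + 2"
      by auto
    then have "1 / (real n + 2) < real n + 2"
      by (rule less_trans)
    then show ?thesis
      by (subst emeasure_drho_over_rho_Ico) auto
  qed
  moreover have "range ?F \<subseteq> sets drho_over_rho"
    by (auto intro!: Ico_in_rho_borel)
  ultimately show "\<exists>A. countable A \<and> A \<subseteq> sets drho_over_rho \<and> \<Union>A = space drho_over_rho \<and>
      (\<forall>a\<in>A. emeasure drho_over_rho a \<noteq> \<infinity>)"
    by (intro exI[of _ "range ?F"]) auto
qed

section \<open>Product decomposition of a scaling-invariant measure\<close>

text \<open>Separates the measure theory from the geometry. The locale is interpreted twice: for
  loops under dilation, and for dt / t under multiplication.\<close>

locale scaling_action =
  fixes M :: "'a measure" and S :: "real \<Rightarrow> 'a \<Rightarrow> 'a"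
  assumes S_measurable: "0 < c \<Longrightarrow> S c \<in> M \<rightarrow>\<^sub>M M"
    and S_preserves: "0 < c \<Longrightarrow> distr M M (S c) = M"
begin

text \<open>Positivity is carried by the target space, since \<open>rho_borel\<close> lives on
  \<open>{0<..}\<close>.\<close>

definition homogeneous :: "('a \<Rightarrow> real) \<Rightarrow> bool" where
  "homogeneous p \<longleftrightarrow> p \<in> M \<rightarrow>\<^sub>M rho_borel \<and> (\<forall>c>0. \<forall>x\<in>space M. p (S c x) = c * p x)"

definition invariant_set :: "'a set \<Rightarrow> bool" where
  "invariant_set A \<longleftrightarrow> A \<in> sets M \<and> (\<forall>c>0. \<forall>x\<in>space M. S c x \<in> A \<longleftrightarrow> x \<in> A)"

lemma invariant_set_space: "invariant_set (space M)"
  using S_measurable by (auto simp: invariant_set_def dest: measurable_space)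

lemma emeasure_homogeneous_scale:
  assumes "homogeneous p" "0 < c"
  shows "emeasure M {x\<in>space M. p x \<in> {c * a..<c * b}} = emeasure M {x\<in>space M. p x \<in> {a..<b}}"
proof -
  have [measurable]: "p \<in> M \<rightarrow>\<^sub>M borel"
    using assms(1) by (auto simp: homogeneous_def rho_borel_def measurable_restrict_space2_iff)
  have [measurable]: "S c \<in> M \<rightarrow>\<^sub>M M"
    using S_measurable assms by auto
  have "emeasure M {x\<in>space M. p x \<in> {c * a..<c * b}} =
      emeasure (distr M M (S c)) {x\<in>space M. p x \<in> {c * a..<c * b}}"
    using S_preserves[OF assms(2)] by simp
  also have "\<dots> = emeasure M (S c -` {x\<in>space M. p x \<in> {c * a..<c * b}} \<inter> space M)"
    by (intro emeasure_distr) measurable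
  also have "S c -` {x\<in>space M. p x \<in> {c * a..<c * b}} \<inter> space M = {x\<in>space M. p x \<in> {a..<b}}"
    using assms measurable_space[OF S_measurable[OF assms(2)]] by (auto simp: homogeneous_def)
  finally show ?thesis .
qed

text \<open>The set a <= q < b is a fundamental domain for multiplication by r = b / a. Its dilates
  by the integer powers of r tile the space and all have the same finite measure.\<close>

lemma sigma_finiteI:
  assumes q: "homogeneous q" and ab: "0 < a" "a < b"
    and fin: "emeasure M {x\<in>space M. q x \<in> {a..<b}} < \<infinity>"
  shows "sigma_finite_measure M"
proof
  define r where "r = b / a"
  have r: "1 < r" "b = r * a"
    using ab by (auto simp: r_def)
  let ?F = "\<lambda>k::int. {x\<in>space M. q x \<in> {r powi k * a..<r powi k * b}}"
  have q': "q \<in> M \<rightarrow>\<^sub>M borel" "\<And>x. x \<in> space M \<Longrightarrow> 0 < q x"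
    using q by (auto simp: homogeneous_def rho_borel_def measurable_restrict_space2_iff)
  note [measurable] = q'(1)
  have "\<exists>k. x \<in> ?F k" if x: "x \<in> space M" for x
  proof
    \<comment> \<open>The floor k of this logarithm satisfies r^k a <= q x < r^(k+1) a, and r^(k+1)
      a = r^k b.\<close>
    let ?l = "log r (q x / a)"
    have "r powr of_int \<lfloor>?l\<rfloor> \<le> r powr ?l"
      using r by (intro powr_mono) auto
    moreover have "r powr ?l < r powr (of_int \<lfloor>?l\<rfloor> + 1)"
      using r by (intro powr_less_mono) auto
    moreover have "r powr ?l = q x / a"
      using r q'(2)[OF x] ab by simp
    ultimately show "x \<in> ?F \<lfloor>?l\<rfloor>"
      using x r ab by (auto simp: powr_real_of_int' powr_add field_simps)
  qed
  then have "\<Union>(range ?F) = space M"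
    by auto
  moreover have "emeasure M (?F k) \<noteq> \<infinity>" for k
    using emeasure_homogeneous_scale[OF q, of "r powi k" a b] fin r by simp
  ultimately show "\<exists>A. countable A \<and> A \<subseteq> sets M \<and> \<Union>A = space M \<and> (\<forall>a\<in>A. emeasure M a \<noteq> \<infinity>)"
    by (intro exI[of _ "range ?F"]) auto
qed

text \<open>Both sides compute the measure of \<open>{(x, t). x \<in> A \<and> p x \<in> E1 \<and> t * q x \<in> E2}\<close>
  under \<open>M\<close> times \<open>dt / t\<close>; the second one after the substitution \<open>x \<mapsto> S (1 / t) x\<close>.\<close>

lemma emeasure_exchange_aux:
  assumes "sigma_finite_measure M" "homogeneous p" "homogeneous q" "invariant_set A"
    and [measurable]: "E1 \<in> sets rho_borel" "E2 \<in> sets rho_borel"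
  shows "emeasure M {x\<in>A. p x \<in> E1} * emeasure drho_over_rho E2 =
         emeasure M {x\<in>A. q x \<in> E2} * emeasure drho_over_rho {t\<in>{0<..}. 1 / t \<in> E1}"
proof -
  interpret M: sigma_finite_measure M by fact
  interpret L: sigma_finite_measure drho_over_rho by (rule sigma_finite_drho_over_rho)
  interpret P: pair_sigma_finite M drho_over_rho ..
  have E: "E1 \<in> sets borel" "E2 \<in> sets borel" "E1 \<subseteq> {0<..}" "E2 \<subseteq> {0<..}"
    using assms(5,6) by (auto simp: rho_borel_def sets_restrict_space)
  have [measurable]: "p \<in> M \<rightarrow>\<^sub>M rho_borel" "q \<in> M \<rightarrow>\<^sub>M rho_borel" "A \<in> sets M"
    and p: "\<And>c x. 0 < c \<Longrightarrow> x \<in> space M \<Longrightarrow> p (S c x) = c * p x"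
    and q: "\<And>c x. 0 < c \<Longrightarrow> x \<in> space M \<Longrightarrow> q (S c x) = c * q x"
    and A: "\<And>c x. 0 < c \<Longrightarrow> x \<in> space M \<Longrightarrow> S c x \<in> A \<longleftrightarrow> x \<in> A" "A \<subseteq> space M"
    using assms sets.sets_into_space by (auto simp: homogeneous_def invariant_set_def)
  have pos: "0 < p x" "0 < q x" if "x \<in> space M" for x
    using that assms(2,3) measurable_space[of p M rho_borel x] measurable_space[of q M rho_borel x]
    by (auto simp: homogeneous_def)
  have [measurable]: "p \<in> M \<rightarrow>\<^sub>M borel" "q \<in> M \<rightarrow>\<^sub>M borel" "E1 \<in> sets borel" "E2 \<in> sets borel"
    using assms(2,3) E by (auto simp: homogeneous_def rho_borel_def measurable_restrict_space2_iff)
  have [measurable]: "(\<lambda>t. t) \<in> drho_over_rho \<rightarrow>\<^sub>M borel"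
    by (auto simp: drho_over_rho_def intro!: measurable_restrict_space1)
  have meas_inv: "{t\<in>{0<..}. 1 / t \<in> E1} \<in> sets rho_borel"
  proof -
    have "{t\<in>space borel. 1 / t \<in> E1} \<in> sets borel"
      by measurable
    moreover have "{t\<in>{0<..}. 1 / t \<in> E1} = {0<..} \<inter> {t\<in>space borel. 1 / t \<in> E1}"
      by auto
    ultimately show ?thesis
      by (auto simp: rho_borel_def sets_restrict_space)
  qed
  define F :: "'a \<Rightarrow> real \<Rightarrow> ennreal"
    where "F x t = indicator A x * indicator E1 (p x) * indicator E2 (t * q x)" for x t
  \<comment> \<open>This is \<open>F\<close> at the point \<open>S (1 / t) x\<close>: by homogeneity
    p is divided by t, and t q turns into q.\<close>
  define G :: "'a \<Rightarrow> real \<Rightarrow> ennreal"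
    where "G x t = indicator A x * indicator E1 (p x / t) * indicator E2 (q x)" for x t
  have [measurable]: "case_prod F \<in> borel_measurable (M \<Otimes>\<^sub>M drho_over_rho)"
    "case_prod G \<in> borel_measurable (M \<Otimes>\<^sub>M drho_over_rho)"
    unfolding F_def G_def by measurable
  have F1: "(\<integral>\<^sup>+ t. F x t \<partial>drho_over_rho) =
      emeasure drho_over_rho E2 * indicator {x\<in>A. p x \<in> E1} x" if x: "x \<in> space M" for x
  proof -
    have "(\<integral>\<^sup>+ t. F x t \<partial>drho_over_rho) =
      (\<integral>\<^sup>+ t. indicator {x\<in>A. p x \<in> E1} x * indicator {t\<in>{0<..}. t * q x \<in> E2} t \<partial>drho_over_rho)"
      by (intro nn_integral_cong) (auto simp: F_def indicator_def)
    also have "\<dots> = indicator {x\<in>A. p x \<in> E1} x * emeasure drho_over_rho {t\<in>{0<..}. t * q x \<in> E2}"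
      using drho_over_rho_scale(1)[OF assms(6) pos(2)[OF x]] by (simp add: nn_integral_cmult)
    finally show ?thesis
      using drho_over_rho_scale(2)[OF assms(6) pos(2)[OF x]] by (simp add: mult.commute)
  qed
  have G1: "(\<integral>\<^sup>+ t. G x t \<partial>drho_over_rho) =
      emeasure drho_over_rho {t\<in>{0<..}. 1 / t \<in> E1} * indicator {x\<in>A. q x \<in> E2} x"
    if x: "x \<in> space M" for x
  proof -
    let ?E = "{t\<in>{0<..}. 1 / t \<in> E1}"
    have [simp]: "0 < p x" using pos x by blast
    \<comment> \<open>The slice of all t with p x / t in \<open>E1\<close> is a dilate of the
      inverted set \<open>?E\<close>, so its mass does not depend on x.\<close>
    have eq: "{t\<in>{0<..}. t * (1 / p x) \<in> ?E} = {t\<in>{0<..}. p x / t \<in> E1}"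
      by auto
    note * = drho_over_rho_scale[OF meas_inv, of "1 / p x", unfolded eq]
    have "(\<integral>\<^sup>+ t. G x t \<partial>drho_over_rho) =
      (\<integral>\<^sup>+ t. indicator {x\<in>A. q x \<in> E2} x * indicator {t\<in>{0<..}. p x / t \<in> E1} t \<partial>drho_over_rho)"
      by (intro nn_integral_cong) (auto simp: G_def indicator_def)
    also have "\<dots> = indicator {x\<in>A. q x \<in> E2} x * emeasure drho_over_rho {t\<in>{0<..}. p x / t \<in> E1}"
      using * by (simp add: nn_integral_cmult)
    finally show ?thesis
      using * by (simp add: mult.commute)
  qed
  \<comment> \<open>Invariance is applied for each fixed t, which is why the integral over x has to
    be moved inside by Tonelli.\<close>
  have FG: "(\<integral>\<^sup>+ x. F x t \<partial>M) = (\<integral>\<^sup>+ x. G x t \<partial>M)" if t: "0 < t" for t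
  proof -
    have [measurable]: "S (1 / t) \<in> M \<rightarrow>\<^sub>M M"
      using t by (intro S_measurable) auto
    have "(\<integral>\<^sup>+ x. F x t \<partial>M) = (\<integral>\<^sup>+ x. F x t \<partial>distr M M (S (1 / t)))"
      using S_preserves[of "1 / t"] t by simp
    also have "\<dots> = (\<integral>\<^sup>+ x. F (S (1 / t) x) t \<partial>M)"
      unfolding F_def by (intro nn_integral_distr) measurable
    also have "\<dots> = (\<integral>\<^sup>+ x. G x t \<partial>M)"
      using t p[of "1 / t"] q[of "1 / t"] A(1)[of "1 / t"]
      by (intro nn_integral_cong) (auto simp: F_def G_def indicator_def)
    finally show ?thesis .
  qed
  have "emeasure M {x\<in>A. p x \<in> E1} * emeasure drho_over_rho E2 =
      (\<integral>\<^sup>+ x. emeasure drho_over_rho E2 * indicator {x\<in>A. p x \<in> E1} x \<partial>M)"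
    by (subst nn_integral_cmult_indicator) (auto simp: mult.commute)
  also have "\<dots> = (\<integral>\<^sup>+ x. \<integral>\<^sup>+ t. F x t \<partial>drho_over_rho \<partial>M)"
    by (intro nn_integral_cong) (simp add: F1)
  also have "\<dots> = (\<integral>\<^sup>+ t. \<integral>\<^sup>+ x. F x t \<partial>M \<partial>drho_over_rho)"
    by (intro P.Fubini'[symmetric]) measurable
  also have "\<dots> = (\<integral>\<^sup>+ t. \<integral>\<^sup>+ x. G x t \<partial>M \<partial>drho_over_rho)"
    by (rule nn_integral_cong) (simp add: FG)
  also have "\<dots> = (\<integral>\<^sup>+ x. \<integral>\<^sup>+ t. G x t \<partial>drho_over_rho \<partial>M)"
    by (intro P.Fubini') measurable
  also have "\<dots> = (\<integral>\<^sup>+ x. emeasure drho_over_rho {t\<in>{0<..}. 1 / t \<in> E1} * indicator {x\<in>A. q x \<in> E2} x \<partial>M)"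
    by (intro nn_integral_cong) (simp add: G1)
  also have "\<dots> = emeasure M {x\<in>A. q x \<in> E2} * emeasure drho_over_rho {t\<in>{0<..}. 1 / t \<in> E1}"
    by (subst nn_integral_cmult_indicator) (auto simp: mult.commute)
  finally show ?thesis .
qed

end

text \<open>The exchange identity is applied to dt / t acting on itself, with both homogeneous
  functions equal to the identity; its asymmetry between \<open>E1\<close> and the inverted
  \<open>E1\<close> becomes the claim.\<close>

lemma drho_over_rho_inverse:
  assumes "E \<in> sets rho_borel"
  shows "emeasure drho_over_rho {t\<in>{0<..}. 1 / t \<in> E} = emeasure drho_over_rho E"
proof -
  interpret scaling_action drho_over_rho "\<lambda>c x. x * c"
  proof
    fix c :: real assume c: "0 < c"
    show m: "(\<lambda>x. x * c) \<in> drho_over_rho \<rightarrow>\<^sub>M drho_over_rho"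
      using c drho_over_rho_scale(1)[OF _ c]
      by (auto simp: measurable_def vimage_def Int_def conj_commute)
    show "distr drho_over_rho drho_over_rho (\<lambda>x. x * c) = drho_over_rho"
      using c drho_over_rho_scale(2)[OF _ c]
      by (intro measure_eqI) (auto simp: emeasure_distr[OF m] vimage_def Int_def conj_commute)
  qed
  have hom: "homogeneous (\<lambda>x. x)"
    by (auto simp: homogeneous_def)
  have inv: "invariant_set {0<..}"
    using invariant_set_space by simp
  \<comment> \<open>This interval has mass ln e = 1, so both factors that come from it
    disappear.\<close>
  have I: "{1..<exp 1} \<in> sets rho_borel"
    by (intro Ico_in_rho_borel) auto
  have "emeasure drho_over_rho {x\<in>{0<..}. x \<in> F} = emeasure drho_over_rho F" if "F \<in> sets rho_borel" for F
    using that by (intro arg_cong[where f="emeasure drho_over_rho"]) (auto simp: rho_borel_def sets_restrict_space)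
  note this[OF assms] this[OF I]
  with emeasure_exchange_aux[OF sigma_finite_drho_over_rho hom hom inv assms I]
  show ?thesis
    by (simp add: emeasure_drho_over_rho_Ico[of 1 "exp 1", simplified])
qed

context scaling_action
begin

text \<open>Inversion invariance of dt / t makes the identity symmetric. On a fixed invariant set,
  every homogeneous function thus has as its law the same multiple of dt / t.\<close>

lemma emeasure_exchange:
  assumes "sigma_finite_measure M" "homogeneous p" "homogeneous q" "invariant_set A"
    and "E1 \<in> sets rho_borel" "E2 \<in> sets rho_borel"
  shows "emeasure M {x\<in>A. p x \<in> E1} * emeasure drho_over_rho E2 =
         emeasure M {x\<in>A. q x \<in> E2} * emeasure drho_over_rho E1"
  using emeasure_exchange_aux[OF assms] drho_over_rho_inverse[OF assms(5)] by simp

text \<open>Exchanging \<open>p\<close> with itself shows that E -> M(u in B, p in E) is a multiple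
  of dt / t, and this multiple is defined to be \<nu>(B). Exchanging \<open>p\<close> with
  \<open>q\<close> on the whole space carries finiteness and positivity of the total mass from
  \<open>q\<close> to \<open>p\<close>.\<close>

theorem distr_product:
  fixes u :: "'a \<Rightarrow> 'b"
  assumes p: "homogeneous p" and q: "homogeneous q"
    and u: "u \<in> M \<rightarrow>\<^sub>M N" "\<And>c x. 0 < c \<Longrightarrow> x \<in> space M \<Longrightarrow> u (S c x) = u x"
    and ab: "0 < a" "a < b"
    and fin: "0 < emeasure M {x\<in>space M. q x \<in> {a..<b}}" "emeasure M {x\<in>space M. q x \<in> {a..<b}} < \<infinity>"
  obtains \<nu> where "sets \<nu> = sets N" "finite_measure \<nu>" "0 < emeasure \<nu> (space \<nu>)"
    "distr M (N \<Otimes>\<^sub>M rho_borel) (\<lambda>x. (u x, p x)) = \<nu> \<Otimes>\<^sub>M drho_over_rho"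
proof
  let ?I = "{a..<b}"
  define L where "L = ln (b / a)"
  have L: "0 < L" using ab by (simp add: L_def)
  have lam: "emeasure drho_over_rho ?I = ennreal L"
    using emeasure_drho_over_rho_Ico[OF ab] by (simp add: L_def)
  have I: "?I \<in> sets rho_borel"
    using ab by (intro Ico_in_rho_borel)
  have sf: "sigma_finite_measure M"
    by (rule sigma_finiteI[OF q ab fin(2)])
  have pm[measurable]: "p \<in> M \<rightarrow>\<^sub>M rho_borel" and [measurable]: "u \<in> M \<rightarrow>\<^sub>M N"
    using p u by (auto simp: homogeneous_def)
  define J where "J = {x\<in>space M. p x \<in> ?I}"
  have J[measurable]: "J \<in> sets M"
    using measurable_sets[OF pm I] by (simp add: J_def vimage_def Int_def conj_commute)
  \<comment> \<open>With \<open>E1\<close> and \<open>E2\<close> both equal to \<open>?I\<close>,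
    the common factor \<open>L\<close> is positive and finite and can be cancelled.\<close>
  have eqJ: "emeasure M J = emeasure M {x\<in>space M. q x \<in> ?I}"
    using emeasure_exchange[OF sf p q invariant_set_space I I] L unfolding lam J_def
    by (simp add: mult.commute[of _ "ennreal L"] ennreal_mult_cancel_left)
  define \<nu> where "\<nu> = scale_measure (ennreal (1 / L)) (distr (restrict_space M J) N u)"
  show sets: "sets \<nu> = sets N"
    by (simp add: \<nu>_def)
  have um: "u \<in> restrict_space M J \<rightarrow>\<^sub>M N"
    by (rule measurable_restrict_space1) fact
  have em: "emeasure \<nu> B = ennreal (1 / L) * emeasure M {x\<in>u -` B \<inter> space M. p x \<in> ?I}" if B: "B \<in> sets N" for B
  proof -
    have "emeasure \<nu> B = ennreal (1 / L) * emeasure (restrict_space M J) (u -` B \<inter> J)"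
      using B J sets.sets_into_space[OF J]
      by (auto simp: \<nu>_def emeasure_distr[OF um] space_restrict_space Int_absorb2)
    also have "emeasure (restrict_space M J) (u -` B \<inter> J) = emeasure M (u -` B \<inter> J)"
      using J sets.sets_into_space[OF J] by (intro emeasure_restrict_space) auto
    also have "u -` B \<inter> J = {x\<in>u -` B \<inter> space M. p x \<in> ?I}"
      by (auto simp: J_def)
    finally show ?thesis .
  qed
  have tot: "emeasure \<nu> (space \<nu>) = ennreal (1 / L) * emeasure M J"
    using em[of "space N"] measurable_space[OF u(1)] sets_eq_imp_space_eq[OF sets]
    by (auto simp: J_def intro!: arg_cong[where f="\<lambda>A. _ * emeasure M A"])
  show finm: "finite_measure \<nu>"
    using fin(2) by (intro finite_measureI) (simp add: tot eqJ ennreal_mult_eq_top_iff less_top[symmetric])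
  show "0 < emeasure \<nu> (space \<nu>)"
    using fin(1) L by (simp add: tot eqJ ennreal_zero_less_mult_iff)
  have "\<nu> \<Otimes>\<^sub>M drho_over_rho = distr M (N \<Otimes>\<^sub>M rho_borel) (\<lambda>x. (u x, p x))"
  \<comment> \<open>Both factors are sigma-finite, so agreement on measurable rectangles
    suffices.\<close>
  proof (rule pair_measure_eqI)
    show "sigma_finite_measure \<nu>"
      using finm by (simp add: finite_measure_def)
    show "sigma_finite_measure drho_over_rho"
      by (rule sigma_finite_drho_over_rho)
    show "sets (\<nu> \<Otimes>\<^sub>M drho_over_rho) = sets (distr M (N \<Otimes>\<^sub>M rho_borel) (\<lambda>x. (u x, p x)))"
      using sets by (simp cong: sets_pair_measure_cong)
    fix B E assume "B \<in> sets \<nu>" "E \<in> sets drho_over_rho"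
    then have B: "B \<in> sets N" and E: "E \<in> sets rho_borel"
      using sets by auto
    \<comment> \<open>Since u is constant along orbits, the event u in B is an invariant set; this
      is how B enters the exchange identity.\<close>
    have inv: "invariant_set (u -` B \<inter> space M)"
      using B u S_measurable by (auto simp: invariant_set_def dest: measurable_space intro: measurable_sets)
    have "emeasure \<nu> B * emeasure drho_over_rho E =
        ennreal (1 / L) * (emeasure M {x\<in>u -` B \<inter> space M. p x \<in> ?I} * emeasure drho_over_rho E)"
      by (simp add: em[OF B] mult.assoc)
    also have "\<dots> = ennreal (1 / L) * (emeasure M {x\<in>u -` B \<inter> space M. p x \<in> E} * ennreal L)"
      using emeasure_exchange[OF sf p p inv I E] lam by simp
    also have "\<dots> = (ennreal (1 / L) * ennreal L) * emeasure M {x\<in>u -` B \<inter> space M. p x \<in> E}"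
      by (simp add: mult_ac)
    also have "ennreal (1 / L) * ennreal L = 1"
      using L by (simp add: ennreal_mult[symmetric])
    also have "1 * emeasure M {x\<in>u -` B \<inter> space M. p x \<in> E} =
        emeasure (distr M (N \<Otimes>\<^sub>M rho_borel) (\<lambda>x. (u x, p x))) (B \<times> E)"
      using B E by (subst emeasure_distr)
        (auto intro!: arg_cong[where f="emeasure M"])
    finally show "emeasure \<nu> B * emeasure drho_over_rho E =
        emeasure (distr M (N \<Otimes>\<^sub>M rho_borel) (\<lambda>x. (u x, p x))) (B \<times> E)" .
  qed
  then show "distr M (N \<Otimes>\<^sub>M rho_borel) (\<lambda>x. (u x, p x)) = \<nu> \<Otimes>\<^sub>M drho_over_rho"
    by simp
qed

end

section \<open>Normalized Riemann maps\<close>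

definition normalized_riemann_map :: "complex set \<Rightarrow> (complex \<Rightarrow> complex) \<Rightarrow> bool" where
  "normalized_riemann_map D f \<longleftrightarrow>
     f holomorphic_on ball 0 1 \<and> inj_on f (ball 0 1) \<and> f ` ball 0 1 = D \<and> f 0 = 0 \<and>
     (\<exists>\<rho>>0. deriv f 0 = complex_of_real \<rho>)"

text \<open>The choice is unique on the unit disc; only values there and Taylor coefficients at 0
  are meaningful.\<close>

definition riemann_map :: "complex set \<Rightarrow> complex \<Rightarrow> complex" where
  "riemann_map D = (SOME f. normalized_riemann_map D f)"

definition conformal_radius :: "complex set \<Rightarrow> real" where
  "conformal_radius D = Re (deriv (riemann_map D) 0)"

text \<open>The index is shifted by one: these are the coefficients of f(z) / (\<rho> z), beginning
  with 1, in accordance with the sequences \<open>u\<close> of \<open>is_phi_plus\<close>.\<close>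

definition coef :: "complex set \<Rightarrow> nat \<Rightarrow> complex" where
  "coef D n = fps_expansion (riemann_map D) 0 $ Suc n / conformal_radius D"

section \<open>Subordination and uniqueness of normalized maps\<close>

lemma deriv_mult_on_ball:
  fixes h :: "complex \<Rightarrow> complex"
  assumes "\<And>z. cmod z < 1 \<Longrightarrow> h z = \<alpha> * z"
  shows "deriv h 0 = \<alpha>"
proof -
  have "((\<lambda>z. \<alpha> * z) has_field_derivative \<alpha>) (at 0)"
    by (auto intro!: derivative_eq_intros)
  then have "(h has_field_derivative \<alpha>) (at 0)"
    by (rule has_field_derivative_transform_within_open[where S="ball 0 1"]) (auto simp: assms)
  then show ?thesis
    by (rule DERIV_imp_deriv)
qed

text \<open>The function h is the inverse of f composed with F, a self-map of the disc fixing 0; the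
  last identity is the chain rule at 0.\<close>

lemma subordination:
  assumes f: "normalized_riemann_map D f"
    and F: "F holomorphic_on ball 0 1" "F ` ball 0 1 \<subseteq> D" "F 0 = 0"
  obtains h where "h holomorphic_on ball 0 1" "h 0 = 0" "\<And>z. cmod z < 1 \<Longrightarrow> cmod (h z) < 1"
    "\<And>z. cmod z < 1 \<Longrightarrow> F z = f (h z)" "deriv F 0 = deriv f 0 * deriv h 0"
proof -
  have hol: "f holomorphic_on ball 0 1" "inj_on f (ball 0 1)" "f ` ball 0 1 = D" "f 0 = 0"
    using f by (auto simp: normalized_riemann_map_def)
  obtain g where g: "g holomorphic_on f ` ball 0 1" "\<And>z. z \<in> ball 0 1 \<Longrightarrow> g (f z) = z"
    by (rule holomorphic_has_inverse[OF hol(1) open_ball hol(2)]) blast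
  have gF: "(g \<circ> F) holomorphic_on ball 0 1"
    using F g hol by (intro holomorphic_on_compose_gen[OF _ g(1)]) auto
  have lt: "cmod ((g \<circ> F) z) < 1 \<and> f ((g \<circ> F) z) = F z" if z: "cmod z < 1" for z
  proof -
    have "F z \<in> f ` ball 0 1"
      using F z hol by auto
    then obtain w where "w \<in> ball 0 1" "F z = f w"
      by auto
    then show ?thesis using g(2)[of w] by simp
  qed
  have 0: "(g \<circ> F) 0 = 0"
    using g(2)[of 0] F hol by simp
  have "((f \<circ> (g \<circ> F)) has_field_derivative deriv f ((g \<circ> F) 0) * deriv (g \<circ> F) 0) (at 0)"
    using gF hol 0 by (intro DERIV_chain holomorphic_derivI[where S="ball 0 1"]) auto
  then have "(f \<circ> (g \<circ> F) has_field_derivative deriv f 0 * deriv (g \<circ> F) 0) (at 0)"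
    by (simp only: 0)
  then have "(F has_field_derivative deriv f 0 * deriv (g \<circ> F) 0) (at 0)"
  proof (rule has_field_derivative_transform_within_open)
    show "(f \<circ> (g \<circ> F)) z = F z" if "z \<in> ball 0 1" for z
      using lt[of z] that by simp
  qed auto
  then have d: "deriv F 0 = deriv f 0 * deriv (g \<circ> F) 0"
    by (rule DERIV_imp_deriv)
  show thesis
    by (rule that[OF gF 0 conjunct1[OF lt] conjunct2[OF lt, symmetric] d])
qed

text \<open>Each map is subordinate to the other, so Schwarz forces the two positive derivatives to
  coincide. Then h'(0) = 1, and the equality case of Schwarz makes h the identity.\<close>

lemma normalized_riemann_map_unique:
  assumes f: "normalized_riemann_map D f" and g: "normalized_riemann_map D g" and z: "cmod z < 1"
  shows "g z = f z"
proof -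
  obtain a b where ab: "0 < a" "0 < b" "deriv f 0 = of_real a" "deriv g 0 = of_real b"
    using f g by (auto simp: normalized_riemann_map_def)
  have F: "f holomorphic_on ball 0 1" "f ` ball 0 1 \<subseteq> D" "f 0 = 0"
    and G: "g holomorphic_on ball 0 1" "g ` ball 0 1 \<subseteq> D" "g 0 = 0"
    using f g by (auto simp: normalized_riemann_map_def)
  obtain h where h: "h holomorphic_on ball 0 1" "h 0 = 0" "\<And>z. cmod z < 1 \<Longrightarrow> cmod (h z) < 1"
    "\<And>z. cmod z < 1 \<Longrightarrow> g z = f (h z)" "deriv g 0 = deriv f 0 * deriv h 0"
    by (rule subordination[OF f G]) blast
  obtain k where k: "k holomorphic_on ball 0 1" "k 0 = 0" "\<And>z. cmod z < 1 \<Longrightarrow> cmod (k z) < 1"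
    "deriv f 0 = deriv g 0 * deriv k 0"
    by (rule subordination[OF g F]) blast
  have "b = a * cmod (deriv h 0)" "a = b * cmod (deriv k 0)"
    using arg_cong[OF h(5), of norm] arg_cong[OF k(4), of norm] ab by (auto simp: norm_mult)
  moreover have "cmod (deriv h 0) \<le> 1" "cmod (deriv k 0) \<le> 1"
    using Schwarz_Lemma(2)[OF h(1,2,3), of 0] Schwarz_Lemma(2)[OF k(1,2,3), of 0] by auto
  ultimately have "a = b"
    using ab mult_left_le[of "cmod (deriv h 0)" a] mult_left_le[of "cmod (deriv k 0)" b] by linarith
  then have dh: "deriv h 0 = 1"
    using h(5) ab by auto
  then obtain \<alpha> where \<alpha>: "\<And>z. cmod z < 1 \<Longrightarrow> h z = \<alpha> * z"
    using Schwarz_Lemma(3)[OF h(1,2,3), of 0] by auto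
  then have "\<alpha> = 1"
    using deriv_mult_on_ball[of h \<alpha>] dh by simp
  then show ?thesis
    using h(4)[OF z] \<alpha>[OF z] by simp
qed

lemma fps_expansion_cong_ball:
  assumes "f holomorphic_on ball 0 1" "g holomorphic_on ball 0 1" "\<And>z. cmod z < 1 \<Longrightarrow> f z = g z"
  shows "fps_expansion f (0::complex) = fps_expansion g 0"
proof -
  have "eventually (\<lambda>z. z \<in> ball 0 1) (nhds (0::complex))"
    by (intro eventually_nhds_in_open) auto
  then have "eventually (\<lambda>z. f z = g z) (nhds 0)"
    by eventually_elim (auto simp: assms)
  moreover have "f has_fps_expansion fps_expansion f 0"
    by (intro has_fps_expansion_fps_expansion[of "ball 0 1"]) (use assms in auto)
  moreover have "g has_fps_expansion fps_expansion g 0"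
    by (intro has_fps_expansion_fps_expansion[of "ball 0 1"]) (use assms in auto)
  ultimately show ?thesis
    using has_fps_expansion_cong[of f g "fps_expansion f 0" "fps_expansion f 0"] fps_expansion_unique_complex by blast
qed

text \<open>By uniqueness, radius and coefficients may be read off from any normalized map of the
  domain instead of the chosen one.\<close>

lemma riemann_map_eq:
  assumes "normalized_riemann_map D f"
  shows "normalized_riemann_map D (riemann_map D)"
    and "deriv f 0 = of_real (conformal_radius D)" and "0 < conformal_radius D"
    and "fps_expansion f 0 $ Suc n = conformal_radius D * coef D n"
proof -
  show r: "normalized_riemann_map D (riemann_map D)"
    unfolding riemann_map_def using assms by (rule someI[of "normalized_riemann_map D"])
  have hol: "f holomorphic_on ball 0 1" "riemann_map D holomorphic_on ball 0 1"
    using assms r by (auto simp: normalized_riemann_map_def)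
  have eq: "fps_expansion f 0 = fps_expansion (riemann_map D) 0"
    using normalized_riemann_map_unique[OF r assms] by (intro fps_expansion_cong_ball hol) auto
  from arg_cong[OF this, of "\<lambda>F. fps_nth F 1"] have d: "deriv f 0 = deriv (riemann_map D) 0"
    by (simp add: fps_expansion_def)
  obtain \<rho> where \<rho>: "\<rho> > 0" "deriv f 0 = of_real \<rho>"
    using assms by (auto simp: normalized_riemann_map_def)
  then show "deriv f 0 = of_real (conformal_radius D)" "0 < conformal_radius D"
    using d by (auto simp: conformal_radius_def)
  then show "fps_expansion f 0 $ Suc n = conformal_radius D * coef D n"
    by (simp add: coef_def eq)
qed

lemma coef_0:
  assumes "normalized_riemann_map D f"
  shows "coef D 0 = 1"
  using riemann_map_eq(2,3)[OF assms] riemann_map_eq(4)[OF assms, of 0]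
  by (simp add: fps_expansion_def)

text \<open>\<open>D\<close> is not assumed to lie in \<open>D'\<close>, but the shrunken map z ->
  f(s z) takes values in \<open>D'\<close> and is subordinate to g. The ratio that appears as h'(0)
  measures how far h is from the identity.\<close>

lemma conformal_radius_subordinate:
  assumes f: "normalized_riemann_map D f" and g: "normalized_riemann_map D' g"
    and s: "0 < s" "s < 1" "f ` cball 0 s \<subseteq> D'"
  obtains h where "h holomorphic_on ball 0 1" "h 0 = 0" "\<And>z. cmod z < 1 \<Longrightarrow> cmod (h z) < 1"
    "\<And>z. cmod z < 1 \<Longrightarrow> f (of_real s * z) = g (h z)"
    "deriv h 0 = of_real (s * conformal_radius D / conformal_radius D')"
proof -
  have hol: "f holomorphic_on ball 0 1" "f 0 = 0"
    using f by (auto simp: normalized_riemann_map_def)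
  have sub: "of_real s * z \<in> ball 0 1 \<and> of_real s * z \<in> cball 0 s" if "cmod z < 1" for z
    using s that mult_strict_mono[of s 1 "cmod z" 1] mult_left_le[of "cmod z" s] by (simp add: norm_mult)
  have "(f \<circ> (\<lambda>z. of_real s * z)) holomorphic_on ball 0 1"
    using sub by (intro holomorphic_on_compose_gen[OF _ hol(1)] holomorphic_intros) auto
  then have 1: "(\<lambda>z. f (of_real s * z)) holomorphic_on ball 0 1"
    by (simp add: o_def)
  have 2: "(\<lambda>z. f (of_real s * z)) ` ball 0 1 \<subseteq> D'"
    using sub s(3) by auto
  obtain h where h: "h holomorphic_on ball 0 1" "h 0 = 0" "\<And>z. cmod z < 1 \<Longrightarrow> cmod (h z) < 1"
    "\<And>z. cmod z < 1 \<Longrightarrow> f (of_real s * z) = g (h z)"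
    "deriv (\<lambda>z. f (of_real s * z)) 0 = deriv g 0 * deriv h 0"
  proof (rule subordination[OF g 1 2])
    show "f (of_real s * 0) = 0"
      by (simp add: hol)
  qed (rule that)
  have "(f has_field_derivative deriv f 0) (at (of_real s * 0))"
    using hol by (simp add: holomorphic_derivI[where S="ball 0 1"])
  then have "((\<lambda>z. f (of_real s * z)) has_field_derivative deriv f 0 * of_real s) (at 0)"
    by (rule DERIV_chain2) (auto intro!: derivative_eq_intros)
  then have "deriv (\<lambda>z. f (of_real s * z)) 0 = deriv f 0 * of_real s"
    by (rule DERIV_imp_deriv)
  then have d: "deriv h 0 = of_real (s * conformal_radius D / conformal_radius D')"
    using h(5) riemann_map_eq(2,3)[OF f] riemann_map_eq(2,3)[OF g] by (simp add: field_simps)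
  show thesis
    by (rule that[OF h(1) h(2) h(3) h(4) d])
qed

text \<open>This is the Schwarz bound |h'(0)| <= 1 for the subordinating function, and the source of
  lower semicontinuity.\<close>

lemma conformal_radius_lower_bound:
  assumes f: "normalized_riemann_map D f" and g: "normalized_riemann_map D' g"
    and s: "0 < s" "s < 1" "f ` cball 0 s \<subseteq> D'"
  shows "s * conformal_radius D \<le> conformal_radius D'"
proof -
  obtain h where h: "h holomorphic_on ball 0 1" "h 0 = 0" "\<And>z. cmod z < 1 \<Longrightarrow> cmod (h z) < 1"
    "deriv h 0 = of_real (s * conformal_radius D / conformal_radius D')"
    by (rule conformal_radius_subordinate[OF assms]) blast
  have "cmod (deriv h 0) \<le> 1"
    using Schwarz_Lemma(2)[OF h(1,2,3), of 0] by auto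
  then show ?thesis
    using riemann_map_eq(3)[OF f] riemann_map_eq(3)[OF g] s by (simp add: h(4) norm_divide norm_mult divide_simps)
qed

section \<open>Schwarz functions with derivative close to 1\<close>

text \<open>Write h(z) = z k(z) with k(0) = a. The Schwarz lemma for k followed by the disc
  automorphism taking a to 0 gives |k - a| <= |z| |1 - a k|. On |z| = 1/2 the right side is at most
  half of (1 - a^2) + |k - a|, and the last term is absorbed on the left.\<close>

lemma Schwarz_almost_identity:
  assumes h: "h holomorphic_on ball 0 1" "h 0 = 0" "\<And>z. cmod z < 1 \<Longrightarrow> cmod (h z) < 1"
    and a: "deriv h 0 = of_real a" "0 \<le> a"
    and z: "cmod z = 1 / 2"
  shows "cmod (h z - of_real a * z) \<le> 1 - a\<^sup>2"
proof -
  have z1: "cmod z < 1" "z \<noteq> 0" using z by auto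
  have "a \<le> 1"
    using Schwarz_Lemma(2)[OF h, of 0] a by auto
  \<comment> \<open>The equality case of Schwarz: h is a rotation, and the nonnegative real
    derivative forces it to be the identity. Ruling it out makes |k| strictly less than 1, as the
    disc automorphism requires.\<close>
  have rot: "a = 1 \<and> (\<forall>z. cmod z < 1 \<longrightarrow> h z = z)"
    if "(\<exists>z. cmod z < 1 \<and> z \<noteq> 0 \<and> cmod (h z) = cmod z) \<or> a = 1"
  proof -
    have "(\<exists>z. cmod z < 1 \<and> z \<noteq> 0 \<and> cmod (h z) = cmod z) \<or> cmod (deriv h 0) = 1"
      using that a by auto
    from Schwarz_Lemma(3)[OF h, of 0, OF _ _ this]
    obtain \<alpha> where \<alpha>: "\<And>z. cmod z < 1 \<Longrightarrow> h z = \<alpha> * z" "cmod \<alpha> = 1"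
      by auto
    have "\<alpha> = of_real a"
      using deriv_mult_on_ball[of h \<alpha>] \<alpha> a by simp
    with \<alpha> a show ?thesis by auto
  qed
  show ?thesis
  proof (cases "a = 1")
    case True
    with rot z1 show ?thesis by auto
  next
    case False
    obtain k where k: "k holomorphic_on ball 0 1" "\<And>z. cmod z < 1 \<Longrightarrow> h z = z * k z" "deriv h 0 = k 0"
      using Schwarz3[OF h(1,2)] by metis
    have k1: "cmod (k w) < 1" if w: "cmod w < 1" for w
    proof (cases "w = 0")
      case True
      have "cmod (k 0) = a"
        using k(3) a by (metis norm_of_real abs_of_nonneg)
      then show ?thesis using True \<open>a \<le> 1\<close> \<open>a \<noteq> 1\<close> by auto
    next
      case False
      have "cmod (h w) \<le> cmod w"
        using Schwarz_Lemma(1)[OF h w] .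
      moreover have "cmod (h w) \<noteq> cmod w"
        using rot \<open>a \<noteq> 1\<close> w False by blast
      ultimately have "cmod w * cmod (k w) < cmod w * 1"
        using k(2)[OF w] by (simp add: norm_mult)
      then show ?thesis
        using False by simp
    qed
    have na: "cmod (of_real a) < 1"
      using \<open>a \<le> 1\<close> \<open>a \<noteq> 1\<close> a by simp
    let ?m = "\<lambda>z. Moebius_function 0 (of_real a) (k z)"
    have "cmod (?m z) \<le> cmod z"
    proof (rule Schwarz_Lemma(1))
      show "?m holomorphic_on ball 0 1"
        using holomorphic_on_compose_gen[OF k(1) Moebius_function_holomorphic[OF na, of 0]] k1
        by (simp add: o_def image_subset_iff)
      show "?m 0 = 0"
        using k(3) a by (simp add: Moebius_function_eq_zero)
      show "cmod (?m w) < 1" if "cmod w < 1" for w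
        using Moebius_function_norm_lt_1[OF na k1[OF that]] .
    qed (use z1 in auto)
    moreover have ne: "1 - of_real a * k z \<noteq> 0"
    proof
      assume "1 - of_real a * k z = 0"
      then have "cmod (of_real a * k z) = 1" by simp
      moreover have "cmod (of_real a * k z) < 1"
        using na k1[OF z1(1)] norm_mult_less[of "of_real a" 1 "k z" 1] by simp
      ultimately show False by simp
    qed
    ultimately have 1: "cmod (k z - of_real a) \<le> 1 / 2 * cmod (1 - of_real a * k z)"
      using z by (simp add: Moebius_function_simple norm_divide divide_simps)
    \<comment> \<open>This splitting exhibits the quantity k - a that is to be absorbed.\<close>
    have "1 - of_real a * k z = of_real (1 - a\<^sup>2) - of_real a * (k z - of_real a)"
      by (simp add: algebra_simps power2_eq_square)
    then have "cmod (1 - of_real a * k z) \<le> cmod (of_real (1 - a\<^sup>2)) + cmod (of_real a * (k z - of_real a))"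
      using norm_triangle_ineq4[of "of_real (1 - a\<^sup>2)" "of_real a * (k z - of_real a)"] by presburger
    moreover have "cmod (of_real (1 - a\<^sup>2)) = 1 - a\<^sup>2"
      unfolding norm_of_real using \<open>a \<le> 1\<close> a(2) by (simp add: power_le_one)
    moreover have "cmod (of_real a * (k z - of_real a)) \<le> cmod (k z - of_real a)"
      using \<open>a \<le> 1\<close> a(2) by (simp add: norm_mult mult_left_le_one_le)
    ultimately have *: "cmod (k z - of_real a) \<le> 1 - a\<^sup>2"
      using 1 by linarith
    have "h z - of_real a * z = z * (k z - of_real a)"
      using k(2)[OF z1(1)] by (simp add: algebra_simps)
    then have "cmod (h z - of_real a * z) \<le> cmod (k z - of_real a)"
      using mult_right_mono[of "cmod z" 1 "cmod (k z - of_real a)"] z1 by (simp add: norm_mult)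
    with * show ?thesis by simp
  qed
qed

text \<open>Cauchy's inequality for h(z) - a z on the circle |z| = 1/2, whose radius accounts for
  the factor 2^n.\<close>

lemma Schwarz_coefficient_bound:
  assumes h: "h holomorphic_on ball 0 1" "h 0 = 0" "\<And>z. cmod z < 1 \<Longrightarrow> cmod (h z) < 1"
    and a: "deriv h 0 = of_real a" "0 \<le> a"
  shows "cmod (fps_expansion h 0 $ n - (fps_const (of_real a) * fps_X) $ n) \<le> 2 ^ n * (1 - a\<^sup>2)"
proof -
  let ?d = "\<lambda>z. h z - of_real a * z"
  have hd: "?d holomorphic_on ball 0 1"
    using h by (auto intro!: holomorphic_intros)
  have "h has_fps_expansion fps_expansion h 0"
    by (intro has_fps_expansion_fps_expansion[of "ball 0 1"]) (use h in auto)
  then have "?d has_fps_expansion fps_expansion h 0 - fps_const (of_real a) * fps_X"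
    by (intro fps_expansion_intros)
  from fps_nth_fps_expansion[OF this, of n]
  have eq: "fps_expansion h 0 $ n - (fps_const (of_real a) * fps_X) $ n = (deriv ^^ n) ?d 0 / fact n"
    by (simp only: fps_sub_nth)
  have "norm ((deriv ^^ n) ?d 0) \<le> fact n * (1 - a\<^sup>2) / (1 / 2) ^ n"
  proof (rule Cauchy_inequality)
    show "?d holomorphic_on ball 0 (1 / 2)"
      by (rule holomorphic_on_subset[OF hd]) auto
    show "continuous_on (cball 0 (1 / 2)) ?d"
      by (rule continuous_on_subset[OF holomorphic_on_imp_continuous_on[OF hd]]) auto
    show "cmod (?d z) \<le> 1 - a\<^sup>2" if "cmod (0 - z) = 1 / 2" for z
      using Schwarz_almost_identity[OF h a, of z] that by simp
  qed auto
  then show ?thesis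
    unfolding eq norm_divide by (simp add: field_simps power_divide)
qed

section \<open>Stability of Taylor coefficients under perturbation of the domain\<close>

lemma fps_power_tendsto:
  fixes G :: "nat \<Rightarrow> complex fps"
  assumes "\<And>n. (\<lambda>k. G k $ n) \<longlonglongrightarrow> H $ n"
  shows "(\<lambda>k. (G k ^ i) $ n) \<longlonglongrightarrow> (H ^ i) $ n"
proof (induction i arbitrary: n)
  case (Suc i)
  show ?case
    unfolding power_Suc fps_mult_nth by (intro tendsto_intros assms Suc)
qed simp

text \<open>Composition is triangular in the coefficients. In the n-th coefficient of the
  composition, the lower terms contain the n-th coefficient of G^i with i < n, which tends to 0,
  while the diagonal factor tends to 1. The induction hypothesis keeps the lower coefficients of F
  convergent, hence bounded.\<close>

lemma fps_compose_cancel_tendsto: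
  fixes F G :: "nat \<Rightarrow> complex fps"
  assumes G: "\<And>n. (\<lambda>k. G k $ n) \<longlonglongrightarrow> fps_X $ n"
    and FG: "\<And>n. (\<lambda>k. (F k oo G k) $ n) \<longlonglongrightarrow> H $ n"
  shows "(\<lambda>k. F k $ n) \<longlonglongrightarrow> H $ n"
proof (induction n rule: less_induct)
  case (less n)
  have pow: "(\<lambda>k. (G k ^ i) $ n) \<longlonglongrightarrow> (if n = i then 1 else 0)" for i
    using fps_power_tendsto[OF G, of i n] by (simp add: fps_X_power_nth)
  have *: "(F k oo G k) $ n = (\<Sum>i<n. F k $ i * (G k ^ i) $ n) + F k $ n * (G k ^ n) $ n" for k
    by (simp add: fps_compose_nth atLeast0AtMost lessThan_Suc_atMost[symmetric])
  have "(\<lambda>k. \<Sum>i<n. F k $ i * (G k ^ i) $ n) \<longlonglongrightarrow> (\<Sum>i<n. H $ i * (if n = i then 1 else 0))"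
    by (intro tendsto_intros pow less) auto
  also have "(\<Sum>i<n. H $ i * (if n = i then 1 else 0)) = 0"
    by (intro sum.neutral) auto
  finally have "(\<lambda>k. ((F k oo G k) $ n - (\<Sum>i<n. F k $ i * (G k ^ i) $ n)) / (G k ^ n) $ n)
      \<longlonglongrightarrow> (H $ n - 0) / (if n = n then 1 else 0)"
    by (intro tendsto_divide tendsto_diff FG pow) auto
  \<comment> \<open>The diagonal factor tends to 1, so dividing by it is legitimate for all large
    k.\<close>
  moreover have "eventually (\<lambda>k. (G k ^ n) $ n \<noteq> 0) sequentially"
    using tendsto_imp_eventually_ne[OF pow[of n], of 0] by simp
  then have "eventually (\<lambda>k. ((F k oo G k) $ n - (\<Sum>i<n. F k $ i * (G k ^ i) $ n)) / (G k ^ n) $ n = F k $ n) sequentially"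
    by eventually_elim (simp add: *)
  ultimately show ?case
    by (auto dest: Lim_transform_eventually)
qed

text \<open>The radius of \<open>D' k\<close> lies between s_k times that of \<open>D\<close> and
  q_k, so the subordinating functions have derivative tending to 1 and tend coefficientwise to z.
  Cancelling them in f(s_k z) = g_k(h_k(z)) gives the limit. The bound on the radius takes the place
  of an inclusion of \<open>D' k\<close> in a slightly larger domain.\<close>

lemma coef_tendsto:
  assumes f: "normalized_riemann_map D f"
    and g: "\<And>k. normalized_riemann_map (D' k) (g k)"
    and s: "\<And>k. 0 < s k" "\<And>k. s k < 1" "s \<longlonglongrightarrow> 1"
    and sub: "\<And>k. f ` cball 0 (s k) \<subseteq> D' k"
    and q: "\<And>k. conformal_radius (D' k) < q k" "q \<longlonglongrightarrow> conformal_radius D"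
  shows "(\<lambda>k. coef (D' k) n) \<longlonglongrightarrow> coef D n"
proof -
  define \<rho> where "\<rho> = conformal_radius D"
  define \<rho>' where "\<rho>' k = conformal_radius (D' k)" for k
  have pos: "0 < \<rho>" "0 < \<rho>' k" for k
    using riemann_map_eq(3)[OF f] riemann_map_eq(3)[OF g] by (auto simp: \<rho>_def \<rho>'_def)
  have "(\<lambda>k. s k * \<rho>) \<longlonglongrightarrow> 1 * \<rho>"
    by (intro tendsto_intros s)
  then have lim: "\<rho>' \<longlonglongrightarrow> \<rho>"
    using q(2) conformal_radius_lower_bound[OF f g s(1,2) sub] less_imp_le[OF q(1)]
    by (intro tendsto_sandwich[of "\<lambda>k. s k * \<rho>" \<rho>' sequentially q]) (auto simp: \<rho>_def \<rho>'_def)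
  have "\<exists>h. h holomorphic_on ball 0 1 \<and> h 0 = 0 \<and> (\<forall>z. cmod z < 1 \<longrightarrow> cmod (h z) < 1) \<and>
    (\<forall>z. cmod z < 1 \<longrightarrow> f (of_real (s k) * z) = g k (h z)) \<and>
    deriv h 0 = of_real (s k * \<rho> / \<rho>' k)" for k
    using conformal_radius_subordinate[OF f g s(1,2) sub, of k] unfolding \<rho>_def \<rho>'_def by metis
  then obtain h where h: "\<And>k. h k holomorphic_on ball 0 1" "\<And>k. h k 0 = 0"
    "\<And>k z. cmod z < 1 \<Longrightarrow> cmod (h k z) < 1"
    "\<And>k z. cmod z < 1 \<Longrightarrow> f (of_real (s k) * z) = g k (h k z)"
    "\<And>k. deriv (h k) 0 = of_real (s k * \<rho> / \<rho>' k)"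
    by metis
  define a where "a k = s k * \<rho> / \<rho>' k" for k
  have "a \<longlonglongrightarrow> 1 * \<rho> / \<rho>"
    unfolding a_def using pos by (intro tendsto_intros s lim) auto
  then have a: "a \<longlonglongrightarrow> 1"
    using pos by simp
  define H where "H k = fps_expansion (h k) 0" for k
  have H: "(\<lambda>k. H k $ m) \<longlonglongrightarrow> fps_X $ m" for m
  proof -
    have "(\<lambda>k. H k $ m - of_real (a k) * fps_X $ m) \<longlonglongrightarrow> 0"
    proof (rule Lim_null_comparison)
      show "eventually (\<lambda>k. norm (H k $ m - of_real (a k) * fps_X $ m) \<le> 2 ^ m * (1 - (a k)\<^sup>2)) sequentially"
        using Schwarz_coefficient_bound[OF h(1,2,3,5), unfolded fps_mult_left_const_nth] s pos
        by (intro always_eventually allI) (auto simp: H_def a_def less_imp_le simp del: fps_X_nth)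
      have "(\<lambda>k. 2 ^ m * (1 - (a k)\<^sup>2)) \<longlonglongrightarrow> 2 ^ m * (1 - 1\<^sup>2)"
        by (intro tendsto_intros a)
      then show "(\<lambda>k. 2 ^ m * (1 - (a k)\<^sup>2)) \<longlonglongrightarrow> 0"
        by simp
    qed
    moreover have "(\<lambda>k. complex_of_real (a k) * fps_X $ m) \<longlonglongrightarrow> of_real 1 * fps_X $ m"
      by (intro tendsto_intros a)
    ultimately have "(\<lambda>k. (H k $ m - of_real (a k) * fps_X $ m) + of_real (a k) * fps_X $ m)
        \<longlonglongrightarrow> 0 + of_real 1 * fps_X $ m"
      by (rule tendsto_add)
    then show ?thesis by simp
  qed
  define F where "F = fps_expansion f 0"
  define G where "G k = fps_expansion (g k) 0" for k
  have hol: "f holomorphic_on ball 0 1" "\<And>k. g k holomorphic_on ball 0 1"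
    using f g by (auto simp: normalized_riemann_map_def)
  have fF: "f has_fps_expansion F" and gG: "g k has_fps_expansion G k"
    and hH: "h k has_fps_expansion H k" for k
    unfolding F_def G_def H_def
    by (auto intro!: has_fps_expansion_fps_expansion[of "ball 0 1"] hol h)
  have H0: "H k $ 0 = 0" for k
    using h(2) by (simp add: H_def fps_expansion_def)
  \<comment> \<open>Both sides are the Taylor series at 0 of z -> f(s_k z); dilation multiplies the
    n-th coefficient by the n-th power of s_k.\<close>
  have comp: "G k oo H k = Abs_fps (\<lambda>n. of_real (s k) ^ n * F $ n)" for k
  proof -
    have "(f \<circ> (\<lambda>z. of_real (s k) * z)) has_fps_expansion (F oo (fps_const (of_real (s k)) * fps_X))"
      by (intro has_fps_expansion_compose fF fps_expansion_intros) simp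
    then have 1: "(\<lambda>z. f (of_real (s k) * z)) has_fps_expansion Abs_fps (\<lambda>n. of_real (s k) ^ n * F $ n)"
      by (simp add: o_def fps_compose_linear)
    have 2: "(\<lambda>z. g k (h k z)) has_fps_expansion (G k oo H k)"
      using has_fps_expansion_compose[OF gG hH H0] by (simp add: o_def)
    have "eventually (\<lambda>z. z \<in> ball 0 1) (nhds (0::complex))"
      by (intro eventually_nhds_in_open) auto
    then have "eventually (\<lambda>z. g k (h k z) = f (of_real (s k) * z)) (nhds 0)"
      by eventually_elim (auto simp: h)
    from has_fps_expansion_cong[OF this refl] 2
    have "(\<lambda>z. f (of_real (s k) * z)) has_fps_expansion (G k oo H k)"
      by blast
    with 1 show ?thesis
      using fps_expansion_unique_complex by blast
  qed
  have "(\<lambda>k. (G k oo H k) $ m) \<longlonglongrightarrow> F $ m" for m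
  proof -
    have "(\<lambda>k. of_real (s k) ^ m * F $ m) \<longlonglongrightarrow> of_real 1 ^ m * F $ m"
      by (intro tendsto_intros s)
    then show ?thesis by (simp add: comp)
  qed
  then have "(\<lambda>k. G k $ Suc n) \<longlonglongrightarrow> F $ Suc n"
    by (rule fps_compose_cancel_tendsto[OF H])
  then have "(\<lambda>k. G k $ Suc n / of_real (\<rho>' k)) \<longlonglongrightarrow> F $ Suc n / of_real \<rho>"
    using pos by (intro tendsto_intros lim) auto
  then show ?thesis
    using pos less_imp_neq[OF pos(2)] riemann_map_eq(4)[OF f, of n] riemann_map_eq(4)[OF g, of _ n]
    by (simp add: F_def G_def \<rho>_def[symmetric] \<rho>'_def[symmetric] eq_commute[of 0])
qed

text \<open>Turns sequential convergence into a condition with fixed \<open>s\<close> and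
  \<open>q\<close> that is uniform over all domains: otherwise counterexamples with s -> 1 and q
  tending to the radius would contradict \<open>coef_tendsto\<close>.\<close>

lemma coef_near:
  assumes f: "normalized_riemann_map D f" and U: "open U" "coef D n \<in> U"
  obtains s q where "0 < s" "s < 1" "conformal_radius D < q"
    "\<And>D' g. normalized_riemann_map D' g \<Longrightarrow> f ` cball 0 s \<subseteq> D' \<Longrightarrow> conformal_radius D' < q \<Longrightarrow> coef D' n \<in> U"
proof (rule ccontr)
  assume "\<not> thesis"
  with that have no: "\<not> (\<forall>D' g. normalized_riemann_map D' g \<longrightarrow> f ` cball 0 s \<subseteq> D' \<longrightarrow> conformal_radius D' < q \<longrightarrow> coef D' n \<in> U)"
    if "0 < s" "s < 1" "conformal_radius D < q" for s q
    using that by blast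
  \<comment> \<open>The successor in the numerator gives s 0 = 1/2, so every member is
    positive.\<close>
  define s where "s k = real (Suc k) / real (Suc (Suc k))" for k
  define q where "q k = conformal_radius D + inverse (real (Suc k))" for k
  have s: "0 < s k" "s k < 1" and q: "conformal_radius D < q k" for k
    by (auto simp: s_def q_def field_simps)
  have "\<exists>D' g. normalized_riemann_map D' g \<and> f ` cball 0 (s k) \<subseteq> D' \<and> conformal_radius D' < q k \<and> coef D' n \<notin> U" for k
    using no[OF s q] by blast
  then obtain D' g where *: "\<And>k. normalized_riemann_map (D' k) (g k)" "\<And>k. f ` cball 0 (s k) \<subseteq> D' k"
    "\<And>k. conformal_radius (D' k) < q k" "\<And>k. coef (D' k) n \<notin> U"
    by metis
  have "s \<longlonglongrightarrow> 1"
    unfolding s_def using LIMSEQ_Suc[OF LIMSEQ_n_over_Suc_n] by simp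
  moreover have "q \<longlonglongrightarrow> conformal_radius D + 0"
    unfolding q_def by (intro tendsto_add tendsto_const LIMSEQ_inverse_real_of_nat)
  ultimately have "(\<lambda>k. coef (D' k) n) \<longlonglongrightarrow> coef D n"
    using coef_tendsto[OF f *(1) s _ *(2,3)] by simp
  then have "eventually (\<lambda>k. coef (D' k) n \<in> U) sequentially"
    using U by (rule topological_tendstoD)
  with *(4) show False by simp
qed

section \<open>Existence of normalized maps and their behaviour under dilation\<close>

text \<open>A biholomorphism from the Riemann mapping theorem is preceded by a disc automorphism
  that makes it fix 0 and by a rotation that makes its derivative positive.\<close>

lemma normalized_riemann_map_exists:
  assumes D: "open D" "simply_connected D" "0 \<in> D" "D \<noteq> UNIV"
  shows "\<exists>f. normalized_riemann_map D f"
proof -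
  obtain F G where FG: "F holomorphic_on D" "G holomorphic_on ball 0 1"
    "\<And>z. z \<in> D \<Longrightarrow> F z \<in> ball 0 1 \<and> G (F z) = z" "\<And>z. z \<in> ball 0 1 \<Longrightarrow> G z \<in> D \<and> F (G z) = z"
  proof -
    have "\<exists>F G. F holomorphic_on D \<and> G holomorphic_on ball 0 1 \<and>
        (\<forall>z\<in>D. F z \<in> ball 0 1 \<and> G (F z) = z) \<and> (\<forall>z\<in>ball 0 1. G z \<in> D \<and> F (G z) = z)"
      using simply_connected_eq_biholomorphic_to_disc[OF D(1)] D by blast
    then show ?thesis
      using that by blast
  qed
  obtain A B where AB: "A (F 0) = 0" "A holomorphic_on ball 0 1" "A ` ball 0 1 \<subseteq> ball 0 1"
    "B holomorphic_on ball 0 1" "B ` ball 0 1 \<subseteq> ball 0 1"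
    "\<And>z. z \<in> ball 0 1 \<Longrightarrow> A (B z) = z" "\<And>z. z \<in> ball 0 1 \<Longrightarrow> B (A z) = z"
  proof (rule ball_biholomorphism_exists)
    show "F 0 \<in> ball 0 1"
      using FG(3)[OF D(3)] by blast
  qed (rule that)
  define g where "g = G \<circ> B"
  have g: "g holomorphic_on ball 0 1"
    unfolding g_def using AB FG by (intro holomorphic_on_compose_gen) auto
  have inv: "A (F (g z)) = z" if "z \<in> ball 0 1" for z
    using that AB FG by (simp add: g_def image_subset_iff)
  have inj: "inj_on g (ball 0 1)"
    by (rule inj_on_inverseI) (rule inv)
  have img: "g ` ball 0 1 = D"
  proof
    show "g ` ball 0 1 \<subseteq> D"
      using AB FG by (auto simp: g_def image_subset_iff)
    show "D \<subseteq> g ` ball 0 1"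
    proof
      fix z assume z: "z \<in> D"
      have "A (F z) \<in> ball 0 1"
        using AB(3) FG(3)[OF z] by blast
      moreover have "g (A (F z)) = z"
        using AB FG(3)[OF z] by (auto simp: g_def)
      ultimately have "g (A (F z)) = z" "A (F z) \<in> ball 0 1"
        by auto
      then show "z \<in> g ` ball 0 1"
        by (metis imageI)
    qed
  qed
  have "B 0 = F 0"
    using AB(7)[of "F 0"] AB(1) FG(3)[OF D(3)] by simp
  then have g0: "g 0 = 0"
    using FG(3)[OF D(3)] by (simp add: g_def)
  define d where "d = deriv g 0"
  have d: "d \<noteq> 0"
    unfolding d_def using holomorphic_injective_imp_regular[OF g _ inj] by auto
  \<comment> \<open>The rotation cancels the argument of the derivative \<open>d\<close>.\<close>
  define w where "w = of_real (cmod d) / d"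
  have w: "cmod w = 1" "d * w = of_real (cmod d)"
    using d by (auto simp: w_def norm_divide)
  have wball: "(*) w ` ball 0 1 = ball 0 1"
  proof
    show "(*) w ` ball 0 1 \<subseteq> ball 0 1"
      using w by (auto simp: norm_mult)
    have "z = w * (z / w)" for z
      using w by auto
    moreover have "z / w \<in> ball 0 1" if "z \<in> ball 0 1" for z
      using that w by (simp add: norm_divide)
    ultimately show "ball 0 1 \<subseteq> (*) w ` ball 0 1"
      by blast
  qed
  define f where "f = g \<circ> (*) w"
  have "f holomorphic_on ball 0 1"
    unfolding f_def using wball
    by (intro holomorphic_on_compose_gen[OF _ g] holomorphic_intros) auto
  moreover have "inj_on f (ball 0 1)"
    unfolding f_def using w wball inj by (intro comp_inj_on) (auto intro!: inj_onI)
  moreover have "f ` ball 0 1 = D"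
    unfolding f_def image_comp[symmetric] wball img ..
  moreover have "f 0 = 0"
    by (simp add: f_def g0)
  moreover have "deriv f 0 = of_real (cmod d)"
  proof -
    have "(g has_field_derivative d) (at (w * 0))"
      unfolding d_def using g by (simp add: holomorphic_derivI[where S="ball 0 1"])
    then have "((\<lambda>z. g (w * z)) has_field_derivative d * w) (at 0)"
      by (rule DERIV_chain2) (auto intro!: derivative_eq_intros)
    then show ?thesis
      using w by (auto simp: f_def o_def intro!: DERIV_imp_deriv)
  qed
  ultimately show ?thesis
    using d by (intro exI[of _ f]) (auto simp: normalized_riemann_map_def)
qed

text \<open>Dilation multiplies the radius and every Taylor coefficient by c, so the quotients are
  unchanged. Scaling invariance of u and homogeneity of \<open>rho_infinity\<close> both rest on
  this.\<close>

lemma normalized_riemann_map_scale: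
  assumes f: "normalized_riemann_map D f" and c: "0 < c"
  shows "normalized_riemann_map ((*) (of_real c) ` D) (\<lambda>z. of_real c * f z)"
    and "conformal_radius ((*) (of_real c) ` D) = c * conformal_radius D"
    and "coef ((*) (of_real c) ` D) = coef D"
proof -
  have hol: "f holomorphic_on ball 0 1" "inj_on f (ball 0 1)"
    using f by (auto simp: normalized_riemann_map_def)
  have der: "((\<lambda>z. of_real c * f z) has_field_derivative of_real c * deriv f 0) (at 0)"
    using hol by (intro DERIV_cmult holomorphic_derivI[where S="ball 0 1"]) auto
  have d: "deriv (\<lambda>z. of_real c * f z) 0 = of_real (c * conformal_radius D)"
    using DERIV_imp_deriv[OF der] riemann_map_eq(2)[OF f] by simp
  show *: "normalized_riemann_map ((*) (of_real c) ` D) (\<lambda>z. of_real c * f z)"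
    using f c d riemann_map_eq(3)[OF f] unfolding normalized_riemann_map_def
    by (auto intro!: holomorphic_intros exI[of _ "c * conformal_radius D"] simp: inj_on_def)
  show cr: "conformal_radius ((*) (of_real c) ` D) = c * conformal_radius D"
    using riemann_map_eq(2)[OF *] d by (metis of_real_eq_iff)
  have "f has_fps_expansion fps_expansion f 0"
    using hol by (intro has_fps_expansion_fps_expansion[of "ball 0 1"]) auto
  then have "(\<lambda>z. of_real c * f z) has_fps_expansion fps_const (of_real c) * fps_expansion f 0"
    by (intro fps_expansion_intros)
  then have "fps_expansion (\<lambda>z. of_real c * f z) 0 = fps_const (of_real c) * fps_expansion f 0"
    by (rule fps_expansion_eqI)
  from arg_cong[OF this, of "\<lambda>F. fps_nth F (Suc n)" for n]
  have "coef ((*) (of_real c) ` D) n = coef D n" for n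
    using riemann_map_eq(4)[OF *, of n] riemann_map_eq(4)[OF f, of n] riemann_map_eq(3)[OF f] c
    by (simp add: cr)
  then show "coef ((*) (of_real c) ` D) = coef D" ..
qed

text \<open>Equal normalized coefficients make the two Taylor series proportional, and these series
  converge on the whole disc. This yields injectivity of the coordinates.\<close>

lemma normalized_riemann_map_eq_scale:
  assumes f: "normalized_riemann_map D f" and g: "normalized_riemann_map D' g"
    and eq: "coef D = coef D'"
  shows "D' = (*) (of_real (conformal_radius D' / conformal_radius D)) ` D"
proof -
  define c where "c = conformal_radius D' / conformal_radius D"
  have pos: "0 < conformal_radius D" "0 < conformal_radius D'"
    using riemann_map_eq(3) f g by auto
  have hol: "f holomorphic_on ball 0 1" "g holomorphic_on ball 0 1" "f 0 = 0" "g 0 = 0"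
    and img: "f ` ball 0 1 = D" "g ` ball 0 1 = D'"
    using f g by (auto simp: normalized_riemann_map_def)
  have "g z = of_real c * f z" if z: "z \<in> ball 0 1" for z
  proof -
    have "(deriv ^^ n) g 0 / fact n = of_real c * ((deriv ^^ n) f 0 / fact n)" for n
    proof (cases n)
      case 0
      then show ?thesis by (simp add: hol)
    next
      case (Suc m)
      then show ?thesis
        using riemann_map_eq(4)[OF f, of m] riemann_map_eq(4)[OF g, of m] pos eq
        by (simp add: c_def fps_expansion_def)
    qed
    then have "(\<lambda>n. of_real c * ((deriv ^^ n) f 0 / fact n * (z - 0) ^ n)) sums g z"
      using holomorphic_power_series[OF hol(2) z] by (simp add: mult.assoc)
    moreover have "(\<lambda>n. of_real c * ((deriv ^^ n) f 0 / fact n * (z - 0) ^ n)) sums (of_real c * f z)"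
      by (intro sums_mult holomorphic_power_series[OF hol(1) z])
    ultimately show ?thesis
      by (rule sums_unique2)
  qed
  then have "g ` ball 0 1 = (\<lambda>z. of_real c * f z) ` ball 0 1"
    by (rule image_cong[OF refl])
  also have "\<dots> = (*) (of_real c) ` f ` ball 0 1"
    by (rule image_image[symmetric])
  finally show ?thesis
    unfolding c_def[symmetric] img .
qed

section \<open>Subdomains of the Riemann sphere\<close>

abbreviation sphere_top :: "complex option topology" where
  "sphere_top \<equiv> Alexandroff_compactification euclidean"

lemma surface_top_sphere_domain [simp]:
  "surface_top (sphere_domain D) = subtopology sphere_top D"
  by (simp add: subsurface_def riemann_sphere_def)

lemma topspace_sphere_top [simp]: "topspace sphere_top = UNIV"
  by (simp add: UNIV_option_conv)

text \<open>Its expansion of the carrier would compete with the form \<open>UNIV\<close>.\<close>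

declare topspace_Alexandroff_compactification [simp del]

text \<open>By Heine-Borel, the compact complement of a neighbourhood of infinity is a closed
  bounded set, and closedness is already part of the first condition.\<close>

lemma openin_sphere_top:
  "openin sphere_top U \<longleftrightarrow> open (Some -` U) \<and> (None \<in> U \<longrightarrow> bounded (- (Some -` U)))"
proof
  assume "openin sphere_top U"
  then consider V where "open V" "U = Some ` V"
    | C where "compact C" "U = insert None (Some ` (UNIV - C))"
    by (auto simp: openin_Alexandroff_compactification)
  then show "open (Some -` U) \<and> (None \<in> U \<longrightarrow> bounded (- (Some -` U)))"
  proof cases
    case 1
    then show ?thesis by (auto simp: vimage_def image_iff)
  next
    case 2
    then have "Some -` U = - C" by auto
    with 2 show ?thesis
      by (simp add: compact_imp_bounded compact_imp_closed open_Compl)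
  qed
next
  assume *: "open (Some -` U) \<and> (None \<in> U \<longrightarrow> bounded (- (Some -` U)))"
  show "openin sphere_top U"
  proof (cases "None \<in> U")
    case True
    then have "p \<in> U \<longleftrightarrow> p \<in> insert None (Some ` (UNIV - (- (Some -` U))))" for p
      by (cases p) auto
    then have "U = insert None (Some ` (UNIV - (- (Some -` U))))"
      by blast
    moreover have "compact (- (Some -` U))"
      using * True by (simp add: compact_eq_bounded_closed closed_def)
    ultimately show ?thesis
      unfolding openin_Alexandroff_compactification
      by (metis closed_closedin compact_imp_closed compactin_euclidean_iff topspace_euclidean)
  next
    case False
    then have "p \<in> U \<longleftrightarrow> p \<in> Some ` (Some -` U)" for p
      by (cases p) auto
    then have "U = Some ` (Some -` U)"
      by blast
    then show ?thesis
      using * by (metis openin_Alexandroff_compactification_image_Some open_openin)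
  qed
qed

text \<open>As an involution of the whole sphere it turns statements about neighbourhoods of
  infinity, and about \<open>U_minus\<close>, into planar statements at 0.\<close>

definition sphere_inv :: "complex option \<Rightarrow> complex option" where
  "sphere_inv p = (case p of None \<Rightarrow> Some 0 | Some z \<Rightarrow> if z = 0 then None else Some (inverse z))"

lemma sphere_inv_simps [simp]:
  "sphere_inv None = Some 0" "sphere_inv (Some 0) = None"
  "z \<noteq> 0 \<Longrightarrow> sphere_inv (Some z) = Some (inverse z)"
  "sphere_inv (sphere_inv p) = p" "sphere_inv p = None \<longleftrightarrow> p = Some 0"
  by (auto simp: sphere_inv_def split: option.splits)

lemma bij_sphere_inv: "bij sphere_inv"
  by (rule involuntory_imp_bij) simp

lemma image_sphere_inv: "p \<in> sphere_inv ` D \<longleftrightarrow> sphere_inv p \<in> D"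
  by (metis image_iff sphere_inv_simps(4))

lemma sphere_inv_sphere_inv_image [simp]: "sphere_inv ` sphere_inv ` D = D"
  by (simp add: image_image)

lemma continuous_map_sphere_inv: "continuous_map sphere_top sphere_top sphere_inv"
  unfolding continuous_map_def
proof (intro conjI allI impI)
  fix U assume "openin sphere_top U"
  then have V: "open (Some -` U)" and b: "None \<in> U \<Longrightarrow> bounded (- (Some -` U))"
    by (auto simp: openin_sphere_top)
  define V where "V = Some -` U"
  have "continuous_on (- {0::complex}) inverse"
    by (intro continuous_intros) auto
  then have op: "open (inverse -` V \<inter> - {0})"
    using V continuous_open_preimage[of "- {0}" inverse V] by (simp add: V_def Int_commute open_Compl)
  show "openin sphere_top {x \<in> topspace sphere_top. sphere_inv x \<in> U}"
    unfolding openin_sphere_top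
  proof (intro conjI impI)
    show "open (Some -` {x \<in> topspace sphere_top. sphere_inv x \<in> U})"
    proof (cases "None \<in> U")
      case False
      then have "Some -` {x \<in> topspace sphere_top. sphere_inv x \<in> U} = inverse -` V \<inter> - {0}"
        by (auto simp: V_def sphere_inv_def split: if_splits)
      with op show ?thesis by simp
    next
      case True
      from b[OF this] obtain R where R: "R > 0" "\<And>z. z \<notin> V \<Longrightarrow> cmod z \<le> R"
        by (auto simp: bounded_pos V_def)
      have *: "inverse z \<in> V" if "z \<noteq> 0" "cmod z < 1 / R" for z
      proof (rule ccontr)
        assume "inverse z \<notin> V"
        from R(2)[OF this] have "1 \<le> R * cmod z"
          using that by (simp add: norm_divide norm_inverse field_simps)
        with that R show False by (simp add: field_simps)
      qed
      \<comment> \<open>The point 0 is sent to infinity; the bound R on the complement of V provides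
        a full disc around 0 in the preimage, which makes it open there.\<close>
      have "Some -` {x \<in> topspace sphere_top. sphere_inv x \<in> U} = (inverse -` V \<inter> - {0}) \<union> ball 0 (1 / R)"
        using True * R(1) by (auto simp: V_def sphere_inv_def split: if_splits)
      with op show ?thesis by auto
    qed
    assume "None \<in> {x \<in> topspace sphere_top. sphere_inv x \<in> U}"
    then have "0 \<in> V" by (auto simp: V_def)
    with V obtain e where e: "e > 0" "ball 0 e \<subseteq> V"
      unfolding V_def[symmetric] by (auto simp: open_contains_ball)
    have "cmod z \<le> 1 / e" if "z \<notin> Some -` {x \<in> topspace sphere_top. sphere_inv x \<in> U}" for z
    proof (cases "z = 0")
      case False
      then have "inverse z \<notin> V" using that by (auto simp: V_def)
      then have "\<not> cmod (inverse z) < e" using e by auto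
      then show ?thesis using False e by (simp add: norm_divide norm_inverse field_simps)
    qed (use e in auto)
    then show "bounded (- (Some -` {x \<in> topspace sphere_top. sphere_inv x \<in> U}))"
      unfolding bounded_iff by blast
  qed
qed auto

section \<open>Transfer of maps between the plane and the sphere\<close>

lemma homeomorphic_maps_Some:
  "homeomorphic_maps (top_of_set V) (subtopology sphere_top (Some ` V)) Some the"
proof -
  have "homeomorphic_map euclidean (subtopology sphere_top (range Some)) Some"
    using embedding_map_Some[of "euclidean :: complex topology"] by (simp add: embedding_map_def)
  then have "homeomorphic_map (top_of_set V) (subtopology (subtopology sphere_top (range Some)) (Some ` V)) Some"
    by (rule homeomorphic_map_subtopologies) auto
  also have "subtopology (subtopology sphere_top (range Some)) (Some ` V) = subtopology sphere_top (Some ` V)"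
    by (simp add: subtopology_subtopology Int_absorb1 image_mono)
  finally obtain g where g: "homeomorphic_maps (top_of_set V) (subtopology sphere_top (Some ` V)) Some g"
    by (auto simp: homeomorphic_map_maps)
  then show ?thesis
    by (rule homeomorphic_maps_eq) (use g in \<open>auto simp: homeomorphic_maps_def\<close>)
qed

lemma continuous_map_the: "continuous_map (subtopology sphere_top (Some ` V)) (top_of_set V) the"
  and continuous_map_Some': "continuous_map (top_of_set V) (subtopology sphere_top (Some ` V)) Some"
  using homeomorphic_maps_Some[of V] by (auto simp: homeomorphic_maps_def)

lemma continuous_map_Some_conj:
  assumes "continuous_on D f" "f ` D \<subseteq> E" "\<And>z. z \<in> D \<Longrightarrow> \<phi> (Some z) = Some (f z)"
  shows "continuous_map (subtopology sphere_top (Some ` D)) (subtopology sphere_top (Some ` E)) \<phi>"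
proof -
  have "continuous_map (top_of_set D) (top_of_set E) f"
    using assms by auto
  then have "continuous_map (subtopology sphere_top (Some ` D)) (subtopology sphere_top (Some ` E)) (Some \<circ> (f \<circ> the))"
    by (intro continuous_map_compose[OF continuous_map_compose[OF continuous_map_the] continuous_map_Some'])
  then show ?thesis
    by (rule continuous_map_eq) (use assms in auto)
qed

text \<open>The chart at infinity is \<open>the \<circ> sphere_inv\<close> on its domain, so both charts, and their
  inverses, are obtained from \<open>the\<close> and \<open>Some\<close> by composition with an element of \<open>{id, sphere_inv}\<close>.\<close>

lemma holomorphic_map_sphere_iff:
  "holomorphic_map (sphere_domain D) (sphere_domain E) \<phi> \<longleftrightarrow>
     continuous_map (subtopology sphere_top D) (subtopology sphere_top E) \<phi> \<and>
     (\<forall>a\<in>{id, sphere_inv}. \<forall>b\<in>{id, sphere_inv}.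
        (\<lambda>z. the (b (\<phi> (a (Some z))))) holomorphic_on
          {z. a (Some z) \<in> D \<and> \<phi> (a (Some z)) \<in> E \<and> b (\<phi> (a (Some z))) \<noteq> None})"
proof -
  \<comment> \<open>These are the chart domains: \<open>range Some\<close> for \<open>id\<close> and
    \<open>UNIV - {Some 0}\<close> for \<open>sphere_inv\<close>. Both charts become instances of
    one expression in \<open>a\<close>.\<close>
  define dom :: "(complex option \<Rightarrow> complex option) \<Rightarrow> complex option set"
    where "dom a = {p. a p \<noteq> None}" for a
  define chart :: "(complex option \<Rightarrow> complex option) \<Rightarrow> complex option \<Rightarrow> complex"
    where "chart a = (if a = id then the else (\<lambda>p. case p of None \<Rightarrow> 0 | Some z \<Rightarrow> inverse z))" for a
  have ne: "sphere_inv \<noteq> id"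
    by (metis id_apply option.distinct(1) sphere_inv_simps(1))
  have chart: "chart a p = the (a p)" if "a \<in> {id, sphere_inv}" "p \<in> dom a" for a p
    using that ne by (auto simp: chart_def dom_def sphere_inv_def split: option.splits if_splits)
  have aa: "a (a p) = p" if "a \<in> {id, sphere_inv}" for a p
    using that by auto
  have atl: "atlas (sphere_domain X) = (\<lambda>a. (dom a \<inter> X, chart a)) ` {id, sphere_inv}" for X
    using ne by (auto simp: subsurface_def riemann_sphere_def dom_def chart_def image_iff)
  have inv: "inv_into (dom a \<inter> X) (chart a) z = a (Some z)"
    if a: "a \<in> {id, sphere_inv}" and z: "a (Some z) \<in> X" for a X z
  proof (rule inv_into_f_eq)
    show "inj_on (chart a) (dom a \<inter> X)"
    proof (rule inj_onI)
      fix p q assume pq: "p \<in> dom a \<inter> X" "q \<in> dom a \<inter> X" "chart a p = chart a q"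
      then have "a p = a q"
        using chart[OF a] by (auto simp: dom_def option.expand)
      then show "p = q" using aa[OF a] by metis
    qed
    show "a (Some z) \<in> dom a \<inter> X"
      using a z by (auto simp: dom_def aa)
    then show "chart a (a (Some z)) = z"
      using chart[OF a, of "a (Some z)"] a by (auto simp: aa)
  qed
  have img: "chart a ` (dom a \<inter> X) = {z. a (Some z) \<in> X}" if a: "a \<in> {id, sphere_inv}" for a X
  proof
    show "chart a ` (dom a \<inter> X) \<subseteq> {z. a (Some z) \<in> X}"
    proof
      fix z assume "z \<in> chart a ` (dom a \<inter> X)"
      then obtain p where p: "p \<in> dom a" "p \<in> X" "z = the (a p)"
        using chart[OF a] by auto
      then have "Some z = a p"
        by (auto simp: dom_def)
      then show "z \<in> {z. a (Some z) \<in> X}"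
        using p aa[OF a] by simp
    qed
    show "{z. a (Some z) \<in> X} \<subseteq> chart a ` (dom a \<inter> X)"
    proof
      fix z assume "z \<in> {z. a (Some z) \<in> X}"
      moreover have "a (Some z) \<in> dom a"
        using aa[OF a] by (auto simp: dom_def)
      moreover from chart[OF a this] have "chart a (a (Some z)) = z"
        using aa[OF a] by simp
      ultimately show "z \<in> chart a ` (dom a \<inter> X)"
        by (metis (no_types, lifting) IntI imageI mem_Collect_eq)
    qed
  qed
  have *: "(chart b \<circ> \<phi> \<circ> inv_into (dom a \<inter> D) (chart a)) holomorphic_on
        chart a ` ((dom a \<inter> D) \<inter> \<phi> -` (dom b \<inter> E)) \<longleftrightarrow>
      (\<lambda>z. the (b (\<phi> (a (Some z))))) holomorphic_on
          {z. a (Some z) \<in> D \<and> \<phi> (a (Some z)) \<in> E \<and> b (\<phi> (a (Some z))) \<noteq> None}"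
    if a: "a \<in> {id, sphere_inv}" and b: "b \<in> {id, sphere_inv}" for a b
  proof -
    have "chart a ` ((dom a \<inter> D) \<inter> \<phi> -` (dom b \<inter> E)) =
        {z. a (Some z) \<in> D \<and> \<phi> (a (Some z)) \<in> E \<and> b (\<phi> (a (Some z))) \<noteq> None}"
      using img[OF a, of "D \<inter> \<phi> -` (dom b \<inter> E)"] by (auto simp: dom_def Int_assoc)
    then show ?thesis
      using inv[OF a] chart[OF b] by (intro holomorphic_cong) (auto simp: dom_def)
  qed
  have image: "(\<forall>x\<in>(\<lambda>a. (dom a \<inter> X, chart a)) ` {id, sphere_inv}. P x) \<longleftrightarrow>
      (\<forall>a\<in>{id, sphere_inv}. P (dom a \<inter> X, chart a))" for X P
    by simp
  show ?thesis
    unfolding holomorphic_map_def atl surface_top_sphere_domain by (simp only: image prod.case * cong: ball_cong)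
qed

text \<open>Inverse maps are given by \<open>inv_into\<close>, whose values are controlled only on
  the image, so replacement by a map that agrees on \<open>D\<close> is required.\<close>

lemma holomorphic_map_sphere_cong:
  assumes "\<And>p. p \<in> D \<Longrightarrow> \<phi> p = \<psi> p" "holomorphic_map (sphere_domain D) (sphere_domain E) \<phi>"
  shows "holomorphic_map (sphere_domain D) (sphere_domain E) \<psi>"
  unfolding holomorphic_map_sphere_iff
proof (intro conjI ballI)
  show "continuous_map (subtopology sphere_top D) (subtopology sphere_top E) \<psi>"
    by (rule continuous_map_eq[of _ _ \<phi>]) (use assms in \<open>auto simp: holomorphic_map_sphere_iff\<close>)
  fix a b assume ab: "a \<in> {id, sphere_inv}" "b \<in> {id, sphere_inv}"
  have "{z. a (Some z) \<in> D \<and> \<psi> (a (Some z)) \<in> E \<and> b (\<psi> (a (Some z))) \<noteq> None} =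
        {z. a (Some z) \<in> D \<and> \<phi> (a (Some z)) \<in> E \<and> b (\<phi> (a (Some z))) \<noteq> None}"
    using assms(1) by auto
  moreover have "(\<lambda>z. the (b (\<phi> (a (Some z))))) holomorphic_on
          {z. a (Some z) \<in> D \<and> \<phi> (a (Some z)) \<in> E \<and> b (\<phi> (a (Some z))) \<noteq> None}"
    using assms(2) ab unfolding holomorphic_map_sphere_iff by blast
  ultimately have "(\<lambda>z. the (b (\<phi> (a (Some z))))) holomorphic_on
          {z. a (Some z) \<in> D \<and> \<psi> (a (Some z)) \<in> E \<and> b (\<psi> (a (Some z))) \<noteq> None}"
    by simp
  then show "(\<lambda>z. the (b (\<psi> (a (Some z))))) holomorphic_on
          {z. a (Some z) \<in> D \<and> \<psi> (a (Some z)) \<in> E \<and> b (\<psi> (a (Some z))) \<noteq> None}"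
    by (rule holomorphic_transform) (simp add: assms(1))
qed

text \<open>Conjugation by the inversion merely permutes the four pairs of charts, so the conditions
  for the conjugate are those for \<phi> in another order.\<close>

lemma holomorphic_map_sphere_inv:
  assumes "holomorphic_map (sphere_domain D) (sphere_domain E) \<phi>"
  shows "holomorphic_map (sphere_domain (sphere_inv ` D)) (sphere_domain (sphere_inv ` E))
           (sphere_inv \<circ> \<phi> \<circ> sphere_inv)"
  unfolding holomorphic_map_sphere_iff
proof (intro conjI ballI)
  have *: "continuous_map (subtopology sphere_top D) (subtopology sphere_top E) \<phi>"
    using assms by (simp add: holomorphic_map_sphere_iff)
  have c: "continuous_map (subtopology sphere_top X) (subtopology sphere_top (sphere_inv ` X)) sphere_inv" for X
    by (intro continuous_map_into_subtopology continuous_map_from_subtopology continuous_map_sphere_inv) auto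
  show "continuous_map (subtopology sphere_top (sphere_inv ` D)) (subtopology sphere_top (sphere_inv ` E))
      (sphere_inv \<circ> \<phi> \<circ> sphere_inv)"
    using continuous_map_compose[OF continuous_map_compose[OF c[of "sphere_inv ` D", unfolded sphere_inv_sphere_inv_image] *] c]
    by (simp add: o_assoc)
  fix a b assume a: "a \<in> {id, sphere_inv}" and b: "b \<in> {id, sphere_inv}"
  have invol: "sphere_inv \<circ> sphere_inv = id" by auto
  have a': "sphere_inv \<circ> a \<in> {id, sphere_inv}" "b \<circ> sphere_inv \<in> {id, sphere_inv}"
    using a b invol by auto
  then have "(\<lambda>z. the ((b \<circ> sphere_inv) (\<phi> ((sphere_inv \<circ> a) (Some z))))) holomorphic_on
          {z. (sphere_inv \<circ> a) (Some z) \<in> D \<and> \<phi> ((sphere_inv \<circ> a) (Some z)) \<in> E \<and>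
              (b \<circ> sphere_inv) (\<phi> ((sphere_inv \<circ> a) (Some z))) \<noteq> None}"
    using assms unfolding holomorphic_map_sphere_iff by blast
  then show "(\<lambda>z. the (b ((sphere_inv \<circ> \<phi> \<circ> sphere_inv) (a (Some z))))) holomorphic_on
          {z. a (Some z) \<in> sphere_inv ` D \<and> (sphere_inv \<circ> \<phi> \<circ> sphere_inv) (a (Some z)) \<in> sphere_inv ` E \<and>
              b ((sphere_inv \<circ> \<phi> \<circ> sphere_inv) (a (Some z))) \<noteq> None}"
    by (simp add: image_sphere_inv)
qed

lemma holomorphic_map_SomeI:
  assumes f: "f holomorphic_on D" "f ` D \<subseteq> E" and \<phi>: "\<And>z. z \<in> D \<Longrightarrow> \<phi> (Some z) = Some (f z)"
  shows "holomorphic_map (sphere_domain (Some ` D)) (sphere_domain (Some ` E)) \<phi>"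
  unfolding holomorphic_map_sphere_iff
proof (intro conjI)
  show "continuous_map (subtopology sphere_top (Some ` D)) (subtopology sphere_top (Some ` E)) \<phi>"
    using f \<phi> by (intro continuous_map_Some_conj holomorphic_on_imp_continuous_on)
  \<comment> \<open>The facts 1 to 4 treat the charts of source and target in the order (z, z), (z,
    1/z), (1/z, z), (1/z, 1/z).\<close>
  have 1: "(\<lambda>z. the (\<phi> (Some z))) holomorphic_on {z. Some z \<in> Some ` D}"
    by (rule holomorphic_transform[OF f(1)[THEN holomorphic_on_subset]]) (auto simp: \<phi>)
  have 2: "(\<lambda>z. the (sphere_inv (\<phi> (Some z)))) holomorphic_on {z. Some z \<in> Some ` D \<and> f z \<noteq> 0}"
    by (rule holomorphic_transform[of "\<lambda>z. inverse (f z)"])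
      (auto simp: \<phi> intro!: holomorphic_intros f(1)[THEN holomorphic_on_subset])
  have sub: "\<phi> p \<in> Some ` E" if "p \<in> Some ` D" for p
    using f(2) \<phi> that by auto
  have eq: "sphere_inv (Some z) \<in> Some ` D \<longleftrightarrow> z \<noteq> 0 \<and> inverse z \<in> D" for z
    by (cases "z = 0") auto
  let ?I = "{z. z \<noteq> 0 \<and> inverse z \<in> D}"
  have "(f \<circ> inverse) holomorphic_on ?I"
    by (intro holomorphic_on_compose_gen[OF _ f(1)] holomorphic_intros) auto
  then have fi: "(\<lambda>z. f (inverse z)) holomorphic_on ?I"
    by (simp add: o_def)
  have 3: "(\<lambda>z. the (\<phi> (sphere_inv (Some z)))) holomorphic_on ?I"
    by (rule holomorphic_transform[OF fi]) (auto simp: \<phi>)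
  have 4: "(\<lambda>z. the (sphere_inv (\<phi> (sphere_inv (Some z))))) holomorphic_on {z\<in>?I. f (inverse z) \<noteq> 0}"
    by (rule holomorphic_transform[of "\<lambda>z. inverse (f (inverse z))"])
      (auto simp: \<phi> intro!: holomorphic_intros fi[THEN holomorphic_on_subset])
  show "\<forall>a\<in>{id, sphere_inv}. \<forall>b\<in>{id, sphere_inv}.
        (\<lambda>z. the (b (\<phi> (a (Some z))))) holomorphic_on
          {z. a (Some z) \<in> Some ` D \<and> \<phi> (a (Some z)) \<in> Some ` E \<and> b (\<phi> (a (Some z))) \<noteq> None}"
  proof (simp, intro conjI)
    show "(\<lambda>z. the (\<phi> (Some z))) holomorphic_on
        {z. Some z \<in> Some ` D \<and> \<phi> (Some z) \<in> Some ` E \<and> (\<exists>y. \<phi> (Some z) = Some y)}"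
      by (rule holomorphic_on_subset[OF 1]) auto
    show "(\<lambda>z. the (sphere_inv (\<phi> (Some z)))) holomorphic_on
        {z. Some z \<in> Some ` D \<and> \<phi> (Some z) \<in> Some ` E \<and> (\<exists>y. sphere_inv (\<phi> (Some z)) = Some y)}"
      by (rule holomorphic_on_subset[OF 2]) (auto simp: \<phi>)
    show "(\<lambda>z. the (\<phi> (sphere_inv (Some z)))) holomorphic_on
        {z. sphere_inv (Some z) \<in> Some ` D \<and> \<phi> (sphere_inv (Some z)) \<in> Some ` E \<and>
            (\<exists>y. \<phi> (sphere_inv (Some z)) = Some y)}"
      by (rule holomorphic_on_subset[OF 3]) (auto simp: eq)
    show "(\<lambda>z. the (sphere_inv (\<phi> (sphere_inv (Some z))))) holomorphic_on
        {z. sphere_inv (Some z) \<in> Some ` D \<and> \<phi> (sphere_inv (Some z)) \<in> Some ` E \<and>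
            (\<exists>y. sphere_inv (\<phi> (sphere_inv (Some z))) = Some y)}"
      by (rule holomorphic_on_subset[OF 4]) (auto simp: \<phi> eq)
  qed
qed

lemma holomorphic_map_SomeD:
  assumes "holomorphic_map (sphere_domain (Some ` D)) (sphere_domain (Some ` E)) \<phi>"
  shows "(\<lambda>z. the (\<phi> (Some z))) holomorphic_on D"
proof -
  have "continuous_map (subtopology sphere_top (Some ` D)) (subtopology sphere_top (Some ` E)) \<phi>"
    and hol: "(\<lambda>z. the (id (\<phi> (id (Some z))))) holomorphic_on
      {z. id (Some z) \<in> Some ` D \<and> \<phi> (id (Some z)) \<in> Some ` E \<and> id (\<phi> (id (Some z))) \<noteq> None}"
    using assms unfolding holomorphic_map_sphere_iff by blast+
  then have "\<phi> ` Some ` D \<subseteq> Some ` E"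
    using continuous_map_image_subset_topspace by fastforce
  then have "D \<subseteq> {z. id (Some z) \<in> Some ` D \<and> \<phi> (id (Some z)) \<in> Some ` E \<and> id (\<phi> (id (Some z))) \<noteq> None}"
    by auto
  from holomorphic_on_subset[OF hol this] show ?thesis by simp
qed

lemma conformal_iso_sphere_inv:
  assumes "conformal_iso (sphere_domain D) (sphere_domain E) \<phi>"
  shows "conformal_iso (sphere_domain (sphere_inv ` D)) (sphere_domain (sphere_inv ` E))
           (sphere_inv \<circ> \<phi> \<circ> sphere_inv)"
proof -
  have hol: "holomorphic_map (sphere_domain D) (sphere_domain E) \<phi>"
    and bij: "bij_betw \<phi> D E"
    and inv: "holomorphic_map (sphere_domain E) (sphere_domain D) (inv_into D \<phi>)"
    using assms by (auto simp: conformal_iso_def)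
  have b: "bij_betw sphere_inv X (sphere_inv ` X)" for X
    using bij_sphere_inv by (metis bij_betw_def bij_is_inj inj_on_subset top_greatest)
  have bij': "bij_betw (sphere_inv \<circ> \<phi> \<circ> sphere_inv) (sphere_inv ` D) (sphere_inv ` E)"
    using bij_betw_trans[OF bij_betw_trans[OF b[of "sphere_inv ` D", unfolded sphere_inv_sphere_inv_image] bij] b]
    by (simp add: o_assoc)
  have "holomorphic_map (sphere_domain (sphere_inv ` E)) (sphere_domain (sphere_inv ` D))
      (inv_into (sphere_inv ` D) (sphere_inv \<circ> \<phi> \<circ> sphere_inv))"
  proof (rule holomorphic_map_sphere_cong[OF _ holomorphic_map_sphere_inv[OF inv]])
    fix p assume p: "p \<in> sphere_inv ` E"
    show "(sphere_inv \<circ> inv_into D \<phi> \<circ> sphere_inv) p = inv_into (sphere_inv ` D) (sphere_inv \<circ> \<phi> \<circ> sphere_inv) p"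
    proof (rule inv_into_f_eq[symmetric])
      show "inj_on (sphere_inv \<circ> \<phi> \<circ> sphere_inv) (sphere_inv ` D)"
        using bij' by (rule bij_betw_imp_inj_on)
      have q: "sphere_inv p \<in> \<phi> ` D"
        using p bij by (auto simp: bij_betw_def image_sphere_inv)
      then show "(sphere_inv \<circ> inv_into D \<phi> \<circ> sphere_inv) p \<in> sphere_inv ` D"
        by (auto simp: inv_into_into)
      show "(sphere_inv \<circ> \<phi> \<circ> sphere_inv) ((sphere_inv \<circ> inv_into D \<phi> \<circ> sphere_inv) p) = p"
        using q by (simp add: f_inv_into_f)
    qed
  qed
  then show ?thesis
    using bij' holomorphic_map_sphere_inv[OF hol] by (simp add: conformal_iso_def)
qed

lemma conformal_iso_SomeI:
  assumes f: "f holomorphic_on D" "open D" "inj_on f D" "f ` D = E" and \<phi>: "\<And>z. z \<in> D \<Longrightarrow> \<phi> (Some z) = Some (f z)"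
  shows "conformal_iso (sphere_domain (Some ` D)) (sphere_domain (Some ` E)) \<phi>"
proof -
  obtain g where g: "g holomorphic_on f ` D" "\<And>z. z \<in> D \<Longrightarrow> g (f z) = z"
    by (rule holomorphic_has_inverse[OF f(1-3)]) blast
  have inj: "inj_on \<phi> (Some ` D)"
    using f(3) \<phi> by (auto simp: inj_on_def)
  have bij: "bij_betw \<phi> (Some ` D) (Some ` E)"
    using inj \<phi> f(4) by (auto simp: bij_betw_def image_image)
  have "holomorphic_map (sphere_domain (Some ` E)) (sphere_domain (Some ` D)) (inv_into (Some ` D) \<phi>)"
  proof (rule holomorphic_map_SomeI)
    show "g holomorphic_on E" "g ` E \<subseteq> D"
      using g f(4) by auto
    fix w assume "w \<in> E"
    then obtain z where "z \<in> D" "w = f z" using f(4) by auto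
    then show "inv_into (Some ` D) \<phi> (Some w) = Some (g w)"
      using inv_into_f_f[OF inj, of "Some z"] \<phi> g by simp
  qed
  moreover have "holomorphic_map (sphere_domain (Some ` D)) (sphere_domain (Some ` E)) \<phi>"
    using f \<phi> by (intro holomorphic_map_SomeI) auto
  ultimately show ?thesis
    using bij by (simp add: conformal_iso_def)
qed

lemma conformal_embedding_SomeI:
  assumes f: "f holomorphic_on D" "inj_on f D" "f ` D \<subseteq> E" and \<phi>: "\<And>z. z \<in> D \<Longrightarrow> \<phi> (Some z) = Some (f z)"
  shows "conformal_embedding (sphere_domain (Some ` D)) (sphere_domain (Some ` E)) \<phi>"
  using assms holomorphic_map_SomeI[OF f(1,3) \<phi>]
  by (auto simp: conformal_embedding_def inj_on_def)

section \<open>Planar domains as Riemann surfaces, and their loops\<close>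

lemma Hausdorff_sphere_top: "Hausdorff_space sphere_top"
  by (simp add: Hausdorff_space_Alexandroff_compactification locally_compact_space_euclidean)

text \<open>Conformal restriction can be invoked only for Riemann surfaces, in particular the
  punctured plane and punctured discs. The restricted atlas consists of z on \<open>D\<close> and
  1/z on \<open>D - {0}\<close>.\<close>

lemma riemann_surface_sphere_domain:
  assumes D: "open D" "connected D" "D \<noteq> {}"
  shows "riemann_surface (sphere_domain (Some ` D))"
proof -
  let ?c = "\<lambda>p. case p of None \<Rightarrow> 0 | Some z \<Rightarrow> inverse (z::complex)"
  let ?U = "Some ` (D - {0})"
  have "range Some \<inter> Some ` D = Some ` D" "(UNIV - {Some 0}) \<inter> Some ` D = ?U"
    by auto
  then have atl: "atlas (sphere_domain (Some ` D)) = {(Some ` D, the), (?U, ?c)}"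
    by (auto simp: subsurface_def riemann_sphere_def)
  have D0: "open (D - {0})" using D by auto
  have cimg: "?c ` ?U = inverse ` (D - {0})"
    by (auto simp: image_image)
  have "continuous_on (D - {0}) inverse"
    by (intro continuous_intros) auto
  then have hom: "homeomorphism (D - {0}) (inverse ` (D - {0})) inverse inverse"
    by (auto simp: homeomorphism_def image_image intro!: continuous_intros)
  have opinv: "open (inverse ` (D - {0}))"
  proof (rule open_mapping_thm3)
    show "inverse holomorphic_on D - {0}"
      by (intro holomorphic_intros) auto
  qed (use D0 in \<open>auto simp: inj_on_def\<close>)
  have opin: "openin sphere_top (Some ` V)" if "open V" for V
    using that by simp
  have the: "homeomorphic_map (subtopology sphere_top (Some ` V)) (top_of_set V) the" for V
    unfolding homeomorphic_map_maps using homeomorphic_maps_Some[of V] homeomorphic_maps_sym by blast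
  have 1: "homeomorphic_map (subtopology (subtopology sphere_top (Some ` D)) (Some ` D)) (top_of_set (the ` Some ` D)) the"
    using the[of D] by (simp add: subtopology_subtopology image_image)
  have 2: "homeomorphic_map (subtopology (subtopology sphere_top (Some ` D)) ?U) (top_of_set (?c ` ?U)) ?c"
  proof -
    have "homeomorphic_map (subtopology sphere_top ?U) (top_of_set (D - {0})) the"
      by (rule the)
    moreover have "homeomorphic_map (top_of_set (D - {0})) (top_of_set (inverse ` (D - {0}))) inverse"
      using hom unfolding homeomorphic_map_maps homeomorphic_maps_def homeomorphism_def
      by (intro exI[of _ inverse]) auto
    ultimately have "homeomorphic_map (subtopology sphere_top ?U) (top_of_set (inverse ` (D - {0}))) (inverse \<circ> the)"
      by (rule homeomorphic_map_compose)
    then have "homeomorphic_map (subtopology sphere_top ?U) (top_of_set (inverse ` (D - {0}))) ?c"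
      by (rule homeomorphic_map_eq) auto
    moreover have "Some ` D \<inter> ?U = ?U" by auto
    ultimately show ?thesis
      unfolding cimg by (simp add: subtopology_subtopology)
  qed
  have inj1: "inj_on the (Some ` D)" and inj2: "inj_on ?c ?U"
    by (auto simp: inj_on_def)
  have i1: "inv_into (Some ` D) the z = Some z" if "z \<in> D" for z
    by (rule inv_into_f_eq[OF inj1]) (use that in auto)
  have i2: "inv_into ?U ?c z = Some (inverse z)" if "z \<noteq> 0" "inverse z \<in> D" for z
    by (rule inv_into_f_eq[OF inj2]) (use that in auto)
  have dz: "z \<noteq> 0 \<and> inverse z \<in> D" if "z \<in> ?c ` (?U \<inter> X)" for z X
    using that by auto
  have h: "(\<psi> \<circ> inv_into U \<phi>) holomorphic_on \<phi> ` (U \<inter> V)"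
    if "(U, \<phi>) \<in> {(Some ` D, the), (?U, ?c)}" "(V, \<psi>) \<in> {(Some ` D, the), (?U, ?c)}" for U V \<phi> \<psi>
  proof -
    have id: "(\<lambda>z. z) holomorphic_on S" and inv: "inverse holomorphic_on (S - {0})" for S :: "complex set"
      by (auto intro!: holomorphic_intros)
    have a: "(the \<circ> inv_into (Some ` D) the) holomorphic_on the ` (Some ` D \<inter> Some ` D)"
      by (rule holomorphic_transform[OF id]) (auto simp: i1)
    have b: "(the \<circ> inv_into ?U ?c) holomorphic_on ?c ` (?U \<inter> Some ` D)"
    proof (rule holomorphic_transform[OF holomorphic_on_subset[OF inv[of UNIV]]])
      show "inverse z = (the \<circ> inv_into ?U ?c) z" if "z \<in> ?c ` (?U \<inter> Some ` D)" for z
        using i2[of z] dz[OF that] by simp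
    qed (use dz in blast)
    have c: "(?c \<circ> inv_into (Some ` D) the) holomorphic_on the ` (Some ` D \<inter> ?U)"
      by (rule holomorphic_transform[OF holomorphic_on_subset[OF inv[of UNIV]]]) (auto simp: i1)
    have d: "(?c \<circ> inv_into ?U ?c) holomorphic_on ?c ` (?U \<inter> ?U)"
    proof (rule holomorphic_transform[OF id])
      show "z = (?c \<circ> inv_into ?U ?c) z" if "z \<in> ?c ` (?U \<inter> ?U)" for z
        using i2[of z] dz[OF that] by simp
    qed
    from that consider "(U, \<phi>) = (Some ` D, the)" "(V, \<psi>) = (Some ` D, the)"
      | "(U, \<phi>) = (?U, ?c)" "(V, \<psi>) = (Some ` D, the)"
      | "(U, \<phi>) = (Some ` D, the)" "(V, \<psi>) = (?U, ?c)"
      | "(U, \<phi>) = (?U, ?c)" "(V, \<psi>) = (?U, ?c)"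
      by blast
    then show ?thesis
      using a b c d by cases (simp_all only: prod.inject)
  qed
  have conn: "connected_space (subtopology sphere_top (Some ` D))"
  proof -
    have "connectedin sphere_top (Some ` D)"
      by (rule connectedin_continuous_map_image[OF continuous_map_Some]) (use D in simp)
    then show ?thesis by (simp add: connectedin_def)
  qed
  have op: "openin (subtopology sphere_top (Some ` D)) (Some ` D)" "openin (subtopology sphere_top (Some ` D)) ?U"
    using opin[OF D(1)] opin[OF D0] by (auto simp: openin_open_subtopology)
  have sf: "topspace (subtopology sphere_top (Some ` D)) = Some ` D"
    by simp
  show ?thesis
    unfolding riemann_surface_def atl surface_top_sphere_domain sf
  proof (intro conjI)
    show "connected_space (subtopology sphere_top (Some ` D))"
      by (rule conn)
    show "Some ` D \<noteq> {}"
      using D by simp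
    show "(\<Union>(U, \<phi>)\<in>{(Some ` D, the), (?U, ?c)}. U) = Some ` D"
      by auto
    show "Hausdorff_space (subtopology sphere_top (Some ` D))"
      by (intro Hausdorff_space_subtopology Hausdorff_sphere_top)
    show "\<forall>(U, \<phi>)\<in>{(Some ` D, the), (?U, ?c)}. openin (subtopology sphere_top (Some ` D)) U \<and> open (\<phi> ` U) \<and>
        homeomorphic_map (subtopology (subtopology sphere_top (Some ` D)) U) (top_of_set (\<phi> ` U)) \<phi>"
      using op 1 2 opinv D by (simp only: cimg) (simp add: image_image)
    show "\<forall>(U, \<phi>)\<in>{(Some ` D, the), (?U, ?c)}. \<forall>(V, \<psi>)\<in>{(Some ` D, the), (?U, ?c)}.
        (\<psi> \<circ> inv_into U \<phi>) holomorphic_on \<phi> ` (U \<inter> V)"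
      using h by blast
  qed
qed

lemma homeomorphic_space_top_of_set:
  "top_of_set S homeomorphic_space top_of_set T \<longleftrightarrow> S homeomorphic T"
proof
  assume "top_of_set S homeomorphic_space top_of_set T"
  then obtain f g where fg: "continuous_on S f" "f ` S \<subseteq> T" "continuous_on T g" "g ` T \<subseteq> S"
    "\<And>x. x \<in> S \<Longrightarrow> g (f x) = x" "\<And>y. y \<in> T \<Longrightarrow> f (g y) = y"
    by (auto simp: homeomorphic_space_def homeomorphic_maps_def image_subset_iff_funcset)
  then show "S homeomorphic T"
    unfolding homeomorphic_minimal by blast
next
  assume "S homeomorphic T"
  then obtain f g where "homeomorphism S T f g"
    by (auto simp: homeomorphic_def)
  then have "homeomorphic_maps (top_of_set S) (top_of_set T) f g"
    by (auto simp: homeomorphism_def homeomorphic_maps_def)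
  then show "top_of_set S homeomorphic_space top_of_set T"
    by (auto simp: homeomorphic_space_def)
qed

text \<open>\<open>Some\<close> is a homeomorphism onto its image, so loops of the surface become
  Jordan curves in the plane, where the Jordan curve theorem applies.\<close>

lemma Loop_sphere_domain:
  "Loop (sphere_domain (Some ` D)) = (`) Some ` {K. K \<subseteq> D \<and> compact K \<and> K homeomorphic sphere (0::complex) 1}"
proof -
  have *: "compactin (subtopology sphere_top (Some ` D)) (Some ` K) \<and>
      subtopology (subtopology sphere_top (Some ` D)) (Some ` K) homeomorphic_space top_of_set (sphere (0::complex) 1)
     \<longleftrightarrow> compact K \<and> K homeomorphic sphere (0::complex) 1" if K: "K \<subseteq> D" for K
  proof -
    have "subtopology (subtopology sphere_top (Some ` D)) (Some ` K) = subtopology sphere_top (Some ` K)"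
      using K by (simp add: subtopology_subtopology Int_absorb1 image_mono)
    moreover have "top_of_set K homeomorphic_space subtopology sphere_top (Some ` K)"
      using homeomorphic_maps_Some[of K] by (auto simp: homeomorphic_space_def)
    ultimately have 1: "subtopology (subtopology sphere_top (Some ` D)) (Some ` K) homeomorphic_space top_of_set (sphere (0::complex) 1)
        \<longleftrightarrow> K homeomorphic sphere (0::complex) 1"
      by (metis homeomorphic_space_sym homeomorphic_space_top_of_set homeomorphic_space_trans)
    have 2: "K homeomorphic sphere (0::complex) 1 \<Longrightarrow> compact K"
      using homeomorphic_compactness compact_sphere by blast
    have "compact K \<Longrightarrow> compactin sphere_top (Some ` K)"
      by (rule image_compactin[OF _ continuous_map_Some]) simp
    then show ?thesis
      using 1 2 K by (auto simp: compactin_subtopology)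
  qed
  show ?thesis
  proof (intro set_eqI iffI)
    fix \<gamma> assume \<gamma>: "\<gamma> \<in> Loop (sphere_domain (Some ` D))"
    then have "\<gamma> \<subseteq> Some ` D"
      by (auto simp: Loop_def compactin_subtopology)
    then obtain K where K: "K \<subseteq> D" "\<gamma> = Some ` K"
      by (metis subset_imageE)
    with \<gamma> *[OF K(1)] show "\<gamma> \<in> (`) Some ` {K. K \<subseteq> D \<and> compact K \<and> K homeomorphic sphere (0::complex) 1}"
      by (auto simp: Loop_def)
  next
    fix \<gamma> assume "\<gamma> \<in> (`) Some ` {K. K \<subseteq> D \<and> compact K \<and> K homeomorphic sphere (0::complex) 1}"
    then obtain K where K: "K \<subseteq> D" "\<gamma> = Some ` K" "compact K" "K homeomorphic sphere (0::complex) 1"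
      by auto
    with *[OF K(1)] show "\<gamma> \<in> Loop (sphere_domain (Some ` D))"
      by (auto simp: Loop_def)
  qed
qed

section \<open>Jordan loops around the origin and their coordinates\<close>

definition jordan_loop :: "complex set \<Rightarrow> bool" where
  "jordan_loop K \<longleftrightarrow> compact K \<and> K homeomorphic sphere (0::complex) 1 \<and> 0 \<in> inside K"

lemma simple_path_of_homeomorphic_circle:
  assumes "K homeomorphic sphere (0::complex) 1"
  obtains c where "simple_path c" "pathfinish c = pathstart c" "path_image c = (K :: complex set)"
proof -
  obtain h k where hk: "homeomorphism (sphere (0::complex) 1) K h k"
    using homeomorphic_sym[THEN iffD1, OF assms] unfolding homeomorphic_def by blast
  let ?c = "h \<circ> circlepath 0 1"
  have "simple_path ?c"
  proof (rule simple_path_continuous_image)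
    have "path_image (circlepath 0 1) = sphere (0::complex) 1"
      by simp
    then show "continuous_on (path_image (circlepath 0 1)) h" "inj_on h (path_image (circlepath 0 1))"
      using hk by (auto simp: homeomorphism_def intro: inj_on_inverseI)
  qed (simp add: simple_path_circlepath)
  moreover have "pathfinish ?c = pathstart ?c"
    by (simp add: pathfinish_compose pathstart_compose)
  moreover have "path_image ?c = K"
    using hk by (simp add: path_image_compose homeomorphism_def)
  ultimately show thesis using that by blast
qed

lemma homeomorphic_circle_inside_outside:
  assumes "K homeomorphic sphere (0::complex) 1"
  shows "open (inside K)" "connected (inside K)" "simply_connected (inside K)" "bounded (inside K)"
    and "frontier (inside K) = (K :: complex set)"
    and "open (outside K)" "connected (outside K)" "\<not> bounded (outside K)"
proof -
  obtain c where c: "simple_path c" "pathfinish c = pathstart c" "path_image c = K"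
    using simple_path_of_homeomorphic_circle[OF assms] .
  from Jordan_inside_outside[OF c(1,2)] show "open (inside K)" "connected (inside K)" "bounded (inside K)"
    "frontier (inside K) = K" "open (outside K)" "connected (outside K)" "\<not> bounded (outside K)"
    by (simp_all add: c(3))
  show "simply_connected (inside K)"
    using simply_connected_inside_simple_path[OF c(1)] by (simp add: c(3))
qed

lemma jordan_loop_facts:
  assumes "jordan_loop K"
  shows "compact K" "K homeomorphic sphere (0::complex) 1" "0 \<in> inside K" "0 \<notin> K"
    and "open (inside K)" "connected (inside K)" "simply_connected (inside K)" "bounded (inside K)"
    and "frontier (inside K) = K" "open (outside K)" "inside K \<inter> K = {}"
proof -
  show K: "compact K" "K homeomorphic sphere (0::complex) 1" "0 \<in> inside K"
    using assms by (auto simp: jordan_loop_def)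
  show "inside K \<inter> K = {}"
    by (rule inside_no_overlap)
  with K(3) show "0 \<notin> K"
    by blast
  from homeomorphic_circle_inside_outside[OF K(2)]
  show "open (inside K)" "connected (inside K)" "simply_connected (inside K)" "bounded (inside K)"
    "frontier (inside K) = K" "open (outside K)"
    by auto
qed

lemma connected_subset_if_frontier_disjoint:
  assumes "connected S" "S \<inter> T \<noteq> {}" "S \<inter> frontier T = {}"
  shows "S \<subseteq> T"
  using connected_Int_frontier[OF assms(1,2)] assms(3) by blast

lemma jordan_loop_connected_subset_inside:
  assumes "jordan_loop K" "connected S" "S \<inter> inside K \<noteq> {}" "S \<inter> K = {}"
  shows "S \<subseteq> inside K"
  using assms jordan_loop_facts(9)[OF assms(1)] by (intro connected_subset_if_frontier_disjoint) auto

text \<open>The component of 0 in the complement of K cannot cross the frontier of D, so it stays in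
  the bounded set D and 0 is inside. Conversely D is connected and misses K, so it stays
  inside.\<close>

lemma jordan_loop_eqI:
  assumes K: "compact K" "K homeomorphic sphere (0::complex) 1"
    and D: "0 \<in> D" "connected D" "bounded D" "D \<inter> K = {}" "frontier D \<subseteq> K"
  shows "jordan_loop K" "inside K = D"
proof -
  have sub: "connected_component_set (- K) 0 \<subseteq> D"
  proof (rule connected_subset_if_frontier_disjoint)
    have "0 \<in> connected_component_set (- K) 0"
      using D(1,4) by (auto intro: connected_component_refl)
    then show "connected_component_set (- K) 0 \<inter> D \<noteq> {}"
      using D(1) by blast
    show "connected_component_set (- K) 0 \<inter> frontier D = {}"
      using D(5) connected_component_subset[of "- K" 0] by auto
  qed simp
  then have 0: "0 \<in> inside K"
    using D bounded_subset[OF D(3)] by (auto simp: inside_def)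
  then show J: "jordan_loop K"
    using K by (simp add: jordan_loop_def)
  have "D \<subseteq> inside K"
    using D 0 by (intro jordan_loop_connected_subset_inside[OF J]) auto
  moreover have "inside K \<subseteq> connected_component_set (- K) 0"
    using 0 jordan_loop_facts(6)[OF J] inside_no_overlap[of K] by (intro connected_component_maximal) blast+
  ultimately show "inside K = D"
    using sub by auto
qed

lemma jordan_loop_scale:
  assumes J: "jordan_loop K" and c: "0 < c"
  shows "jordan_loop ((*) (complex_of_real c) ` K)"
    and "inside ((*) (complex_of_real c) ` K) = (*) (complex_of_real c) ` inside K"
proof -
  let ?m = "(*) (complex_of_real c)"
  note facts = jordan_loop_facts[OF J]
  have inj: "inj ?m" using c by (auto simp: inj_on_def)
  have m: "?m = (*\<^sub>R) c" by (auto simp: scaleR_conv_of_real)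
  have "compact (?m ` K)"
    unfolding m by (intro compact_scaling facts)
  moreover have "?m ` K homeomorphic sphere (0::complex) 1"
  proof -
    have "K homeomorphic ?m ` K"
      unfolding m using c by (intro homeomorphic_scaling) auto
    then show ?thesis
      using facts(2) homeomorphic_sym homeomorphic_trans by blast
  qed
  moreover have "0 \<in> ?m ` inside K"
    using facts(3) by (auto intro!: image_eqI[of _ _ 0])
  moreover have "connected (?m ` inside K)"
    by (intro connected_continuous_image continuous_intros facts)
  moreover have "bounded (?m ` inside K)"
    unfolding m by (intro bounded_scaling facts)
  moreover have "?m ` inside K \<inter> ?m ` K = {}"
    using facts(11) inj by (metis image_Int image_empty)
  moreover have "frontier (?m ` inside K) \<subseteq> ?m ` K"
  proof -
    have "closure (?m ` inside K) = ?m ` closure (inside K)"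
      unfolding m by (rule closure_scaleR[symmetric])
    moreover have "open (?m ` inside K)"
      unfolding m using c by (intro open_scaling facts) auto
    ultimately have "frontier (?m ` inside K) = ?m ` closure (inside K) - ?m ` inside K"
      by (simp add: frontier_def interior_open)
    also have "\<dots> = ?m ` frontier (inside K)"
      using inj facts(5) by (simp add: frontier_def interior_open image_set_diff)
    finally show ?thesis using facts(9) by simp
  qed
  ultimately show "jordan_loop (?m ` K)" "inside (?m ` K) = ?m ` inside K"
    by (rule jordan_loop_eqI)+
qed

text \<open>The point is that inversion exchanges the two sides. If 0 were outside the inverted
  loop, inverting this outside without 0 would give a connected set that misses K, meets the inside
  of K, and hence lies in it; but it contains inverses of points near 0 and is unbounded.\<close>

lemma jordan_loop_inverse:
  assumes J: "jordan_loop K"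
  shows "jordan_loop (inverse ` K)"
proof -
  note facts = jordan_loop_facts[OF J]
  have cont: "continuous_on X inverse" if "0 \<notin> X" for X :: "complex set"
    using that by (intro continuous_intros) auto
  have hom: "homeomorphism K (inverse ` K) inverse inverse"
    using facts(4) by (auto simp: homeomorphism_def image_image intro!: cont)
  have K': "compact (inverse ` K)" "inverse ` K homeomorphic sphere (0::complex) 1"
  proof -
    show "compact (inverse ` K)"
      by (intro compact_continuous_image cont facts)
    show "inverse ` K homeomorphic sphere (0::complex) 1"
    proof -
      have "K homeomorphic inverse ` K"
        unfolding homeomorphic_def using hom by blast
      from homeomorphic_trans[OF homeomorphic_sym[THEN iffD1, OF this] facts(2)]
      show ?thesis .
    qed
  qed
  note facts' = homeomorphic_circle_inside_outside[OF K'(2)]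
  have "0 \<in> inside (inverse ` K)"
  proof (rule ccontr)
    assume "0 \<notin> inside (inverse ` K)"
    moreover have "0 \<notin> inverse ` K"
      using facts(4) by auto
    ultimately have 0: "0 \<in> outside (inverse ` K)"
      using inside_Un_outside[of "inverse ` K"] by blast
    \<comment> \<open>Removing 0 keeps the open connected set connected and makes inversion
      continuous on it.\<close>
    define O' where "O' = outside (inverse ` K) - {0}"
    have "connected O'"
      unfolding O'_def using facts' by (intro connected_open_delete) auto
    then have con: "connected (inverse ` O')"
      by (intro connected_continuous_image cont) (auto simp: O'_def)
    obtain e where e: "0 < e" "ball 0 e \<subseteq> inside K"
      using facts(3,5) open_contains_ball by blast
    \<comment> \<open>The outside contains a point so large that its inverse falls into the disc of
      radius e inside K.\<close>
    have "\<exists>z\<in>outside (inverse ` K). \<not> cmod z \<le> 1 / e"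
      using facts'(8) unfolding bounded_iff by blast
    then obtain z where z: "z \<in> outside (inverse ` K)" "1 / e < cmod z"
      by auto
    have "0 < 1 / e" using e by simp
    then have z0: "z \<noteq> 0" using z(2) by auto
    then have "cmod (inverse z) < e"
      using z e by (simp add: norm_divide norm_inverse field_simps)
    then have "inverse z \<in> inside K \<inter> inverse ` O'"
      using e z z0 by (auto simp: O'_def)
    moreover have "inverse ` O' \<inter> K = {}"
    proof -
      have "inverse x \<notin> K" if "x \<in> O'" for x
      proof
        assume "inverse x \<in> K"
        then have "inverse (inverse x) \<in> inverse ` K"
          by (rule imageI)
        then show False
          using that outside_no_overlap[of "inverse ` K"] by (auto simp: O'_def simp del: outside_no_overlap)
      qed
      then show ?thesis by blast
    qed
    ultimately have sub: "inverse ` O' \<subseteq> inside K"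
      by (intro jordan_loop_connected_subset_inside[OF J con]) auto
    obtain d where d: "0 < d" "ball 0 d \<subseteq> outside (inverse ` K)"
      using 0 facts'(6) open_contains_ball by blast
    obtain R where R: "0 < R" "\<And>z. z \<in> inside K \<Longrightarrow> cmod z \<le> R"
      using facts(8) by (auto simp: bounded_pos)
    \<comment> \<open>The bound d / 2 keeps t in the outside of the inverted loop, and 1 / (2 R)
      makes 1 / t at least 2 R, beyond the bound for the inside of K.\<close>
    define t where "t = min (d / 2) (1 / (2 * R))"
    have t: "0 < t" "t < d" "t \<le> 1 / (2 * R)"
      using d(1) R(1) by (simp_all add: t_def min_less_iff_disj)
    then have "complex_of_real t \<in> O'"
      using d by (auto simp: O'_def)
    then have "inverse (complex_of_real t) \<in> inside K"
      using sub by blast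
    then have "cmod (inverse (complex_of_real t)) \<le> R"
      by (rule R(2))
    then have "1 \<le> R * t"
      using t by (simp add: norm_inverse norm_divide field_simps)
    moreover have "R * t \<le> 1 / 2"
      using t R by (simp add: field_simps)
    ultimately show False by simp
  qed
  with K' show ?thesis by (simp add: jordan_loop_def)
qed

lemma inverse_scale_image:
  "inverse ` (*) (complex_of_real c) ` K = (*) (complex_of_real (1 / c)) ` inverse ` K"
  unfolding image_image by (simp add: inverse_eq_divide)

lemma jordan_loop_normalized_riemann_map:
  assumes "jordan_loop K"
  shows "normalized_riemann_map (inside K) (riemann_map (inside K))"
proof -
  have "inside K \<noteq> UNIV"
    using jordan_loop_facts(8)[OF assms] not_bounded_UNIV by metis
  then show ?thesis
    using normalized_riemann_map_exists[of "inside K"] jordan_loop_facts[OF assms] riemann_map_eq(1) by blast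
qed

lemma Loop1_eq: "Loop1 = (`) Some ` {K. jordan_loop K}"
proof -
  have "surrounds_0 (Some ` K) \<longleftrightarrow> 0 \<in> inside K" for K
    by (simp add: surrounds_0_def inj_vimage_image_eq)
  moreover have "K \<subseteq> UNIV - {0} \<and> compact K \<and> K homeomorphic sphere (0::complex) 1 \<and> 0 \<in> inside K
     \<longleftrightarrow> jordan_loop K" for K
    using jordan_loop_facts(4)[of K] by (auto simp: jordan_loop_def)
  ultimately show ?thesis
    unfolding Loop1_def Loop_sphere_domain by auto
qed

section \<open>The two complementary components of a loop in the sphere\<close>

text \<open>The inside, and the outside together with infinity, are disjoint open sets covering the
  complement of the loop, so a connected set through 0 cannot leave the inside.\<close>

lemma U_plus_Some:
  assumes J: "jordan_loop K"
  shows "U_plus (Some ` K) = Some ` inside K"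
proof
  note facts = jordan_loop_facts[OF J]
  let ?X = "subtopology sphere_top (UNIV - Some ` K)"
  have "connectedin sphere_top (Some ` inside K)"
    by (rule connectedin_continuous_map_image[OF continuous_map_Some]) (use facts in simp)
  then have "connectedin ?X (Some ` inside K)"
    using facts(11) by (auto simp: connectedin_subtopology disjoint_iff simp del: inside_no_overlap)
  then show "Some ` inside K \<subseteq> U_plus (Some ` K)"
    unfolding complement_component_def surface_top_sphere_domain
    using facts(3) by (intro connected_component_of_maximal) auto
  show "U_plus (Some ` K) \<subseteq> Some ` inside K"
  proof
    fix p assume "p \<in> U_plus (Some ` K)"
    then obtain T where T: "connectedin ?X T" "Some 0 \<in> T" "p \<in> T"
      by (auto simp: complement_component_def connected_component_of_def)
    let ?A = "Some ` inside K" and ?B = "insert None (Some ` outside K)"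
    have A: "openin sphere_top ?A"
      using facts(5) by simp
    \<comment> \<open>Openness at infinity holds because the complement of the outside, the loop
      with its inside, is bounded.\<close>
    have B: "openin sphere_top ?B"
    proof -
      have "Some -` ?B = outside K" by auto
      moreover have "- outside K = K \<union> inside K"
        by (rule union_with_inside[symmetric])
      ultimately show ?thesis
        using facts by (simp add: openin_sphere_top compact_imp_bounded)
    qed
    have cover: "T \<subseteq> ?A \<union> ?B"
    proof
      fix q assume "q \<in> T"
      then have q: "q \<notin> Some ` K"
        using T(1) by (auto simp: connectedin_subtopology)
      show "q \<in> ?A \<union> ?B"
      proof (cases q)
        case (Some z)
        with q have "z \<in> inside K \<union> outside K"
          unfolding inside_Un_outside by auto
        then consider "z \<in> inside K" | "z \<in> outside K"
          by blast
        with Some show ?thesis by cases auto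
      qed simp
    qed
    have "z \<notin> outside K" if "z \<in> inside K" for z
      using inside_Int_outside[of K] that by blast
    then have disj: "?A \<inter> ?B \<inter> T = {}"
      by auto
    have AT: "?A \<inter> T \<noteq> {}"
      using T(2) facts(3) by auto
    have "connectedin sphere_top T"
      using T(1) by (simp add: connectedin_subtopology)
    then have "\<not> (\<exists>E1 E2. openin sphere_top E1 \<and> openin sphere_top E2 \<and>
        T \<subseteq> E1 \<union> E2 \<and> E1 \<inter> E2 \<inter> T = {} \<and> E1 \<inter> T \<noteq> {} \<and> E2 \<inter> T \<noteq> {})"
      unfolding connectedin by (rule conjunct2)
    then have "?B \<inter> T = {}"
    proof (rule contrapos_np)
      assume "?B \<inter> T \<noteq> {}"
      then show "\<exists>E1 E2. openin sphere_top E1 \<and> openin sphere_top E2 \<and>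
        T \<subseteq> E1 \<union> E2 \<and> E1 \<inter> E2 \<inter> T = {} \<and> E1 \<inter> T \<noteq> {} \<and> E2 \<inter> T \<noteq> {}"
        by (intro exI[of _ ?A] exI[of _ ?B] conjI A B cover disj AT)
    qed
    then have "p \<notin> ?B"
      using T(3) by (metis IntI empty_iff)
    then show "p \<in> ?A"
      using subsetD[OF cover T(3)] by (metis Un_iff)
  qed
qed

lemma complement_component_sphere_inv:
  "complement_component (sphere_inv ` \<gamma>) (sphere_inv p) = sphere_inv ` complement_component \<gamma> p"
proof -
  have *: "sphere_inv q \<in> complement_component (sphere_inv ` \<gamma>) (sphere_inv p)"
    if "q \<in> complement_component \<gamma> p" for p q \<gamma>
  proof -
    have "continuous_map (subtopology sphere_top (UNIV - \<gamma>)) (subtopology sphere_top (UNIV - sphere_inv ` \<gamma>)) sphere_inv"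
      by (intro continuous_map_into_subtopology continuous_map_from_subtopology continuous_map_sphere_inv)
        (auto simp: image_sphere_inv)
    from connected_component_of_continuous_image[OF this] that show ?thesis
      by (auto simp: complement_component_def)
  qed
  show ?thesis
  proof
    show "sphere_inv ` complement_component \<gamma> p \<subseteq> complement_component (sphere_inv ` \<gamma>) (sphere_inv p)"
      using * by auto
    show "complement_component (sphere_inv ` \<gamma>) (sphere_inv p) \<subseteq> sphere_inv ` complement_component \<gamma> p"
      using *[of _ "sphere_inv ` \<gamma>" "sphere_inv p"] by (auto simp: image_sphere_inv)
  qed
qed

lemma sphere_inv_Some_image: "0 \<notin> K \<Longrightarrow> sphere_inv ` Some ` K = Some ` inverse ` K"
  unfolding image_image by (rule image_cong) (metis sphere_inv_simps(3))+

text \<open>After inversion the component of infinity is the component of 0 for the inverted loop,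
  so the computation of \<open>U_plus\<close> covers it.\<close>

lemma U_minus_Some:
  assumes J: "jordan_loop K"
  shows "sphere_inv ` U_minus (Some ` K) = Some ` inside (inverse ` K)"
proof -
  have "sphere_inv ` U_minus (Some ` K) = U_plus (sphere_inv ` Some ` K)"
    using complement_component_sphere_inv[of "Some ` K" None] by simp
  then show ?thesis
    using U_plus_Some[OF jordan_loop_inverse[OF J]] jordan_loop_facts(4)[OF J]
    by (simp add: sphere_inv_Some_image)
qed

section \<open>The coordinates in terms of normalized Riemann maps\<close>

lemma unit_disc_eq: "{z. cmod z < 1} = ball 0 1"
  by auto

lemma has_fps_expansion_power_series:
  assumes "\<And>z. cmod z < 1 \<Longrightarrow> summable (\<lambda>n. b n * z ^ n)"
  shows "(\<lambda>z. \<Sum>n. b n * z ^ n) has_fps_expansion Abs_fps (b :: nat \<Rightarrow> complex)"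
proof (rule has_fps_expansionI)
  have "eventually (\<lambda>z. z \<in> ball 0 1) (nhds (0::complex))"
    by (intro eventually_nhds_in_open) auto
  then show "eventually (\<lambda>z. (\<lambda>n. Abs_fps b $ n * z ^ n) sums (\<Sum>n. b n * z ^ n)) (nhds 0)"
    by eventually_elim (auto intro!: summable_sums assms)
qed

lemma eventually_unit_ball: "(\<And>z. cmod z < 1 \<Longrightarrow> P z) \<Longrightarrow> eventually P (nhds (0::complex))"
proof -
  assume P: "\<And>z. cmod z < 1 \<Longrightarrow> P z"
  have "eventually (\<lambda>z. z \<in> ball 0 1) (nhds (0::complex))"
    by (intro eventually_nhds_in_open) auto
  then show ?thesis
    by eventually_elim (auto intro: P)
qed

lemma conformal_iso_disc_SomeD:
  assumes "conformal_iso (disc 1) (sphere_domain (Some ` D)) \<phi>"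
  shows "(\<lambda>z. the (\<phi> (Some z))) holomorphic_on ball 0 1" "inj_on (\<lambda>z. the (\<phi> (Some z))) (ball 0 1)"
    and "(\<lambda>z. the (\<phi> (Some z))) ` ball 0 1 = D" "\<And>z. cmod z < 1 \<Longrightarrow> \<exists>w\<in>D. \<phi> (Some z) = Some w"
proof -
  have hol: "holomorphic_map (sphere_domain (Some ` ball 0 1)) (sphere_domain (Some ` D)) \<phi>"
    and bij: "bij_betw \<phi> (Some ` ball 0 1) (Some ` D)"
    using assms by (simp_all add: conformal_iso_def unit_disc_eq)
  show "(\<lambda>z. the (\<phi> (Some z))) holomorphic_on ball 0 1"
    by (rule holomorphic_map_SomeD[OF hol])
  show ex: "\<exists>w\<in>D. \<phi> (Some z) = Some w" if "cmod z < 1" for z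
  proof -
    have "\<phi> (Some z) \<in> \<phi> ` Some ` ball 0 1"
      using that by auto
    then show ?thesis
      using bij by (auto simp: bij_betw_def)
  qed
  show "inj_on (\<lambda>z. the (\<phi> (Some z))) (ball 0 1)"
  proof (rule inj_onI)
    fix z w assume zw: "z \<in> ball 0 1" "w \<in> ball 0 1" "the (\<phi> (Some z)) = the (\<phi> (Some w))"
    then have "\<phi> (Some z) = \<phi> (Some w)"
      using ex[of z] ex[of w] by auto
    then have "Some z = Some w"
      using bij_betw_imp_inj_on[OF bij] zw by (auto dest: inj_onD)
    then show "z = w" by simp
  qed
  have "\<phi> ` Some ` ball 0 1 = Some ` D"
    using bij by (simp add: bij_betw_def)
  then have "the ` \<phi> ` Some ` ball 0 1 = the ` Some ` D"
    by simp
  then show "(\<lambda>z. the (\<phi> (Some z))) ` ball 0 1 = D"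
    by (simp add: image_image)
qed

text \<open>Any admissible \<phi> is a normalized map in disguise, with Taylor coefficients \<rho>
  u_n. Uniqueness of normalized maps then determines u, which justifies the definite description in
  \<open>u_coord\<close>.\<close>

lemma is_phi_plus_unique:
  assumes J: "jordan_loop K" and \<phi>: "is_phi_plus (Some ` K) \<rho> u \<phi>"
  shows "u = coef (inside K)"
proof -
  have iso: "conformal_iso (disc 1) (sphere_domain (Some ` inside K)) \<phi>" and \<rho>: "0 < \<rho>" "u 0 = 1"
    and sm: "\<And>z. cmod z < 1 \<Longrightarrow> summable (\<lambda>n. u n * z ^ n)"
    and eq: "\<And>z. cmod z < 1 \<Longrightarrow> \<phi> (Some z) = Some (of_real \<rho> * (z * (\<Sum>n. u n * z ^ n)))"
    using \<phi> by (auto simp: is_phi_plus_def U_plus_Some[OF J])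
  define f where "f = (\<lambda>z. the (\<phi> (Some z)))"
  note f = conformal_iso_disc_SomeD(1-3)[OF iso, folded f_def]
  have "(\<lambda>z. of_real \<rho> * (z * (\<Sum>n. u n * z ^ n))) has_fps_expansion fps_const (of_real \<rho>) * (fps_X * Abs_fps u)"
    by (intro fps_expansion_intros has_fps_expansion_power_series sm)
  moreover have "eventually (\<lambda>z. of_real \<rho> * (z * (\<Sum>n. u n * z ^ n)) = f z) (nhds 0)"
    by (rule eventually_unit_ball) (simp add: f_def eq)
  from has_fps_expansion_cong[OF this refl]
  have "(\<lambda>z. of_real \<rho> * (z * (\<Sum>n. u n * z ^ n))) has_fps_expansion F \<longleftrightarrow> f has_fps_expansion F" for F .
  ultimately have "f has_fps_expansion fps_const (of_real \<rho>) * (fps_X * Abs_fps u)"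
    by blast
  then have fps: "fps_expansion f 0 = fps_const (of_real \<rho>) * (fps_X * Abs_fps u)"
    by (rule fps_expansion_eqI)
  have c: "fps_expansion f 0 $ Suc n = of_real \<rho> * u n" for n
    by (simp add: fps)
  have "deriv f 0 = of_real \<rho>"
    using c[of 0] \<rho> by (simp add: fps_expansion_def)
  moreover have "f 0 = 0"
    using eq[of 0] by (simp add: f_def)
  ultimately have n: "normalized_riemann_map (inside K) f"
    using f \<rho> by (auto simp: normalized_riemann_map_def)
  have "\<rho> = conformal_radius (inside K)"
    using riemann_map_eq(2)[OF n] \<open>deriv f 0 = of_real \<rho>\<close> by simp
  then have "u n = coef (inside K) n" for n
    using riemann_map_eq(4)[OF n, of n] c[of n] \<rho> by simp
  then show ?thesis ..
qed

lemma is_phi_plus_exists: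
  assumes J: "jordan_loop K"
  shows "is_phi_plus (Some ` K) (conformal_radius (inside K)) (coef (inside K))
           (\<lambda>p. Some (riemann_map (inside K) (the p)))"
proof -
  define f where "f = riemann_map (inside K)"
  define r where "r = conformal_radius (inside K)"
  have n: "normalized_riemann_map (inside K) f"
    unfolding f_def by (rule jordan_loop_normalized_riemann_map[OF J])
  then have f: "f holomorphic_on ball 0 1" "inj_on f (ball 0 1)" "f ` ball 0 1 = inside K" "f 0 = 0"
    by (auto simp: normalized_riemann_map_def)
  have r: "0 < r" unfolding r_def by (rule riemann_map_eq(3)[OF n])
  have "conformal_iso (disc 1) (sphere_domain (Some ` inside K)) (\<lambda>p. Some (f (the p)))"
    unfolding unit_disc_eq by (rule conformal_iso_SomeI) (use f in auto)
  moreover have "summable (\<lambda>n. coef (inside K) n * z ^ n) \<and>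
      f z = of_real r * (z * (\<Sum>n. coef (inside K) n * z ^ n))" if z: "cmod z < 1" for z
  proof (cases "z = 0")
    case True
    then show ?thesis using f by (simp add: summable_0_powser)
  next
    case False
    have "(\<lambda>n. (deriv ^^ n) f 0 / fact n * (z - 0) ^ n) sums f z"
      using z by (intro holomorphic_power_series[OF f(1)]) simp
    \<comment> \<open>The constant term vanishes because f(0) = 0, so the series can start at index
      1, which allows the factor z to be taken out.\<close>
    then have "(\<lambda>n. (deriv ^^ Suc n) f 0 / fact (Suc n) * z ^ Suc n) sums f z"
      by (subst sums_Suc_iff) (simp add: f del: funpow.simps)
    also have "(\<lambda>n. (deriv ^^ Suc n) f 0 / fact (Suc n) * z ^ Suc n) =
        (\<lambda>n. (of_real r * z) * (coef (inside K) n * z ^ n))"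
      using riemann_map_eq(4)[OF n] by (auto simp: fps_expansion_def r_def simp del: funpow.simps)
    finally have s: "(\<lambda>n. (of_real r * z) * (coef (inside K) n * z ^ n)) sums f z" .
    then have sm: "summable (\<lambda>n. coef (inside K) n * z ^ n)"
      using r False sums_summable[OF s] by (simp add: summable_cmult_iff)
    moreover have "f z = (of_real r * z) * (\<Sum>n. coef (inside K) n * z ^ n)"
      using sums_unique2[OF s sums_mult[OF summable_sums[OF sm]]] .
    ultimately show ?thesis by (simp add: mult.assoc)
  qed
  ultimately show ?thesis
    using r f coef_0[OF n] unfolding is_phi_plus_def U_plus_Some[OF J] f_def[symmetric] r_def[symmetric]
    by auto
qed

lemma u_coord_Some: "jordan_loop K \<Longrightarrow> u_coord (Some ` K) = coef (inside K)"
  unfolding u_coord_def using is_phi_plus_exists is_phi_plus_unique by (intro the_equality) blast+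

lemma sphere_inv_exterior_disc:
  "sphere_inv ` insert None (Some ` {z. 1 < cmod z}) = Some ` {z. cmod z < 1}"
proof -
  have "p \<in> sphere_inv ` insert None (Some ` {z. 1 < cmod z}) \<longleftrightarrow> p \<in> Some ` {z. cmod z < 1}" for p
  proof (cases p)
    case (Some z)
    then show ?thesis
    proof (cases "z = 0")
      case False
      then have "1 < cmod (inverse z) \<longleftrightarrow> cmod z < 1"
        by (simp add: norm_inverse one_less_inverse_iff)
      then show ?thesis
        using Some False by (auto simp: image_sphere_inv)
    qed (use Some in \<open>auto simp: image_sphere_inv\<close>)
  qed (auto simp: image_sphere_inv)
  then show ?thesis by blast
qed

text \<open>The map f(z) = 1 / \<phi>(1/z) is a normalized map onto the inside of the inverted loop.
  It satisfies f(z) \<rho> (1 + b_1 z + ...) = z, and comparing coefficients of z gives f'(0) = 1 /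
  \<rho>.\<close>

lemma is_phi_minus_unique:
  assumes J: "jordan_loop K" and \<phi>: "is_phi_minus (Some ` K) \<rho> b \<phi>"
  shows "\<rho> = 1 / conformal_radius (inside (inverse ` K))"
proof -
  have iso: "conformal_iso (sphere_domain (insert None (Some ` {z. 1 < cmod z}))) (sphere_domain (U_minus (Some ` K))) \<phi>"
    and \<rho>: "0 < \<rho>" "b 0 = 1" "\<phi> None = None"
    and sm: "\<And>z. 1 < cmod z \<Longrightarrow> summable (\<lambda>n. b n * inverse z ^ n)"
    and eq: "\<And>z. 1 < cmod z \<Longrightarrow> \<phi> (Some z) = Some (of_real \<rho> * (z * (\<Sum>n. b n * inverse z ^ n)))"
    using \<phi> by (auto simp: is_phi_minus_def)
  define \<psi> where "\<psi> = sphere_inv \<circ> \<phi> \<circ> sphere_inv"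
  have iso': "conformal_iso (disc 1) (sphere_domain (Some ` inside (inverse ` K))) \<psi>"
    using conformal_iso_sphere_inv[OF iso] unfolding sphere_inv_exterior_disc U_minus_Some[OF J] \<psi>_def .
  define f where "f = (\<lambda>z. the (\<psi> (Some z)))"
  note f = conformal_iso_disc_SomeD(1-3)[OF iso', folded f_def]
  have f0: "f 0 = 0"
    by (simp add: f_def \<psi>_def \<rho>)
  have inv1: "1 < cmod (inverse z)" if "cmod z < 1" "z \<noteq> 0" for z
    using that by (simp add: norm_inverse one_less_inverse_iff)
  have fz: "f z * (of_real \<rho> * (\<Sum>n. b n * z ^ n)) = z" if z: "cmod z < 1" for z
  proof (cases "z = 0")
    case True
    then show ?thesis using f0 by simp
  next
    case False
    let ?s = "\<Sum>n. b n * z ^ n"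
    have *: "\<phi> (Some (inverse z)) = Some (of_real \<rho> * (inverse z * ?s))"
      using eq[OF inv1[OF z False]] by simp
    obtain w where "\<psi> (Some z) = Some w"
      using conformal_iso_disc_SomeD(4)[OF iso' z] by auto
    \<comment> \<open>A zero of the series would give \<phi> the value 0, which inversion sends to
      infinity, outside the bounded image of \<psi>.\<close>
    then have s: "?s \<noteq> 0"
      using * False by (auto simp: \<psi>_def)
    then have "f z = inverse (of_real \<rho> * (inverse z * ?s))"
      using * False \<rho> by (simp add: f_def \<psi>_def)
    then show ?thesis using s False \<rho> by (simp add: field_simps)
  qed
  have sm': "summable (\<lambda>n. b n * z ^ n)" if z: "cmod z < 1" for z
    using sm[OF inv1[OF z]] by (cases "z = 0") (auto simp: summable_0_powser)
  have F: "f has_fps_expansion fps_expansion f 0"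
    using f(1) by (intro has_fps_expansion_fps_expansion[of "ball 0 1"]) auto
  have "(\<lambda>z. f z * (of_real \<rho> * (\<Sum>n. b n * z ^ n))) has_fps_expansion
      fps_expansion f 0 * (fps_const (of_real \<rho>) * Abs_fps b)"
    by (intro fps_expansion_intros has_fps_expansion_power_series sm' F)
  moreover have "eventually (\<lambda>z. f z * (of_real \<rho> * (\<Sum>n. b n * z ^ n)) = z) (nhds 0)"
    by (rule eventually_unit_ball) (rule fz)
  from has_fps_expansion_cong[OF this refl]
  have "(\<lambda>z. f z * (of_real \<rho> * (\<Sum>n. b n * z ^ n))) has_fps_expansion G \<longleftrightarrow> (\<lambda>z. z) has_fps_expansion G" for G .
  ultimately have "(\<lambda>z. z) has_fps_expansion fps_expansion f 0 * (fps_const (of_real \<rho>) * Abs_fps b)"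
    by blast
  then have "fps_expansion f 0 * (fps_const (of_real \<rho>) * Abs_fps b) = fps_X"
    using fps_expansion_unique_complex has_fps_expansion_fps_X by blast
  from arg_cong[OF this, of "\<lambda>G. fps_nth G 1"]
  have "deriv f 0 * of_real \<rho> = 1"
    using f0 \<rho> by (simp add: fps_mult_nth fps_expansion_def)
  then have d: "deriv f 0 = of_real (1 / \<rho>)"
    using \<rho> by (simp add: field_simps)
  then have n: "normalized_riemann_map (inside (inverse ` K)) f"
    using f f0 \<rho> unfolding normalized_riemann_map_def by (auto intro!: exI[of _ "1 / \<rho>"])
  have "1 / \<rho> = conformal_radius (inside (inverse ` K))"
    using riemann_map_eq(2)[OF n] d by (metis of_real_eq_iff)
  then show ?thesis by (metis div_by_1 divide_divide_eq_right mult_1)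
qed

text \<open>Write f(z) = z k(z) for the normalized map of the inverted loop; k has no zeros because
  f is injective. The exterior map is 1 / f(1/z) = z / k(1/z), so b consists of the Taylor
  coefficients of r / k.\<close>

lemma is_phi_minus_exists:
  assumes J: "jordan_loop K"
  shows "\<exists>b \<phi>. is_phi_minus (Some ` K) (1 / conformal_radius (inside (inverse ` K))) b \<phi>"
proof -
  define f where "f = riemann_map (inside (inverse ` K))"
  define r where "r = conformal_radius (inside (inverse ` K))"
  have n: "normalized_riemann_map (inside (inverse ` K)) f"
    unfolding f_def by (rule jordan_loop_normalized_riemann_map[OF jordan_loop_inverse[OF J]])
  then have f: "f holomorphic_on ball 0 1" "inj_on f (ball 0 1)" "f ` ball 0 1 = inside (inverse ` K)" "f 0 = 0"
    by (auto simp: normalized_riemann_map_def)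
  have r: "0 < r" "deriv f 0 = of_real r" unfolding r_def using riemann_map_eq(2,3)[OF n] by auto
  obtain k where k: "k holomorphic_on ball 0 1" "\<And>z. cmod z < 1 \<Longrightarrow> f z = z * k z" "deriv f 0 = k 0"
    using Schwarz3[OF f(1,4)] by metis
  have k0: "k z \<noteq> 0" if z: "cmod z < 1" for z
  proof (cases "z = 0")
    case False
    then have "f z \<noteq> f 0"
      using inj_onD[OF f(2), of z 0] z by auto
    then show ?thesis using k(2)[OF z] f(4) by auto
  next
    case True
    have "k 0 \<noteq> 0"
      using r by (simp add: k(3)[symmetric])
    then show ?thesis using True by simp
  qed
  \<comment> \<open>The factor r = k(0) normalizes the constant coefficient to 1.\<close>
  define B where "B = (\<lambda>w. of_real r / k w)"
  have B: "B holomorphic_on ball 0 1"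
    unfolding B_def using k0 by (intro holomorphic_intros k) auto
  define b where "b n = (deriv ^^ n) B 0 / fact n" for n
  have sums: "(\<lambda>n. b n * w ^ n) sums B w" if "cmod w < 1" for w
    using holomorphic_power_series[OF B, of w] that by (simp add: b_def)
  define \<phi> where "\<phi> = sphere_inv \<circ> (\<lambda>p. Some (f (the p))) \<circ> sphere_inv"
  have "conformal_iso (sphere_domain (Some ` {z. cmod z < 1})) (sphere_domain (Some ` inside (inverse ` K))) (\<lambda>p. Some (f (the p)))"
    unfolding unit_disc_eq by (rule conformal_iso_SomeI) (use f in auto)
  from conformal_iso_sphere_inv[OF this]
  have iso: "conformal_iso (sphere_domain (insert None (Some ` {z. 1 < cmod z}))) (sphere_domain (U_minus (Some ` K))) \<phi>"
    unfolding sphere_inv_exterior_disc[symmetric] U_minus_Some[OF J, symmetric] \<phi>_def sphere_inv_sphere_inv_image .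
  have "\<phi> None = None"
    by (simp add: \<phi>_def f)
  moreover have "b 0 = 1"
    using r k0[of 0] by (simp add: b_def B_def k(3)[symmetric])
  moreover have "summable (\<lambda>n. b n * inverse z ^ n) \<and>
      \<phi> (Some z) = Some (of_real (1 / r) * (z * (\<Sum>n. b n * inverse z ^ n)))" if z: "1 < cmod z" for z
  proof
    have z0: "z \<noteq> 0" using z by auto
    have iz: "cmod (inverse z) < 1"
      using z z0 by (simp add: norm_inverse inverse_less_1_iff)
    show "summable (\<lambda>n. b n * inverse z ^ n)"
      using sums[OF iz] by (rule sums_summable)
    have "(\<Sum>n. b n * inverse z ^ n) = of_real r / k (inverse z)"
      using sums_unique[OF sums[OF iz]] by (simp add: B_def)
    moreover have "f (inverse z) = inverse z * k (inverse z)"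
      by (rule k(2)[OF iz])
    ultimately show "\<phi> (Some z) = Some (of_real (1 / r) * (z * (\<Sum>n. b n * inverse z ^ n)))"
      using z0 k0[OF iz] r by (simp add: \<phi>_def divide_inverse)
  qed
  ultimately have "is_phi_minus (Some ` K) (1 / r) b \<phi>"
    using iso r unfolding is_phi_minus_def by auto
  then show ?thesis unfolding r_def by blast
qed

lemma rho_infinity_Some:
  "jordan_loop K \<Longrightarrow> rho_infinity (Some ` K) = 1 / conformal_radius (inside (inverse ` K))"
  unfolding rho_infinity_def using is_phi_minus_exists is_phi_minus_unique by (intro the_equality) blast+

section \<open>Action of dilations on the coordinates\<close>

definition scale :: "real \<Rightarrow> complex option \<Rightarrow> complex option" where
  "scale c = map_option ((*) (complex_of_real c))"

lemma scale_Some_image: "scale c ` Some ` K = Some ` (*) (complex_of_real c) ` K"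
  by (simp add: scale_def image_image)

lemma Loop1E:
  assumes "\<gamma> \<in> Loop1"
  obtains K where "\<gamma> = Some ` K" "jordan_loop K"
  using assms by (auto simp: Loop1_eq)

lemma rho_infinity_pos:
  assumes "\<gamma> \<in> Loop1"
  shows "0 < rho_infinity \<gamma>"
proof -
  obtain K where K: "\<gamma> = Some ` K" "jordan_loop K"
    using assms by (rule Loop1E)
  then show ?thesis
    using riemann_map_eq(3)[OF jordan_loop_normalized_riemann_map[OF jordan_loop_inverse[OF K(2)]]]
    by (simp add: rho_infinity_Some)
qed

text \<open>For \<open>rho_infinity\<close>, dilation by c turns into dilation by 1 / c after
  inversion, and the reciprocal of the conformal radius restores the factor c.\<close>

lemma Loop1_scale:
  assumes "\<gamma> \<in> Loop1" "0 < c"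
  shows "scale c ` \<gamma> \<in> Loop1" "u_coord (scale c ` \<gamma>) = u_coord \<gamma>"
    and "rho_infinity (scale c ` \<gamma>) = c * rho_infinity \<gamma>"
proof -
  obtain K where K: "\<gamma> = Some ` K" "jordan_loop K"
    using assms(1) by (rule Loop1E)
  note sc = jordan_loop_scale[OF K(2) assms(2)]
  show "scale c ` \<gamma> \<in> Loop1"
    using sc by (auto simp: K scale_Some_image Loop1_eq)
  show "u_coord (scale c ` \<gamma>) = u_coord \<gamma>"
    using normalized_riemann_map_scale(3)[OF jordan_loop_normalized_riemann_map[OF K(2)] assms(2)]
    by (simp add: K scale_Some_image u_coord_Some sc)
  have J: "jordan_loop (inverse ` K)"
    by (rule jordan_loop_inverse[OF K(2)])
  have "inside (inverse ` (*) (complex_of_real c) ` K) = (*) (complex_of_real (1 / c)) ` inside (inverse ` K)"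
    unfolding inverse_scale_image using assms(2) by (intro jordan_loop_scale(2)[OF J]) auto
  then have "rho_infinity (scale c ` \<gamma>) = 1 / (1 / c * conformal_radius (inside (inverse ` K)))"
    using normalized_riemann_map_scale(2)[OF jordan_loop_normalized_riemann_map[OF J], of "1 / c"] assms(2) sc
    by (simp only: K scale_Some_image rho_infinity_Some) simp
  then show "rho_infinity (scale c ` \<gamma>) = c * rho_infinity \<gamma>"
    using K by (simp add: rho_infinity_Some)
qed

text \<open>Equal u makes the insides dilates of each other, and a loop is the frontier of its
  inside, so the loops are dilates too; equal \<open>rho_infinity\<close> then forces the factor 1.
  Dilating a loop reaches every positive second coordinate without changing u.\<close>

lemma bij_betw_loop_coords: "bij_betw loop_coords Loop1 (u_set \<times> {0<..})"
  unfolding bij_betw_def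
proof
  show "inj_on loop_coords Loop1"
  proof (rule inj_onI)
    fix \<gamma>1 \<gamma>2 assume \<gamma>: "\<gamma>1 \<in> Loop1" "\<gamma>2 \<in> Loop1" "loop_coords \<gamma>1 = loop_coords \<gamma>2"
    obtain K1 K2 where K: "\<gamma>1 = Some ` K1" "jordan_loop K1" "\<gamma>2 = Some ` K2" "jordan_loop K2"
      using \<gamma> by (metis Loop1E)
    have eq: "coef (inside K1) = coef (inside K2)" "rho_infinity \<gamma>1 = rho_infinity \<gamma>2"
      using \<gamma>(3) by (auto simp: loop_coords_def K u_coord_Some)
    note n = jordan_loop_normalized_riemann_map[OF K(2)] jordan_loop_normalized_riemann_map[OF K(4)]
    define c where "c = conformal_radius (inside K2) / conformal_radius (inside K1)"
    have c: "0 < c"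
      using riemann_map_eq(3)[OF n(1)] riemann_map_eq(3)[OF n(2)] by (simp add: c_def)
    have "inside K2 = (*) (complex_of_real c) ` inside K1"
      unfolding c_def by (rule normalized_riemann_map_eq_scale[OF n eq(1)])
    then have "inside K2 = inside ((*) (complex_of_real c) ` K1)"
      by (simp add: jordan_loop_scale[OF K(2) c])
    then have "K2 = (*) (complex_of_real c) ` K1"
      using jordan_loop_facts(9)[OF K(4)] jordan_loop_facts(9)[OF jordan_loop_scale(1)[OF K(2) c]] by metis
    then have sc: "\<gamma>2 = scale c ` \<gamma>1"
      by (simp add: K scale_Some_image)
    then have "c * rho_infinity \<gamma>1 = rho_infinity \<gamma>1"
      using Loop1_scale(3)[OF \<gamma>(1) c] eq by simp
    then have "c = 1"
      using rho_infinity_pos[OF \<gamma>(1)] by simp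
    then show "\<gamma>1 = \<gamma>2"
      by (simp add: sc K scale_Some_image)
  qed
  show "loop_coords ` Loop1 = u_set \<times> {0<..}"
  proof
    show "loop_coords ` Loop1 \<subseteq> u_set \<times> {0<..}"
      using rho_infinity_pos by (auto simp: loop_coords_def u_set_def)
    show "u_set \<times> {0<..} \<subseteq> loop_coords ` Loop1"
    proof (rule subrelI)
      fix u and r :: real assume "(u, r) \<in> u_set \<times> {0<..}"
      then obtain \<gamma> where \<gamma>: "\<gamma> \<in> Loop1" "u = u_coord \<gamma>" and r: "0 < r"
        by (auto simp: u_set_def)
      have c: "0 < r / rho_infinity \<gamma>"
        using r rho_infinity_pos[OF \<gamma>(1)] by simp
      have "loop_coords (scale (r / rho_infinity \<gamma>) ` \<gamma>) = (u, r)"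
        using Loop1_scale[OF \<gamma>(1) c] rho_infinity_pos[OF \<gamma>(1)] \<gamma>(2) by (simp add: loop_coords_def)
      then show "(u, r) \<in> loop_coords ` Loop1"
        using Loop1_scale(1)[OF \<gamma>(1) c] by (metis imageI)
    qed
  qed
qed

section \<open>Measurability of the coordinates\<close>

lemma topspace_vietoris: "topspace (vietoris S) = Loop S"
proof -
  have "\<gamma> \<subseteq> topspace (surface_top S)" if "\<gamma> \<in> Loop S" for \<gamma>
    using that by (auto simp: Loop_def dest: compactin_subset_topspace)
  moreover have "openin (surface_top S) (topspace (surface_top S))"
    by simp
  ultimately show ?thesis
    unfolding vietoris_def topology_generated_by_topspace by blast
qed

lemma space_loop_borel [simp]: "space (loop_borel S) = Loop S"
  and sets_loop_borel: "openin (vietoris S) W \<Longrightarrow> W \<in> sets (loop_borel S)"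
proof -
  have *: "{W. openin (vietoris S) W} \<subseteq> Pow (Loop S)"
    using openin_subset topspace_vietoris by blast
  then show "space (loop_borel S) = Loop S"
    by (simp add: loop_borel_def space_measure_of)
  show "openin (vietoris S) W \<Longrightarrow> W \<in> sets (loop_borel S)"
    unfolding loop_borel_def sets_measure_of[OF *] by (rule sigma_sets.Basic) simp
qed

lemma openin_punctured_plane:
  "openin (surface_top punctured_plane) U \<longleftrightarrow> (\<exists>V. open V \<and> 0 \<notin> V \<and> U = Some ` V)"
proof -
  have "openin sphere_top (Some ` (UNIV - {0}))"
    by (simp add: open_Diff)
  then have "openin (surface_top punctured_plane) U \<longleftrightarrow> openin sphere_top U \<and> U \<subseteq> Some ` (UNIV - {0})"
    by (simp add: openin_open_subtopology)
  also have "\<dots> \<longleftrightarrow> (\<exists>V. open V \<and> 0 \<notin> V \<and> U = Some ` V)"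
    by (auto simp: subset_image_iff)
  finally show ?thesis .
qed

lemma Loop_punctured_plane_subset: "\<gamma> \<in> Loop punctured_plane \<Longrightarrow> \<gamma> \<subseteq> Some ` (UNIV - {0})"
  unfolding Loop_sphere_domain by auto

text \<open>The set is Vietoris open as a union of basic open sets. The family may be uncountable,
  and so may be indexed by all Riemann maps of all domains.\<close>

lemma upper_sets:
  assumes "\<And>D. D \<in> \<D> \<Longrightarrow> open D"
  shows "{\<gamma> \<in> Loop punctured_plane. \<exists>D\<in>\<D>. \<gamma> \<subseteq> Some ` D} \<in> sets (loop_borel punctured_plane)"
proof (rule sets_loop_borel)
  have op: "openin (vietoris punctured_plane) {\<gamma> \<in> Loop punctured_plane. \<gamma> \<subseteq> Some ` D}" if D: "D \<in> \<D>" for D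
  proof -
    have "openin (surface_top punctured_plane) (Some ` (D - {0}))"
      unfolding openin_punctured_plane using assms[OF D] by (intro exI[of _ "D - {0}"]) auto
    then have "openin (vietoris punctured_plane) {\<gamma> \<in> Loop punctured_plane. \<gamma> \<subseteq> Some ` (D - {0})}"
      unfolding vietoris_def by (intro topology_generated_by_Basis) blast
    also have "{\<gamma> \<in> Loop punctured_plane. \<gamma> \<subseteq> Some ` (D - {0})} = {\<gamma> \<in> Loop punctured_plane. \<gamma> \<subseteq> Some ` D}"
      using Loop_punctured_plane_subset by blast
    finally show ?thesis .
  qed
  have "{\<gamma> \<in> Loop punctured_plane. \<exists>D\<in>\<D>. \<gamma> \<subseteq> Some ` D} = (\<Union>D\<in>\<D>. {\<gamma> \<in> Loop punctured_plane. \<gamma> \<subseteq> Some ` D})"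
    by blast
  then show "openin (vietoris punctured_plane) {\<gamma> \<in> Loop punctured_plane. \<exists>D\<in>\<D>. \<gamma> \<subseteq> Some ` D}"
    using op by auto
qed

lemma Loop1_subset: "Loop1 \<subseteq> Loop punctured_plane"
  by (auto simp: Loop1_def)

text \<open>The trace of the Borel sets on \<open>Loop1\<close> is taken because the set
  \<open>Loop1\<close> itself becomes measurable only through the measure.\<close>

definition loop1_borel :: "complex option set measure" where
  "loop1_borel = restrict_space (loop_borel punctured_plane) Loop1"

lemma space_loop1_borel [simp]: "space loop1_borel = Loop1"
  using Loop1_subset by (auto simp: loop1_borel_def space_restrict_space)

lemma upper_sets_Loop1:
  assumes "\<And>D. D \<in> \<D> \<Longrightarrow> open D"
  shows "{\<gamma> \<in> Loop1. \<exists>D\<in>\<D>. \<gamma> \<subseteq> Some ` D} \<in> sets loop1_borel"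
proof -
  have "{\<gamma> \<in> Loop1. \<exists>D\<in>\<D>. \<gamma> \<subseteq> Some ` D} = Loop1 \<inter> {\<gamma> \<in> Loop punctured_plane. \<exists>D\<in>\<D>. \<gamma> \<subseteq> Some ` D}"
    using Loop1_subset by blast
  then show ?thesis
    unfolding loop1_borel_def sets_restrict_space using upper_sets[OF assms] by blast
qed

lemma sets_loop1_borelI:
  assumes "\<And>D. D \<in> \<D> \<Longrightarrow> open D"
    and "\<And>K. jordan_loop K \<Longrightarrow> P (Some ` K) \<longleftrightarrow> (\<exists>D\<in>\<D>. K \<subseteq> D)"
  shows "{\<gamma> \<in> Loop1. P \<gamma>} \<in> sets loop1_borel"
proof -
  have "{\<gamma> \<in> Loop1. P \<gamma>} = {\<gamma> \<in> Loop1. \<exists>D\<in>\<D>. \<gamma> \<subseteq> Some ` D}"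
    unfolding Loop1_eq using assms(2) by (auto simp: inj_image_subset_iff)
  then show ?thesis
    using upper_sets_Loop1[OF assms(1)] by simp
qed

section \<open>Semicontinuity and measurability of the coordinates\<close>

text \<open>The image of the closed disc is connected, contains 0 and misses K. The map f belongs to
  an arbitrary domain, so loops can be tested against compact sets chosen in advance.\<close>

lemma image_cball_subset_inside:
  assumes J: "jordan_loop K" and f: "normalized_riemann_map D f" and s: "0 < s" "s < 1"
    and K: "K \<subseteq> - f ` cball 0 s"
  shows "f ` cball 0 s \<subseteq> inside K"
proof (rule jordan_loop_connected_subset_inside[OF J])
  have hol: "f holomorphic_on ball 0 1" "f 0 = 0"
    using f by (auto simp: normalized_riemann_map_def)
  have "continuous_on (cball 0 s) f"
    by (rule holomorphic_on_imp_continuous_on[OF holomorphic_on_subset[OF hol(1)]]) (use s in auto)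
  then show "connected (f ` cball 0 s)"
    by (rule connected_continuous_image) simp
  have "0 \<in> f ` cball 0 s"
    using hol s by (auto intro!: image_eqI[of _ _ 0])
  then show "f ` cball 0 s \<inter> inside K \<noteq> {}"
    using jordan_loop_facts(3)[OF J] by blast
  show "f ` cball 0 s \<inter> K = {}"
    using K by blast
qed

lemma open_compl_image_cball:
  assumes f: "normalized_riemann_map D f" and s: "s < 1"
  shows "open (- f ` cball 0 s)"
proof -
  have "continuous_on (cball 0 s) f"
    using f s by (intro holomorphic_on_imp_continuous_on)
      (auto simp: normalized_riemann_map_def elim!: holomorphic_on_subset)
  then have "compact (f ` cball 0 s)"
    by (rule compact_continuous_image) simp
  then show ?thesis
    by (simp add: compact_imp_closed open_Compl)
qed

lemma loop_subset_compl_image_cball: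
  assumes J: "jordan_loop K" and f: "normalized_riemann_map (inside K) f" and s: "s < 1"
  shows "K \<subseteq> - f ` cball 0 s"
proof -
  have "f ` cball 0 s \<subseteq> inside K"
  proof -
    have "f ` cball 0 s \<subseteq> f ` ball 0 1"
      by (intro image_mono) (use s in auto)
    also have "\<dots> = inside K"
      using f by (simp add: normalized_riemann_map_def)
    finally show ?thesis .
  qed
  then show ?thesis
    using inside_no_overlap[of K] by blast
qed

text \<open>A loop around 0 contained in such a complement surrounds the removed compact image,
  whose size certifies a conformal radius above r. The family is independent of the loop.\<close>

definition radius_witnesses :: "real \<Rightarrow> complex set set" where
  "radius_witnesses r = {- f ` cball 0 s |f s D. normalized_riemann_map D f \<and> 0 < s \<and> s < 1 \<and>
     r < s * conformal_radius D}"

lemma open_radius_witnesses: "D \<in> radius_witnesses r \<Longrightarrow> open D"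
  unfolding radius_witnesses_def using open_compl_image_cball by blast

text \<open>A slightly shrunken image of the disc survives all small perturbations of the loop; hence the
  conformal radius is lower semicontinuous.\<close>

lemma conformal_radius_greater_iff:
  assumes J: "jordan_loop K"
  shows "r < conformal_radius (inside K) \<longleftrightarrow> (\<exists>D\<in>radius_witnesses r. K \<subseteq> D)"
proof
  note n = jordan_loop_normalized_riemann_map[OF J]
  note pos = riemann_map_eq(3)[OF n]
  assume r: "r < conformal_radius (inside K)"
  \<comment> \<open>The midpoint s of t and 1 lies strictly between the required ratio and 1; the
    maximum with 0 keeps s positive when r is negative.\<close>
  define t where "t = max (r / conformal_radius (inside K)) 0"
  define s where "s = (t + 1) / 2"
  have t: "0 \<le> t" "t < 1" "r / conformal_radius (inside K) \<le> t"
    using r pos by (auto simp: t_def)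
  then have s: "0 < s" "s < 1" "t < s"
    unfolding s_def by auto
  with t(3) have "r / conformal_radius (inside K) < s"
    by linarith
  then have "r < s * conformal_radius (inside K)"
    using pos by (simp add: field_simps)
  then have "- riemann_map (inside K) ` cball 0 s \<in> radius_witnesses r"
    unfolding radius_witnesses_def using n s by blast
  then show "\<exists>D\<in>radius_witnesses r. K \<subseteq> D"
    using loop_subset_compl_image_cball[OF J n s(2)] by blast
next
  assume "\<exists>D\<in>radius_witnesses r. K \<subseteq> D"
  then obtain f s D where f: "normalized_riemann_map D f" "0 < s" "s < 1" "r < s * conformal_radius D"
    "K \<subseteq> - f ` cball 0 s"
    unfolding radius_witnesses_def by blast
  have "f ` cball 0 s \<subseteq> inside K"
    by (rule image_cball_subset_inside[OF J f(1,2,3,5)])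
  from conformal_radius_lower_bound[OF f(1) jordan_loop_normalized_riemann_map[OF J] f(2,3) this]
  show "r < conformal_radius (inside K)"
    using f(4) by simp
qed

lemma vimage_Some_image [simp]: "Some -` Some ` K = K"
  by auto

lemma conformal_radius_measurable:
  "(\<lambda>\<gamma>. conformal_radius (inside (Some -` \<gamma>))) \<in> borel_measurable loop1_borel"
proof (rule borel_measurableI_greater)
  fix r
  have "{\<gamma> \<in> Loop1. r < conformal_radius (inside (Some -` \<gamma>))} \<in> sets loop1_borel"
    by (rule sets_loop1_borelI[OF open_radius_witnesses]) (simp_all add: conformal_radius_greater_iff)
  then show "{\<gamma> \<in> space loop1_borel. r < conformal_radius (inside (Some -` \<gamma>))} \<in> sets loop1_borel"
    by simp
qed

text \<open>Being the reciprocal of a lower semicontinuous radius, \<open>rho_infinity\<close> is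
  upper semicontinuous, so sublevel sets are the ones to test; witnesses for the inverted loop are
  pulled back by the inversion.\<close>

lemma rho_infinity_measurable: "rho_infinity \<in> loop1_borel \<rightarrow>\<^sub>M rho_borel"
  unfolding rho_borel_def
proof (rule measurable_restrict_space2)
  show "rho_infinity \<in> space loop1_borel \<rightarrow> {0<..}"
    using rho_infinity_pos by auto
  show "rho_infinity \<in> borel_measurable loop1_borel"
  proof (rule borel_measurableI_less)
    fix r :: real
    show "{\<gamma> \<in> space loop1_borel. rho_infinity \<gamma> < r} \<in> sets loop1_borel"
    proof (cases "0 < r")
      case False
      then have eq: "{\<gamma> \<in> space loop1_borel. rho_infinity \<gamma> < r} = {}"
        using rho_infinity_pos by force
      show ?thesis
        unfolding eq by simp
    next
      case True
      \<comment> \<open>The point 0 is removed because \<open>inverse\<close> takes the default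
        value 0 there and is continuous only elsewhere.\<close>
      let ?\<D> = "(\<lambda>D. - {0} \<inter> inverse -` D) ` radius_witnesses (1 / r)"
      have "{\<gamma> \<in> Loop1. rho_infinity \<gamma> < r} \<in> sets loop1_borel"
      proof (rule sets_loop1_borelI[of ?\<D>])
        fix D assume "D \<in> ?\<D>"
        then obtain D0 where D0: "D0 \<in> radius_witnesses (1 / r)" "D = - {0} \<inter> inverse -` D0"
          by blast
        have "continuous_on (- {0::complex}) inverse"
          by (intro continuous_intros) auto
        then show "open D"
          unfolding D0(2) by (rule continuous_open_preimage) (auto simp: open_radius_witnesses[OF D0(1)])
      next
        fix K assume J: "jordan_loop K"
        note J' = jordan_loop_inverse[OF J]
        have "0 < conformal_radius (inside (inverse ` K))"
          by (rule riemann_map_eq(3)[OF jordan_loop_normalized_riemann_map[OF J']])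
        then have "rho_infinity (Some ` K) < r \<longleftrightarrow> 1 / r < conformal_radius (inside (inverse ` K))"
          using True by (simp add: rho_infinity_Some[OF J] field_simps)
        also have "\<dots> \<longleftrightarrow> (\<exists>D\<in>radius_witnesses (1 / r). inverse ` K \<subseteq> D)"
          by (rule conformal_radius_greater_iff[OF J'])
        also have "\<dots> \<longleftrightarrow> (\<exists>D\<in>?\<D>. K \<subseteq> D)"
          using jordan_loop_facts(4)[OF J] by auto
        finally show "rho_infinity (Some ` K) < r \<longleftrightarrow> (\<exists>D\<in>?\<D>. K \<subseteq> D)" .
      qed
      then show ?thesis by simp
    qed
  qed
qed

text \<open>Quantifying over all domains \<open>D'\<close> makes two facts sufficient to place the
  coefficient in U: the loop avoids the compact image, and its conformal radius is below q.\<close>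

definition coef_witnesses :: "nat \<Rightarrow> complex set \<Rightarrow> real \<Rightarrow> complex set set" where
  "coef_witnesses n U q = {- f ` cball 0 s |f s D. normalized_riemann_map D f \<and> 0 < s \<and> s < 1 \<and>
     (\<forall>D' g. normalized_riemann_map D' g \<longrightarrow> f ` cball 0 s \<subseteq> D' \<longrightarrow> conformal_radius D' < q \<longrightarrow> coef D' n \<in> U)}"

text \<open>The coefficients are continuous once the topology is refined by the sets
  \<open>{\<gamma>. conformal_radius (inside \<gamma>) < q}\<close>; since rational \<open>q\<close> suffice, this yields measurability.\<close>

lemma coef_in_open_iff:
  assumes J: "jordan_loop K" and U: "open U"
  shows "coef (inside K) n \<in> U \<longleftrightarrow>
    (\<exists>q\<in>\<rat>. conformal_radius (inside K) < q \<and> (\<exists>D\<in>coef_witnesses n U q. K \<subseteq> D))"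
proof
  note nrm = jordan_loop_normalized_riemann_map[OF J]
  assume "coef (inside K) n \<in> U"
  from coef_near[OF nrm U this] obtain s q0 where s: "0 < s" "s < 1" and q0: "conformal_radius (inside K) < q0"
    and *: "\<And>D' g. normalized_riemann_map D' g \<Longrightarrow> riemann_map (inside K) ` cball 0 s \<subseteq> D' \<Longrightarrow>
      conformal_radius D' < q0 \<Longrightarrow> coef D' n \<in> U"
    by blast
  obtain q where q: "q \<in> \<rat>" "conformal_radius (inside K) < q" "q < q0"
    using Rats_dense_in_real[OF q0] by blast
  have "- riemann_map (inside K) ` cball 0 s \<in> coef_witnesses n U q"
    unfolding coef_witnesses_def mem_Collect_eq
  proof (intro exI conjI allI impI)
    show "normalized_riemann_map (inside K) (riemann_map (inside K))" "0 < s" "s < 1"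
      by (fact nrm s)+
    show "coef D' n \<in> U" if "normalized_riemann_map D' g" "riemann_map (inside K) ` cball 0 s \<subseteq> D'"
      "conformal_radius D' < q" for D' g
      using that(3) q(3) by (intro *[OF that(1,2)]) simp
  qed simp
  then show "\<exists>q\<in>\<rat>. conformal_radius (inside K) < q \<and> (\<exists>D\<in>coef_witnesses n U q. K \<subseteq> D)"
    using q loop_subset_compl_image_cball[OF J nrm s(2)] by blast
next
  assume "\<exists>q\<in>\<rat>. conformal_radius (inside K) < q \<and> (\<exists>D\<in>coef_witnesses n U q. K \<subseteq> D)"
  then obtain q f s D where q: "conformal_radius (inside K) < q" and f: "normalized_riemann_map D f" "0 < s" "s < 1"
    "K \<subseteq> - f ` cball 0 s"
    and *: "\<And>D' g. normalized_riemann_map D' g \<Longrightarrow> f ` cball 0 s \<subseteq> D' \<Longrightarrow> conformal_radius D' < q \<Longrightarrow> coef D' n \<in> U"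
    unfolding coef_witnesses_def by blast
  show "coef (inside K) n \<in> U"
    by (rule *[OF jordan_loop_normalized_riemann_map[OF J] image_cball_subset_inside[OF J f] q])
qed

text \<open>The Borel sets of a countable product are generated by the coordinates. For each
  coefficient, the preimage of an open set is a countable union over rational q of an open set of
  loops cut down by a sublevel set of the conformal radius.\<close>

lemma u_coord_measurable: "u_coord \<in> loop1_borel \<rightarrow>\<^sub>M u_borel"
  unfolding u_borel_def
proof (rule measurable_restrict_space2)
  show "u_coord \<in> space loop1_borel \<rightarrow> u_set"
    by (auto simp: u_set_def)
  show "u_coord \<in> borel_measurable loop1_borel"
  proof (rule measurable_coordinatewise_then_product, rule borel_measurableI)
    fix n and U :: "complex set" assume U: "open U"
    let ?W = "\<lambda>q. {\<gamma> \<in> Loop1. \<exists>D\<in>coef_witnesses n U q. \<gamma> \<subseteq> Some ` D}"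
    let ?R = "\<lambda>q. {\<gamma> \<in> space loop1_borel. conformal_radius (inside (Some -` \<gamma>)) < q}"
    have "?W q \<in> sets loop1_borel" for q
    proof (rule upper_sets_Loop1)
      show "open D" if "D \<in> coef_witnesses n U q" for D
        using that open_compl_image_cball unfolding coef_witnesses_def by blast
    qed
    moreover have "?R q \<in> sets loop1_borel" for q
      using conformal_radius_measurable by measurable
    ultimately have "(\<Union>q\<in>\<rat>. ?R q \<inter> ?W q) \<in> sets loop1_borel"
      by (intro sets.countable_UN' countable_rat) auto
    also have "(\<Union>q\<in>\<rat>. ?R q \<inter> ?W q) = (\<lambda>\<gamma>. u_coord \<gamma> n) -` U \<inter> space loop1_borel"
    proof -
      have "\<gamma> \<in> (\<Union>q\<in>\<rat>. ?R q \<inter> ?W q) \<longleftrightarrow> u_coord \<gamma> n \<in> U" if g: "\<gamma> \<in> Loop1" for \<gamma>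
      proof -
        obtain K where K: "\<gamma> = Some ` K" "jordan_loop K"
          using g by (rule Loop1E)
        then show ?thesis
          using coef_in_open_iff[OF K(2) U, of n] g by (simp add: u_coord_Some inj_image_subset_iff)
      qed
      then show ?thesis by auto
    qed
    finally show "(\<lambda>\<gamma>. u_coord \<gamma> n) -` U \<inter> space loop1_borel \<in> sets loop1_borel" .
  qed
qed

section \<open>The maximal modulus of a loop\<close>

definition outer_radius :: "complex option set \<Rightarrow> real" where
  "outer_radius \<gamma> = (SUP z\<in>Some -` \<gamma>. cmod z)"

text \<open>By compactness the supremum is attained, so a strict bound is containment in an open
  disc, an open condition on the loop.\<close>

lemma outer_radius_less_iff:
  assumes J: "jordan_loop K"
  shows "outer_radius (Some ` K) < r \<longleftrightarrow> K \<subseteq> ball 0 r"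
proof -
  have "K \<noteq> {}"
    using jordan_loop_facts(3)[OF J] by auto
  moreover have "continuous_on K cmod"
    by (intro continuous_intros)
  ultimately obtain w where w: "w \<in> K" "\<And>z. z \<in> K \<Longrightarrow> cmod z \<le> cmod w"
    using continuous_attains_sup[OF jordan_loop_facts(1)[OF J]] by blast
  then have "outer_radius (Some ` K) = cmod w"
    unfolding outer_radius_def by (intro cSup_eq_maximum) auto
  then show ?thesis
    using w by fastforce
qed

lemma outer_radius_pos:
  assumes "\<gamma> \<in> Loop1"
  shows "0 < outer_radius \<gamma>"
proof -
  obtain K where K: "\<gamma> = Some ` K" "jordan_loop K"
    using assms by (rule Loop1E)
  have "K \<noteq> {}"
    using jordan_loop_facts(3)[OF K(2)] by auto
  then obtain z where "z \<in> K" "z \<noteq> 0"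
    using jordan_loop_facts(4)[OF K(2)] by (metis all_not_in_conv)
  then show ?thesis
    using outer_radius_less_iff[OF K(2), of "cmod z"] K(1) by (smt (verit) mem_ball_0 subsetD zero_less_norm_iff)
qed

lemma outer_radius_scale:
  assumes "\<gamma> \<in> Loop1" and c: "0 < c"
  shows "outer_radius (scale c ` \<gamma>) = c * outer_radius \<gamma>"
proof -
  obtain K where K: "\<gamma> = Some ` K" "jordan_loop K"
    using assms by (metis Loop1E)
  have "outer_radius (scale c ` \<gamma>) < r \<longleftrightarrow> c * outer_radius \<gamma> < r" for r
  proof -
    have "outer_radius (scale c ` \<gamma>) < r \<longleftrightarrow> (\<forall>z\<in>K. c * cmod z < r)"
      using outer_radius_less_iff[OF jordan_loop_scale(1)[OF K(2) c]] c
      by (auto simp: K(1) scale_Some_image norm_mult image_subset_iff)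
    also have "\<dots> \<longleftrightarrow> (\<forall>z\<in>K. cmod z < r / c)"
      using c by (simp add: field_simps)
    also have "\<dots> \<longleftrightarrow> outer_radius \<gamma> < r / c"
      using outer_radius_less_iff[OF K(2)] by (auto simp: K(1) subset_iff)
    also have "\<dots> \<longleftrightarrow> c * outer_radius \<gamma> < r"
      using c by (simp add: field_simps)
    finally show ?thesis .
  qed
  then show ?thesis
    by (metis less_irrefl linorder_neqE)
qed

lemma outer_radius_measurable: "outer_radius \<in> loop1_borel \<rightarrow>\<^sub>M rho_borel"
  unfolding rho_borel_def
proof (rule measurable_restrict_space2)
  show "outer_radius \<in> space loop1_borel \<rightarrow> {0<..}"
    using outer_radius_pos by auto
  show "outer_radius \<in> borel_measurable loop1_borel"
  proof (rule borel_measurableI_less)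
    fix r :: real
    have "{\<gamma> \<in> Loop1. outer_radius \<gamma> < r} \<in> sets loop1_borel"
      by (rule sets_loop1_borelI[of "{ball 0 r}"]) (simp_all add: outer_radius_less_iff)
    then show "{\<gamma> \<in> space loop1_borel. outer_radius \<gamma> < r} \<in> sets loop1_borel"
      by simp
  qed
qed

section \<open>Dilations on the space of loops\<close>

lemma scale_punctured_plane_loop:
  assumes "\<gamma> \<in> Loop punctured_plane" and c: "0 < c"
  shows "scale c ` \<gamma> \<in> Loop punctured_plane"
proof -
  obtain K where K: "\<gamma> = Some ` K" "K \<subseteq> UNIV - {0}" "compact K" "K homeomorphic sphere (0::complex) 1"
    using assms(1) unfolding Loop_sphere_domain by blast
  have m: "(*) (complex_of_real c) = (*\<^sub>R) c"
    by (auto simp: scaleR_conv_of_real)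
  have "compact ((*\<^sub>R) c ` K)"
    by (intro compact_scaling K)
  moreover have "K homeomorphic (*\<^sub>R) c ` K"
    using c by (intro homeomorphic_scaling) auto
  then have "(*\<^sub>R) c ` K homeomorphic sphere (0::complex) 1"
    using K(4) homeomorphic_sym homeomorphic_trans by blast
  moreover have "(*\<^sub>R) c ` K \<subseteq> UNIV - {0}"
    using K(2) c by auto
  ultimately show ?thesis
    unfolding Loop_sphere_domain K(1) scale_Some_image m by blast
qed

lemma scale_scale: "0 < c \<Longrightarrow> scale c ` scale (1 / c) ` \<gamma> = \<gamma>"
  by (auto simp: scale_def image_image option.map_comp o_def option.map_ident)

lemma scale_vimage_Some: "0 < c \<Longrightarrow> scale c -` Some ` V = Some ` ((\<lambda>z. of_real c * z) -` V)"
  by (auto simp: scale_def map_option_case split: option.splits)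

text \<open>Dilation is continuous for the Vietoris topology: the preimage of a subbasic set, of
  either kind, is the subbasic set of the same kind for the preimage of U.\<close>

lemma scale_measurable_loop_borel:
  assumes c: "0 < c"
  shows "(`) (scale c) \<in> loop_borel punctured_plane \<rightarrow>\<^sub>M loop_borel punctured_plane"
proof -
  have pre: "openin (surface_top punctured_plane) (scale c -` U)"
    if U: "openin (surface_top punctured_plane) U" for U
  proof -
    obtain V where V: "open V" "0 \<notin> V" "U = Some ` V"
      using U unfolding openin_punctured_plane by blast
    have "open ((\<lambda>z. of_real c * z) -` V)"
      by (intro continuous_open_vimage V continuous_intros)
    then show ?thesis
      unfolding openin_punctured_plane V(3) scale_vimage_Some[OF c] using V(2) by fastforce
  qed
  have cont: "continuous_map (vietoris punctured_plane) (vietoris punctured_plane) ((`) (scale c))"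
  proof -
    let ?L = "Loop punctured_plane" and ?T = "surface_top punctured_plane"
    let ?B = "{{\<gamma>\<in>?L. \<gamma> \<subseteq> U} |U. openin ?T U} \<union> {{\<gamma>\<in>?L. \<gamma> \<inter> U \<noteq> {}} |U. openin ?T U}"
    have "continuous_map (vietoris punctured_plane) (topology_generated_by ?B) ((`) (scale c))"
      unfolding continuous_on_generated_topo_iff
    proof (intro conjI allI impI)
      fix W assume "W \<in> ?B"
      then consider U where "openin ?T U" "W = {\<gamma>\<in>?L. \<gamma> \<subseteq> U}" | U where "openin ?T U" "W = {\<gamma>\<in>?L. \<gamma> \<inter> U \<noteq> {}}"
        by blast
      then show "openin (vietoris punctured_plane) ((`) (scale c) -` W \<inter> topspace (vietoris punctured_plane))"
      proof cases
        case (1 U)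
        have "(`) (scale c) -` W \<inter> topspace (vietoris punctured_plane) = {\<gamma>\<in>?L. \<gamma> \<subseteq> scale c -` U}"
          unfolding 1 topspace_vietoris using scale_punctured_plane_loop[OF _ c] by auto
        then show ?thesis
          unfolding vietoris_def using pre[OF 1(1)] by (auto intro!: topology_generated_by_Basis)
      next
        case (2 U)
        have "(`) (scale c) -` W \<inter> topspace (vietoris punctured_plane) = {\<gamma>\<in>?L. \<gamma> \<inter> scale c -` U \<noteq> {}}"
          unfolding 2 topspace_vietoris using scale_punctured_plane_loop[OF _ c] by auto
        then show ?thesis
          unfolding vietoris_def using pre[OF 2(1)] by (auto intro!: topology_generated_by_Basis)
      qed
    next
      show "(`) (scale c) ` topspace (vietoris punctured_plane) \<subseteq> \<Union>?B"
        using scale_punctured_plane_loop[OF _ c] topspace_vietoris[of punctured_plane]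
        unfolding vietoris_def topology_generated_by_topspace by auto
    qed
    then show ?thesis
      by (simp only: vietoris_def[of punctured_plane, symmetric])
  qed
  show ?thesis
    unfolding loop_borel_def[of punctured_plane]
  proof (rule measurable_measure_of)
    show "{W. openin (vietoris punctured_plane) W} \<subseteq> Pow (Loop punctured_plane)"
      using openin_subset topspace_vietoris by blast
    show "(`) (scale c) \<in> space (sigma (Loop punctured_plane) {W. openin (vietoris punctured_plane) W}) \<rightarrow> Loop punctured_plane"
      using scale_punctured_plane_loop[OF _ c] space_loop_borel[of punctured_plane] unfolding loop_borel_def by auto
    fix W assume "W \<in> {W. openin (vietoris punctured_plane) W}"
    then have "openin (vietoris punctured_plane) {\<gamma> \<in> topspace (vietoris punctured_plane). scale c ` \<gamma> \<in> W}"
      using cont by (auto simp: continuous_map_def)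
    then have "{\<gamma> \<in> Loop punctured_plane. scale c ` \<gamma> \<in> W} \<in> sets (loop_borel punctured_plane)"
      unfolding topspace_vietoris by (rule sets_loop_borel)
    then show "(`) (scale c) -` W \<inter> space (sigma (Loop punctured_plane) {W. openin (vietoris punctured_plane) W})
        \<in> sets (sigma (Loop punctured_plane) {W. openin (vietoris punctured_plane) W})"
      using space_loop_borel[of punctured_plane] unfolding loop_borel_def
      by (auto simp: vimage_def Int_def conj_commute)
  qed
qed

lemma scale_measurable_loop1_borel:
  assumes c: "0 < c"
  shows "(`) (scale c) \<in> loop1_borel \<rightarrow>\<^sub>M loop1_borel"
  unfolding loop1_borel_def
  by (rule measurable_restrict_space3[OF scale_measurable_loop_borel[OF c]]) (use Loop1_scale(1) c in auto)

section \<open>Consequences of conformal restriction and nontriviality\<close>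

lemma riemann_surface_punctured_plane: "riemann_surface punctured_plane"
  by (intro riemann_surface_sphere_domain connected_open_delete) auto

lemma riemann_surface_punctured_disc:
  assumes "0 < r"
  shows "riemann_surface (punctured_disc r)"
proof -
  have eq: "{z. 0 < cmod z \<and> cmod z < r} = ball 0 r - {0}"
    by auto
  have "complex_of_real (r / 2) \<in> ball 0 r - {0}"
    using assms by auto
  then have "ball 0 r - {0::complex} \<noteq> {}"
    by blast
  moreover have "connected (ball 0 r - {0::complex})"
    by (rule connected_open_delete) auto
  ultimately show ?thesis
    unfolding eq by (intro riemann_surface_sphere_domain) auto
qed

lemma conformal_restrictionD:
  assumes "conformal_restriction \<mu>" "riemann_surface S" "riemann_surface T" "conformal_embedding S T f"
    and "E \<in> sets (\<mu> S)"
  shows "emeasure (\<mu> S) E = emeasure (\<mu> T) ((`) f ` E)"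
  using assms unfolding conformal_restriction_def by blast

lemma emeasure_scale_image:
  assumes "conformal_restriction \<mu>" "0 < c" "E \<in> sets (\<mu> punctured_plane)"
  shows "emeasure (\<mu> punctured_plane) ((`) (scale c) ` E) = emeasure (\<mu> punctured_plane) E"
proof -
  have "conformal_embedding punctured_plane punctured_plane (scale c)"
    using assms(2) by (intro conformal_embedding_SomeI[of "\<lambda>z. of_real c * z"])
      (auto simp: scale_def inj_on_def intro!: holomorphic_intros)
  from conformal_restrictionD[OF assms(1) riemann_surface_punctured_plane riemann_surface_punctured_plane this assms(3)]
  show ?thesis by (rule sym)
qed

lemma inj_image_Some: "inj ((`) Some :: 'a set \<Rightarrow> 'a option set)"
  by (rule injI) (simp add: inj_image_eq_iff)

lemma Some_image_in_Loop_iff: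
  "Some ` K \<in> Loop (sphere_domain (Some ` D)) \<longleftrightarrow>
     K \<subseteq> D \<and> compact K \<and> K homeomorphic sphere (0::complex) 1"
  unfolding Loop_sphere_domain inj_image_mem_iff[OF inj_image_Some] by simp

lemma Some_image_in_Loop1_iff: "Some ` K \<in> Loop1 \<longleftrightarrow> jordan_loop K"
  unfolding Loop1_eq inj_image_mem_iff[OF inj_image_Some] by simp

text \<open>\<open>emeasure\<close> takes the default value 0 off the sigma-algebra, so positivity
  certifies measurability.\<close>

lemma emeasure_pos_imp_sets: "0 < emeasure M A \<Longrightarrow> A \<in> sets M"
  by (metis emeasure_notin_sets less_irrefl)

text \<open>Lying in the punctured disc of radius b means maximal modulus below b, and not lying in
  the disc of radius a means maximal modulus at least a. Restriction along the inclusion moves this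
  set to the punctured plane.\<close>

lemma nontrivial_witness:
  assumes fam: "loop_measure_family \<mu>" and cr: "conformal_restriction \<mu>" and nt: "nontrivial \<mu>"
  obtains a b where "0 < a" "a < b"
    "0 < emeasure (\<mu> punctured_plane) {\<gamma> \<in> Loop1. outer_radius \<gamma> \<in> {a..<b}}"
    "emeasure (\<mu> punctured_plane) {\<gamma> \<in> Loop1. outer_radius \<gamma> \<in> {a..<b}} < \<infinity>"
proof -
  obtain a b where ab: "0 < a" "a < b"
    and m: "0 < emeasure (\<mu> (punctured_disc b)) {\<gamma> \<in> Loop (punctured_disc b) - Loop (disc a). surrounds_0 \<gamma>}"
      "emeasure (\<mu> (punctured_disc b)) {\<gamma> \<in> Loop (punctured_disc b) - Loop (disc a). surrounds_0 \<gamma>} < \<infinity>"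
    using nt by (auto simp: nontrivial_def Let_def)
  let ?E = "{\<gamma> \<in> Loop (punctured_disc b) - Loop (disc a). surrounds_0 \<gamma>}"
  have E: "?E = {\<gamma> \<in> Loop1. outer_radius \<gamma> \<in> {a..<b}}"
  proof -
    have s: "surrounds_0 (Some ` K) \<longleftrightarrow> 0 \<in> inside K" for K
      by (simp add: surrounds_0_def)
    have "Some ` K \<in> ?E \<longleftrightarrow> Some ` K \<in> Loop1 \<and> outer_radius (Some ` K) \<in> {a..<b}" for K
    proof (cases "jordan_loop K")
      case True
      note facts = jordan_loop_facts[OF True]
      have "K \<subseteq> {z. 0 < cmod z \<and> cmod z < b} \<longleftrightarrow> outer_radius (Some ` K) < b"
        unfolding outer_radius_less_iff[OF True] using facts(4) by (auto simp: subset_iff)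
      moreover have "K \<subseteq> {z. cmod z < a} \<longleftrightarrow> outer_radius (Some ` K) < a"
        unfolding outer_radius_less_iff[OF True] by (auto simp: subset_iff)
      ultimately show ?thesis
        using True facts(1-3) by (auto simp: s Some_image_in_Loop_iff Some_image_in_Loop1_iff)
    next
      case False
      then show ?thesis
        by (auto simp: s Some_image_in_Loop_iff Some_image_in_Loop1_iff jordan_loop_def)
    qed
    moreover have "\<exists>K. \<gamma> = Some ` K" if "\<gamma> \<in> ?E \<or> \<gamma> \<in> Loop1" for \<gamma>
      using that unfolding Loop_sphere_domain Loop1_eq by auto
    ultimately have "\<gamma> \<in> ?E \<longleftrightarrow> \<gamma> \<in> {\<gamma> \<in> Loop1. outer_radius \<gamma> \<in> {a..<b}}" for \<gamma>
      by blast
    then show ?thesis by blast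
  qed
  have E_sets: "?E \<in> sets (\<mu> (punctured_disc b))"
    by (rule emeasure_pos_imp_sets[OF m(1)])
  have emb: "conformal_embedding (punctured_disc b) punctured_plane id"
    by (intro conformal_embedding_SomeI[of "\<lambda>z. z"]) (auto intro!: holomorphic_intros)
  have "0 < b"
    using ab by simp
  have "emeasure (\<mu> (punctured_disc b)) ?E = emeasure (\<mu> punctured_plane) ((`) id ` ?E)"
    by (rule conformal_restrictionD[OF cr riemann_surface_punctured_disc[OF \<open>0 < b\<close>]
          riemann_surface_punctured_plane emb E_sets])
  also have "(`) id ` ?E = {\<gamma> \<in> Loop1. outer_radius \<gamma> \<in> {a..<b}}"
    by (simp only: image_id id_apply E)
  finally have eq: "emeasure (\<mu> (punctured_disc b)) ?E =
      emeasure (\<mu> punctured_plane) {\<gamma> \<in> Loop1. outer_radius \<gamma> \<in> {a..<b}}" .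
  show thesis
    by (rule that[OF ab m[unfolded eq]])
qed

text \<open>Measurability of \<open>Loop1\<close> comes for free: a set of positive measure is measurable.\<close>

lemma Loop1_in_sets:
  assumes fam: "loop_measure_family \<mu>" and cr: "conformal_restriction \<mu>" and nt: "nontrivial \<mu>"
  shows "Loop1 \<in> sets (\<mu> punctured_plane)"
proof -
  obtain a b where ab: "0 < a" "a < b"
    and pos: "0 < emeasure (\<mu> punctured_plane) {\<gamma> \<in> Loop1. outer_radius \<gamma> \<in> {a..<b}}"
    by (rule nontrivial_witness[OF assms])
  let ?E = "{\<gamma> \<in> Loop1. outer_radius \<gamma> \<in> {a..<b}}"
  define r where "r = b / a"
  have r: "1 < r" "b = r * a"
    using ab by (auto simp: r_def)
  have E: "?E \<in> sets (\<mu> punctured_plane)"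
    by (rule emeasure_pos_imp_sets[OF pos])
  \<comment> \<open>Each dilate has the same positive measure by conformal restriction and is
    therefore measurable in its turn; countably many of them exhaust \<open>Loop1\<close>.\<close>
  have "(`) (scale (r powi k)) ` ?E \<in> sets (\<mu> punctured_plane)" for k
    using emeasure_scale_image[OF cr _ E, of "r powi k"] r pos by (intro emeasure_pos_imp_sets) simp
  then have "(\<Union>k::int. (`) (scale (r powi k)) ` ?E) \<in> sets (\<mu> punctured_plane)"
    by auto
  also have "(\<Union>k::int. (`) (scale (r powi k)) ` ?E) = Loop1"
  proof
    show "(\<Union>k::int. (`) (scale (r powi k)) ` ?E) \<subseteq> Loop1"
      using r by (auto intro!: Loop1_scale(1))
    show "Loop1 \<subseteq> (\<Union>k::int. (`) (scale (r powi k)) ` ?E)"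
    proof
      fix \<gamma> assume \<gamma>: "\<gamma> \<in> Loop1"
      define k where "k = \<lfloor>log r (outer_radius \<gamma> / a)\<rfloor>"
      have rk: "0 < r powi k" using r by simp
      have bounds: "r powi k * a \<le> outer_radius \<gamma>" "outer_radius \<gamma> < r powi k * b"
      proof -
        let ?l = "log r (outer_radius \<gamma> / a)"
        have "r powr of_int k \<le> r powr ?l"
          unfolding k_def using r by (intro powr_mono) auto
        moreover have "r powr ?l < r powr (of_int k + 1)"
          unfolding k_def using r by (intro powr_less_mono) auto
        moreover have "r powr ?l = outer_radius \<gamma> / a"
          using r outer_radius_pos[OF \<gamma>] ab by simp
        ultimately show "r powi k * a \<le> outer_radius \<gamma>" "outer_radius \<gamma> < r powi k * b"
          using r ab by (auto simp: powr_real_of_int' powr_add field_simps)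
      qed
      have "scale (1 / r powi k) ` \<gamma> \<in> ?E"
        using Loop1_scale(1)[OF \<gamma>, of "1 / r powi k"] outer_radius_scale[OF \<gamma>, of "1 / r powi k"] bounds rk
        by (simp add: field_simps)
      then show "\<gamma> \<in> (\<Union>k::int. (`) (scale (r powi k)) ` ?E)"
        using scale_scale[OF rk, of \<gamma>] by (metis (no_types, lifting) UN_iff UNIV_I imageI)
    qed
  qed
  finally show ?thesis .
qed

lemma scaling_action_mu0:
  assumes fam: "loop_measure_family \<mu>" and cr: "conformal_restriction \<mu>" and nt: "nontrivial \<mu>"
  shows "sets (mu0 \<mu>) = sets loop1_borel" "scaling_action (mu0 \<mu>) (\<lambda>c. (`) (scale c))"
    and "A \<in> sets (mu0 \<mu>) \<Longrightarrow> emeasure (mu0 \<mu>) A = emeasure (\<mu> punctured_plane) A"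
proof -
  have sets: "sets (\<mu> punctured_plane) = sets (loop_borel punctured_plane)"
    using fam riemann_surface_punctured_plane by (auto simp: loop_measure_family_def)
  show s0: "sets (mu0 \<mu>) = sets loop1_borel"
    unfolding mu0_def loop1_borel_def by (intro sets_restrict_space_cong sets)
  have space: "space (mu0 \<mu>) = Loop1"
    using sets_eq_imp_space_eq[OF s0] by simp
  note L1 = Loop1_in_sets[OF assms]
  have em: "emeasure (mu0 \<mu>) A = emeasure (\<mu> punctured_plane) A" "A \<in> sets (\<mu> punctured_plane)"
    if A: "A \<in> sets (mu0 \<mu>)" for A
  proof -
    have "A \<subseteq> Loop1"
      using sets.sets_into_space[OF A] space by simp
    then show "emeasure (mu0 \<mu>) A = emeasure (\<mu> punctured_plane) A"
      unfolding mu0_def using L1 sets.Int_space_eq2[OF L1] by (intro emeasure_restrict_space) auto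
    show "A \<in> sets (\<mu> punctured_plane)"
      using A L1 by (auto simp: mu0_def sets_restrict_space)
  qed
  show "A \<in> sets (mu0 \<mu>) \<Longrightarrow> emeasure (mu0 \<mu>) A = emeasure (\<mu> punctured_plane) A"
    by (rule em(1))
  show "scaling_action (mu0 \<mu>) (\<lambda>c. (`) (scale c))"
  proof
    fix c :: real assume c: "0 < c"
    show meas: "(`) (scale c) \<in> mu0 \<mu> \<rightarrow>\<^sub>M mu0 \<mu>"
      using scale_measurable_loop1_borel[OF c] measurable_cong_sets[OF s0 s0] by simp
    show "distr (mu0 \<mu>) (mu0 \<mu>) ((`) (scale c)) = mu0 \<mu>"
    proof (rule measure_eqI)
      fix A assume "A \<in> sets (distr (mu0 \<mu>) (mu0 \<mu>) ((`) (scale c)))"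
      then have A: "A \<in> sets (mu0 \<mu>)" by simp
      \<comment> \<open>Conformal restriction speaks about images and \<open>distr\<close> about
        preimages; dilation is invertible on \<open>Loop1\<close>, so the image of the preimage
        \<open>B\<close> is all of \<open>A\<close>.\<close>
      define B where "B = (`) (scale c) -` A \<inter> Loop1"
      have B: "B \<in> sets (mu0 \<mu>)"
        using measurable_sets[OF meas A] by (simp add: B_def space)
      have "(`) (scale c) ` B = A"
      proof
        show "(`) (scale c) ` B \<subseteq> A" by (auto simp: B_def)
        show "A \<subseteq> (`) (scale c) ` B"
        proof
          fix \<gamma> assume \<gamma>: "\<gamma> \<in> A"
          then have "\<gamma> \<in> Loop1"
            using sets.sets_into_space[OF A] space by auto
          then have "scale (1 / c) ` \<gamma> \<in> B"
            using \<gamma> c Loop1_scale(1)[of \<gamma> "1 / c"] scale_scale[OF c, of \<gamma>] by (simp add: B_def)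
          then show "\<gamma> \<in> (`) (scale c) ` B"
            using scale_scale[OF c, of \<gamma>] by (metis imageI)
        qed
      qed
      then have "emeasure (\<mu> punctured_plane) A = emeasure (\<mu> punctured_plane) B"
        using emeasure_scale_image[OF cr c em(2)[OF B]] by simp
      then show "emeasure (distr (mu0 \<mu>) (mu0 \<mu>) ((`) (scale c))) A = emeasure (mu0 \<mu>) A"
        using em(1)[OF A] em(1)[OF B] by (simp add: emeasure_distr[OF meas A] space B_def)
    qed simp
  qed
qed

theorem proposition2p4:
  fixes \<mu> :: "complex option surface \<Rightarrow> complex option set measure"
  assumes "loop_measure_family \<mu>"
    and "conformal_restriction \<mu>"
    and "nontrivial \<mu>"
  shows "bij_betw loop_coords Loop1 (u_set \<times> {0<..}) \<and>
         loop_coords \<in> measurable (mu0 \<mu>) (u_borel \<Otimes>\<^sub>M rho_borel) \<and>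
         (\<exists>\<nu>0 :: (nat \<Rightarrow> complex) measure.
            sets \<nu>0 = sets u_borel \<and>
            finite_measure \<nu>0 \<and>
            (\<exists>c::real. 0 < c \<and> prob_space (scale_measure (ennreal c) \<nu>0)) \<and>
            distr (mu0 \<mu>) (u_borel \<Otimes>\<^sub>M rho_borel) loop_coords = \<nu>0 \<Otimes>\<^sub>M drho_over_rho)"
proof -
  note s0 = scaling_action_mu0(1)[OF assms] and em = scaling_action_mu0(3)[OF assms]
  have space: "space (mu0 \<mu>) = Loop1"
    using sets_eq_imp_space_eq[OF s0] by simp
  interpret scaling_action "mu0 \<mu>" "\<lambda>c. (`) (scale c)"
    by (rule scaling_action_mu0(2)[OF assms])
  have u: "u_coord \<in> mu0 \<mu> \<rightarrow>\<^sub>M u_borel" and p: "rho_infinity \<in> mu0 \<mu> \<rightarrow>\<^sub>M rho_borel"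
    and q: "outer_radius \<in> mu0 \<mu> \<rightarrow>\<^sub>M rho_borel"
    using u_coord_measurable rho_infinity_measurable outer_radius_measurable measurable_cong_sets[OF s0 refl] by blast+
  have coords: "loop_coords = (\<lambda>\<gamma>. (u_coord \<gamma>, rho_infinity \<gamma>))"
    by (auto simp: loop_coords_def)
  have hom: "homogeneous rho_infinity" "homogeneous outer_radius"
    using p q Loop1_scale(3) outer_radius_scale by (auto simp: homogeneous_def space)
  obtain a b where ab: "0 < a" "a < b"
    and m: "0 < emeasure (\<mu> punctured_plane) {\<gamma> \<in> Loop1. outer_radius \<gamma> \<in> {a..<b}}"
      "emeasure (\<mu> punctured_plane) {\<gamma> \<in> Loop1. outer_radius \<gamma> \<in> {a..<b}} < \<infinity>"
    by (rule nontrivial_witness[OF assms])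
  \<comment> \<open>Measurability in the trace allows the bounds for \<mu> on the punctured plane to
    be read as bounds for \<mu>0.\<close>
  have "{\<gamma> \<in> Loop1. outer_radius \<gamma> \<in> {a..<b}} \<in> sets (mu0 \<mu>)"
    using measurable_sets[OF q Ico_in_rho_borel[OF ab(1), of b]]
    by (simp add: space vimage_def Int_def conj_commute)
  note m' = m[folded em[OF this], folded space]
  obtain \<nu> where \<nu>: "sets \<nu> = sets u_borel" "finite_measure \<nu>" "0 < emeasure \<nu> (space \<nu>)"
    "distr (mu0 \<mu>) (u_borel \<Otimes>\<^sub>M rho_borel) (\<lambda>x. (u_coord x, rho_infinity x)) = \<nu> \<Otimes>\<^sub>M drho_over_rho"
    \<comment> \<open>Here p is \<open>rho_infinity\<close>, the coordinate of the claim, and q is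
      \<open>outer_radius\<close>, for which positivity and finiteness are known.\<close>
    by (rule distr_product[OF hom u _ ab m']) (auto simp: space Loop1_scale(2))
  interpret \<nu>: finite_measure \<nu> by fact
  define c where "c = 1 / measure \<nu> (space \<nu>)"
  have pos: "0 < measure \<nu> (space \<nu>)"
    using \<nu>(3) by (simp add: \<nu>.emeasure_eq_measure)
  then have c: "0 < c" by (simp add: c_def)
  have "prob_space (scale_measure (ennreal c) \<nu>)"
  proof
    show "emeasure (scale_measure (ennreal c) \<nu>) (space (scale_measure (ennreal c) \<nu>)) = 1"
      using pos by (simp add: space_scale_measure \<nu>.emeasure_eq_measure c_def ennreal_mult[symmetric])
  qed
  moreover have "loop_coords \<in> mu0 \<mu> \<rightarrow>\<^sub>M u_borel \<Otimes>\<^sub>M rho_borel"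
    unfolding coords using u p by measurable
  ultimately show ?thesis
    using bij_betw_loop_coords \<nu>(1,2,4) c unfolding coords by blast
qed

end
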